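(* Let $\Gamma$ be a discrete group and let $k\ge1$. Then the following three conditions are equivalent: (1) $A(\Gamma)$ has an approximate unit $(\phi_\alpha)$ such that $\|\phi_\alpha\|_{M_0A(\Gamma)}\le k$ for all $\alpha$. (2) There exists a net $(T_\alpha)$ of finite rank operators on $C_r^*(\Gamma)$ such that $\|T_\alpha\|_{CB}\le k$ for all $\alpha$, and such that $\|T_\alpha x-x\|\to0$ for all $x\in C_r^*(\Gamma)$. (3) There exists a net $(T_\alpha)$ of $\sigma$-weakly continuous finite rank maps on $\mathfrak M(\Gamma)$ such that $\|T_\alpha\|_{CB}\le k$ for all $\alpha$, and such that $\langle\phi,T_\alpha x-x\rangle\to0$ for all $x\in\mathfrak M(\Gamma)$ and $\phi\in\mathfrak M(\Gamma)_*$.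
   Context: Let $\lambda$ be the left regular representation of $\Gamma$ on $\ell^2(\Gamma)$. $C_r^*(\Gamma)$ is the norm closure of the linear span of $\lambda(\Gamma)$ in $B(\ell^2(\Gamma))$ (reduced group $C^*$-algebra), and $\mathfrak M(\Gamma)=\lambda(\Gamma)''$ is the group von Neumann algebra, with predual $\mathfrak M(\Gamma)_*$. $\|\cdot\|_{CB}$ is the completely bounded norm of linear maps. The Fourier algebra $A(\Gamma)$ is the algebra of matrix coefficients $x\mapsto\langle\lambda(x)f,g\rangle$, $f,g\in\ell^2(\Gamma)$, under pointwise multiplication, with the norm $\|\phi\|_{A(\Gamma)}$ obtained by identifying $A(\Gamma)$ with $\mathfrak M(\Gamma)_*$ via $\phi(x)=\langle\phi,\lambda(x)\rangle$. A multiplier of $A(\Gamma)$ is a function $\phi$ on $\Gamma$ with $\phi\psi\in A(\Gamma)$ for all $\psi\in A(\Gamma)$; write $m_\phi:\psi\mapsto\phi\psi$. If the transposed operator $m_\phi^*$ on $\mathfrak M(\Gamma)$ is completely bounded, $\phi$ is a completely bounded multiplier; the space of these is $M_0A(\Gamma)$, and $\|\phi\|_{M_0A(\Gamma)}=\|m_\phi^*\|_{CB}$. An approximate unit in $A(\Gamma)$ is a net $(\phi_\alpha)$ in $A(\Gamma)$ with $\lim_\alpha\|\phi_\alpha\psi-\psi\|_{A(\Gamma)}=0$ for all $\psi\in A(\Gamma)$ (not necessarily bounded in $A(\Gamma)$-norm). *)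

theory Defs
  imports "HOL-Analysis.Analysis"
begin

section \<open>The Hilbert space of square summable functions\<close>

typedef 'a ell2 = "{f :: 'a \<Rightarrow> complex. (\<lambda>x. (cmod (f x))\<^sup>2) summable_on UNIV}"
  morphisms ell2_apply Abs_ell2
  by (rule exI[of _ "\<lambda>_. 0"]) simp

setup_lifting type_definition_ell2

lemma square_summable_prod:
  fixes f g :: "'a \<Rightarrow> complex"
  assumes "(\<lambda>x. (cmod (f x))\<^sup>2) summable_on UNIV" "(\<lambda>x. (cmod (g x))\<^sup>2) summable_on UNIV"
  shows "(\<lambda>x. cmod (f x) * cmod (g x)) summable_on UNIV"
proof (rule summable_on_comparison_test)
  show "(\<lambda>x. (cmod (f x))\<^sup>2 + (cmod (g x))\<^sup>2) summable_on UNIV"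
    using assms by (rule summable_on_add)
  show "cmod (f x) * cmod (g x) \<le> (cmod (f x))\<^sup>2 + (cmod (g x))\<^sup>2" for x
  proof -
    have "0 \<le> cmod (f x) * cmod (g x)" by simp
    then show ?thesis
      using sum_squares_bound[of "cmod (f x)" "cmod (g x)"] by linarith
  qed
qed auto

lemma square_summable_add:
  fixes f g :: "'a \<Rightarrow> complex"
  assumes "(\<lambda>x. (cmod (f x))\<^sup>2) summable_on UNIV" "(\<lambda>x. (cmod (g x))\<^sup>2) summable_on UNIV"
  shows "(\<lambda>x. (cmod (f x + g x))\<^sup>2) summable_on UNIV"
proof (rule summable_on_comparison_test)
  show "(\<lambda>x. ((cmod (f x))\<^sup>2 + (cmod (g x))\<^sup>2) + 2 * (cmod (f x) * cmod (g x))) summable_on UNIV"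
    by (intro summable_on_add summable_on_cmult_right assms square_summable_prod)
  show "(cmod (f x + g x))\<^sup>2 \<le> (cmod (f x))\<^sup>2 + (cmod (g x))\<^sup>2 + 2 * (cmod (f x) * cmod (g x))" for x
    using power_mono[OF norm_triangle_ineq[of "f x" "g x"], of 2] by (simp add: power2_sum)
qed auto

lift_definition ell2_scale :: "complex \<Rightarrow> 'a ell2 \<Rightarrow> 'a ell2" is "\<lambda>c f x. c * f x"
  by (simp add: norm_mult power_mult_distrib summable_on_cmult_right)

instantiation ell2 :: (type) real_vector
begin

lift_definition zero_ell2 :: "'a ell2" is "\<lambda>_. 0" by simp
lift_definition uminus_ell2 :: "'a ell2 \<Rightarrow> 'a ell2" is "\<lambda>f x. - f x" by simp
lift_definition plus_ell2 :: "'a ell2 \<Rightarrow> 'a ell2 \<Rightarrow> 'a ell2" is "\<lambda>f g x. f x + g x"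
  by (rule square_summable_add)
lift_definition minus_ell2 :: "'a ell2 \<Rightarrow> 'a ell2 \<Rightarrow> 'a ell2" is "\<lambda>f g x. f x - g x"
proof -
  fix f g :: "'a \<Rightarrow> complex"
  assume "(\<lambda>x. (cmod (f x))\<^sup>2) summable_on UNIV" "(\<lambda>x. (cmod (g x))\<^sup>2) summable_on UNIV"
  then show "(\<lambda>x. (cmod (f x - g x))\<^sup>2) summable_on UNIV"
    using square_summable_add[of f "\<lambda>x. - g x"] by simp
qed
lift_definition scaleR_ell2 :: "real \<Rightarrow> 'a ell2 \<Rightarrow> 'a ell2" is "\<lambda>r f x. r *\<^sub>R f x"
  by (simp add: power_mult_distrib summable_on_cmult_right)

instance
proof
  fix f g h :: "'a ell2" and r s :: real
  show "f + g + h = f + (g + h)" "f + g = g + f" "0 + f = f" "- f + f = 0" "f - g = f + - g"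
    by (transfer; simp add: fun_eq_iff)+
  show "r *\<^sub>R (f + g) = r *\<^sub>R f + r *\<^sub>R g" "(r + s) *\<^sub>R f = r *\<^sub>R f + s *\<^sub>R f"
    "r *\<^sub>R s *\<^sub>R f = (r * s) *\<^sub>R f" "1 *\<^sub>R f = f"
    by (transfer; simp add: fun_eq_iff algebra_simps)+
qed

end

instantiation ell2 :: (type) real_inner
begin

lift_definition inner_ell2 :: "'a ell2 \<Rightarrow> 'a ell2 \<Rightarrow> real" is "\<lambda>f g. \<Sum>\<^sub>\<infinity>x. f x \<bullet> g x" .

definition norm_ell2 :: "'a ell2 \<Rightarrow> real" where "norm_ell2 f = sqrt (f \<bullet> f)"
definition sgn_ell2 :: "'a ell2 \<Rightarrow> 'a ell2" where "sgn_ell2 f = f /\<^sub>R norm f"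
definition dist_ell2 :: "'a ell2 \<Rightarrow> 'a ell2 \<Rightarrow> real" where "dist_ell2 f g = norm (f - g)"
definition uniformity_ell2 :: "('a ell2 \<times> 'a ell2) filter" where
  "uniformity_ell2 = (INF e\<in>{0<..}. principal {(x, y). dist x y < e})"
definition open_ell2 :: "'a ell2 set \<Rightarrow> bool" where
  "open_ell2 U \<longleftrightarrow> (\<forall>x\<in>U. \<forall>\<^sub>F (x', y) in uniformity. x' = x \<longrightarrow> y \<in> U)"

lemma inner_summable_ell2:
  fixes f g :: "'a \<Rightarrow> complex"
  assumes "(\<lambda>x. (cmod (f x))\<^sup>2) summable_on UNIV" "(\<lambda>x. (cmod (g x))\<^sup>2) summable_on UNIV"
  shows "(\<lambda>x. f x \<bullet> g x) summable_on UNIV"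
proof (rule abs_summable_summable, rule summable_on_comparison_test)
  show "(\<lambda>x. cmod (f x) * cmod (g x)) summable_on UNIV"
    using assms by (rule square_summable_prod)
qed (auto simp: Cauchy_Schwarz_ineq2)

instance
proof
  fix f g h :: "'a ell2" and r s :: real
  show "sgn f = f /\<^sub>R norm f" by (rule sgn_ell2_def)
  show "dist f g = norm (f - g)" by (rule dist_ell2_def)
  show "(uniformity :: ('a ell2 \<times> 'a ell2) filter) = (INF e\<in>{0<..}. principal {(x, y). dist x y < e})"
    by (rule uniformity_ell2_def)
  show "open U \<longleftrightarrow> (\<forall>x\<in>U. \<forall>\<^sub>F (x', y) in uniformity. x' = x \<longrightarrow> y \<in> U)" for U :: "'a ell2 set"
    by (rule open_ell2_def)
  show "f \<bullet> g = g \<bullet> f" by transfer (simp add: inner_commute)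
  show "(f + g) \<bullet> h = f \<bullet> h + g \<bullet> h"
    by transfer (simp add: inner_add_left infsum_add inner_summable_ell2)
  show "(r *\<^sub>R f) \<bullet> g = r * (f \<bullet> g)"
    by transfer (simp add: infsum_cmult_right')
  show "0 \<le> f \<bullet> f" by transfer (simp add: infsum_nonneg)
  show "f \<bullet> f = 0 \<longleftrightarrow> f = 0"
  proof transfer
    fix f :: "'a \<Rightarrow> complex"
    assume f: "(\<lambda>x. (cmod (f x))\<^sup>2) summable_on UNIV"
    show "((\<Sum>\<^sub>\<infinity>x. f x \<bullet> f x) = 0) = (f = (\<lambda>_. 0))"
    proof
      assume "(\<Sum>\<^sub>\<infinity>x. f x \<bullet> f x) = 0"
      then have "f x \<bullet> f x = 0" for x
        using nonneg_infsum_le_0D[of "\<lambda>x. f x \<bullet> f x" UNIV x] inner_summable_ell2[OF f f] by simp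
      then show "f = (\<lambda>_. 0)" by (simp add: fun_eq_iff)
    qed simp
  qed
  show "norm f = sqrt (f \<bullet> f)" by (rule norm_ell2_def)
qed

end

lemma norm_ell2_eq: "norm f = sqrt (\<Sum>\<^sub>\<infinity>x. (cmod (ell2_apply f x))\<^sup>2)"
  unfolding norm_ell2_def by transfer (simp add: dot_square_norm)

text \<open>The class-provided \<^term>\<open>f \<bullet> g\<close> is the real part of the following complex inner
  product, which is linear in the first argument.\<close>

definition cinner :: "'a ell2 \<Rightarrow> 'a ell2 \<Rightarrow> complex" where
  "cinner f g = (\<Sum>\<^sub>\<infinity>x. ell2_apply f x * cnj (ell2_apply g x))"

lemma norm_ell2_scale: "norm (ell2_scale c f) = cmod c * norm f"
proof -
  have "(\<Sum>\<^sub>\<infinity>x. (cmod (ell2_apply (ell2_scale c f) x))\<^sup>2)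
      = (cmod c)\<^sup>2 * (\<Sum>\<^sub>\<infinity>x. (cmod (ell2_apply f x))\<^sup>2)"
    by (simp add: ell2_scale.rep_eq norm_mult power_mult_distrib infsum_cmult_right')
  then show ?thesis
    by (simp add: norm_ell2_eq real_sqrt_mult)
qed

lemma bounded_linear_ell2_scale: "bounded_linear (ell2_scale c)"
proof (rule bounded_linear_intro[where K = "cmod c"])
  show "ell2_scale c (f + g) = ell2_scale c f + ell2_scale c g" for f g :: "'a ell2"
    by transfer (simp add: fun_eq_iff algebra_simps)
  show "ell2_scale c (r *\<^sub>R f) = r *\<^sub>R ell2_scale c f" for r and f :: "'a ell2"
    by transfer (simp add: fun_eq_iff)
qed (simp add: norm_ell2_scale)


section \<open>Operators\<close>

text \<open>The library type of bounded operators is that of the real linear ones; the complex linear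
  ones are singled out by \<open>bounded_ops\<close>. Norms and topologies are not affected.\<close>

type_synonym 'a op = "'a ell2 \<Rightarrow>\<^sub>L 'a ell2"

definition bounded_ops :: "'a op set" where
  "bounded_ops = {T. \<forall>c f. blinfun_apply T (ell2_scale c f) = ell2_scale c (blinfun_apply T f)}"

definition op_scale :: "complex \<Rightarrow> 'a op \<Rightarrow> 'a op" where
  "op_scale c T = Blinfun (\<lambda>f. ell2_scale c (blinfun_apply T f))"

lemma op_scale_apply: "blinfun_apply (op_scale c T) f = ell2_scale c (blinfun_apply T f)"
  unfolding op_scale_def
  by (simp add: bounded_linear_Blinfun_apply
      bounded_linear_compose[OF bounded_linear_ell2_scale blinfun.bounded_linear_right])

global_interpretation op_complex: vector_space "op_scale :: complex \<Rightarrow> 'a op \<Rightarrow> 'a op"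
  defines op_span = op_complex.span
proof
  fix a b :: complex and x y :: "'a op"
  show "op_scale a (x + y) = op_scale a x + op_scale a y"
    by (rule blinfun_eqI)
      (simp add: op_scale_apply plus_blinfun.rep_eq linear_add bounded_linear.linear[OF bounded_linear_ell2_scale])
  show "op_scale (a + b) x = op_scale a x + op_scale b x"
  proof (rule blinfun_eqI)
    have "ell2_scale (a + b) f = ell2_scale a f + ell2_scale b f" for f :: "'a ell2"
      by transfer (simp add: fun_eq_iff algebra_simps)
    then show "blinfun_apply (op_scale (a + b) x) i = blinfun_apply (op_scale a x + op_scale b x) i" for i
      by (simp add: op_scale_apply plus_blinfun.rep_eq)
  qed
  show "op_scale a (op_scale b x) = op_scale (a * b) x"
  proof (rule blinfun_eqI)
    have "ell2_scale a (ell2_scale b f) = ell2_scale (a * b) f" for f :: "'a ell2"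
      by transfer (simp add: fun_eq_iff algebra_simps)
    then show "blinfun_apply (op_scale a (op_scale b x)) i = blinfun_apply (op_scale (a * b) x) i" for i
      by (simp add: op_scale_apply)
  qed
  show "op_scale 1 x = x"
  proof (rule blinfun_eqI)
    have "ell2_scale 1 f = f" for f :: "'a ell2"
      by transfer simp
    then show "blinfun_apply (op_scale 1 x) i = blinfun_apply x i" for i
      by (simp add: op_scale_apply)
  qed
qed

definition commutant :: "'a op set \<Rightarrow> 'a op set" where
  "commutant S = {T \<in> bounded_ops. \<forall>s\<in>S. T o\<^sub>L s = s o\<^sub>L T}"

definition clinear_on :: "'a op set \<Rightarrow> (complex \<Rightarrow> 'b \<Rightarrow> 'b) \<Rightarrow> ('a op \<Rightarrow> 'b::plus) \<Rightarrow> bool" where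
  "clinear_on V sc T \<longleftrightarrow>
     (\<forall>x\<in>V. \<forall>y\<in>V. T (x + y) = T x + T y) \<and> (\<forall>c. \<forall>x\<in>V. T (op_scale c x) = sc c (T x))"

definition linear_maps_on :: "'a op set \<Rightarrow> ('a op \<Rightarrow> 'a op) set" where
  "linear_maps_on V = {T. T ` V \<subseteq> V \<and> clinear_on V op_scale T}"

definition finite_rank_on :: "'a op set \<Rightarrow> ('a op \<Rightarrow> 'a op) \<Rightarrow> bool" where
  "finite_rank_on V T \<longleftrightarrow> (\<exists>B. finite B \<and> T ` V \<subseteq> op_span B)"

text \<open>The norm of the \<open>n \<times> n\<close> matrix \<open>a\<close> over \<open>B(H)\<close>, \<open>H\<close> being the Hilbert space above,
  as an operator on the \<open>n\<close>-fold direct sum of \<open>H\<close>. Only entries with indices below \<open>n\<close> matter.\<close>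

definition matrix_norm :: "nat \<Rightarrow> (nat \<Rightarrow> nat \<Rightarrow> 'a op) \<Rightarrow> real" where
  "matrix_norm n a =
     Sup {L2_set (\<lambda>i. norm (\<Sum>j<n. blinfun_apply (a i j) (\<xi> j))) {..<n} | \<xi>.
            L2_set (\<lambda>j. norm (\<xi> j)) {..<n} \<le> 1}"

text \<open>The completely bounded norm of a linear map from the operator space \<open>V\<close> to \<open>B(H)\<close>; it is
  infinite iff the map is not completely bounded.\<close>

definition cb_norm :: "'a op set \<Rightarrow> ('a op \<Rightarrow> 'a op) \<Rightarrow> ennreal" where
  "cb_norm V T =
     (SUP n. SUP a \<in> {a. (\<forall>i<n. \<forall>j<n. a i j \<in> V) \<and> matrix_norm n a \<le> 1}.
        ennreal (matrix_norm n (\<lambda>i j. T (a i j))))"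

definition normal_functional :: "(nat \<Rightarrow> 'a ell2) \<Rightarrow> (nat \<Rightarrow> 'a ell2) \<Rightarrow> 'a op \<Rightarrow> complex" where
  "normal_functional \<xi> \<eta> x = (\<Sum>n. cinner (blinfun_apply x (\<xi> n)) (\<eta> n))"

definition sigma_weak_topology :: "'a op topology" where
  "sigma_weak_topology = topology_generated_by
     {normal_functional \<xi> \<eta> -` U | \<xi> \<eta> U.
        summable (\<lambda>n. (norm (\<xi> n))\<^sup>2) \<and> summable (\<lambda>n. (norm (\<eta> n))\<^sup>2) \<and> open U}"


section \<open>The operator algebras of a discrete group\<close>

text \<open>The discrete group is a type of class \<^class>\<open>group_add\<close>. This class does not include
  commutativity; the group law is written additively, so \<open>x\<inverse>y\<close> reads \<^term>\<open>- x + y\<close>.\<close>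

lemma bij_left_translation: "bij (\<lambda>y. - x + y :: 'g::group_add)"
  by (rule bij_betw_byWitness[where f' = "\<lambda>y. x + y"]) (auto simp: add.assoc[symmetric])

lift_definition left_translate :: "'g::group_add \<Rightarrow> 'g ell2 \<Rightarrow> 'g ell2" is "\<lambda>x f y. f (- x + y)"
  by (subst summable_on_reindex_bij_betw[OF bij_left_translation])

lemma norm_left_translate: "norm (left_translate x f) = norm f"
  unfolding norm_ell2_eq left_translate.rep_eq
  by (subst infsum_reindex_bij_betw[OF bij_left_translation]) simp

lemma bounded_linear_left_translate: "bounded_linear (left_translate x)"
proof (rule bounded_linear_intro[where K = 1])
  fix f g :: "'a ell2" and r :: real
  show "left_translate x (f + g) = left_translate x f + left_translate x g"
    "left_translate x (r *\<^sub>R f) = r *\<^sub>R left_translate x f"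
    by (transfer; simp)+
qed (simp add: norm_left_translate)

definition left_regular :: "'g::group_add \<Rightarrow> 'g op" where
  "left_regular x = Blinfun (left_translate x)"

lemma left_regular_apply: "blinfun_apply (left_regular x) f = left_translate x f"
  by (simp add: left_regular_def bounded_linear_Blinfun_apply[OF bounded_linear_left_translate])

definition reduced_Cstar :: "'g::group_add op set" where
  "reduced_Cstar = closure (op_span (range left_regular))"

definition group_vN :: "'g::group_add op set" where
  "group_vN = commutant (commutant (range left_regular))"

definition sigma_weak_vN :: "'g::group_add op topology" where
  "sigma_weak_vN = subtopology sigma_weak_topology group_vN"

text \<open>Functionals on the von Neumann algebra are made \<^const>\<open>undefined\<close> off it, so that equality
  of functionals is equality in HOL.\<close>

definition vN_predual :: "('g::group_add op \<Rightarrow> complex) set" where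
  "vN_predual = {\<omega> \<in> extensional group_vN.
     clinear_on group_vN (*) \<omega> \<and> continuous_map sigma_weak_vN euclidean \<omega>}"

definition predual_norm :: "('g::group_add op \<Rightarrow> complex) \<Rightarrow> real" where
  "predual_norm \<omega> = Sup {cmod (\<omega> x) | x. x \<in> group_vN \<and> norm x \<le> 1}"


section \<open>The Fourier algebra and its multipliers\<close>

definition fourier_algebra :: "('g::group_add \<Rightarrow> complex) set" where
  "fourier_algebra = {\<lambda>x. cinner (blinfun_apply (left_regular x) f) g | f g. True}"

text \<open>The element of the predual identified with \<open>\<phi>\<close>; the value of the pairing of \<open>\<phi>\<close> with
  an operator \<open>x\<close> is then \<open>fourier_functional \<phi> x\<close>.\<close>

definition fourier_functional :: "('g::group_add \<Rightarrow> complex) \<Rightarrow> 'g op \<Rightarrow> complex" where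
  "fourier_functional \<phi> = (THE \<omega>. \<omega> \<in> vN_predual \<and> (\<forall>x. \<omega> (left_regular x) = \<phi> x))"

definition fourier_norm :: "('g::group_add \<Rightarrow> complex) \<Rightarrow> real" where
  "fourier_norm \<phi> = predual_norm (fourier_functional \<phi>)"

definition fourier_multipliers :: "('g::group_add \<Rightarrow> complex) set" where
  "fourier_multipliers = {\<phi>. \<forall>\<psi>\<in>fourier_algebra. (\<lambda>x. \<phi> x * \<psi> x) \<in> fourier_algebra}"

text \<open>The transpose of multiplication by a multiplier \<open>\<phi>\<close>, an operator on the von Neumann algebra
  regarded as the dual of the Fourier algebra.\<close>

definition multiplier_transpose :: "('g::group_add \<Rightarrow> complex) \<Rightarrow> 'g op \<Rightarrow> 'g op" where
  "multiplier_transpose \<phi> x = (THE y. y \<in> group_vN \<and>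
     (\<forall>\<psi>\<in>fourier_algebra. fourier_functional \<psi> y = fourier_functional (\<lambda>t. \<phi> t * \<psi> t) x))"

definition cb_multiplier_norm :: "('g::group_add \<Rightarrow> complex) \<Rightarrow> ennreal" where
  "cb_multiplier_norm \<phi> = cb_norm group_vN (multiplier_transpose \<phi>)"

definition cb_multipliers :: "('g::group_add \<Rightarrow> complex) set" where
  "cb_multipliers = {\<phi> \<in> fourier_multipliers. cb_multiplier_norm \<phi> < \<infinity>}"


section \<open>Nets\<close>

definition directed :: "'i set \<Rightarrow> ('i \<Rightarrow> 'i \<Rightarrow> bool) \<Rightarrow> bool" where
  "directed I le \<longleftrightarrow> I \<noteq> {} \<and> reflp_on I le \<and> transp_on I le \<and>
     (\<forall>a\<in>I. \<forall>b\<in>I. \<exists>c\<in>I. le a c \<and> le b c)"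

definition net_filter :: "'i set \<Rightarrow> ('i \<Rightarrow> 'i \<Rightarrow> bool) \<Rightarrow> 'i filter" where
  "net_filter I le = (INF a\<in>I. principal {b \<in> I. le a b})"

lemma eventually_net_filter:
  assumes "directed I le"
  shows "eventually P (net_filter I le) \<longleftrightarrow> (\<exists>a\<in>I. \<forall>b\<in>I. le a b \<longrightarrow> P b)"
  unfolding net_filter_def
proof (subst eventually_INF_base)
  show "I \<noteq> {}" using assms by (simp add: directed_def)
  fix a b assume "a \<in> I" "b \<in> I"
  then obtain c where c: "c \<in> I" "le a c" "le b c"
    using assms by (auto simp: directed_def)
  moreover have "transp_on I le" using assms by (simp add: directed_def)
  ultimately have "{d \<in> I. le c d} \<subseteq> {d \<in> I. le a d} \<inter> {d \<in> I. le b d}"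
    using \<open>a \<in> I\<close> \<open>b \<in> I\<close> by (auto dest: transp_onD)
  then show "\<exists>x\<in>I. principal {b \<in> I. le x b}
      \<le> inf (principal {b \<in> I. le a b}) (principal {d \<in> I. le b d})"
    using c(1) by auto
qed (auto simp: eventually_principal)

text \<open>A formula can only quantify over nets with indices in a fixed type. Fixing it loses nothing:
  if the net is to satisfy conditions of the form \<open>d p (f i) \<longlongrightarrow> 0\<close> with parameters
  \<open>p :: 'p\<close>, the index type \<^typ>\<open>'p set \<times> nat\<close> can replace any other.\<close>

lemma net_canonical_index:
  fixes J :: "'j set" and d :: "'p \<Rightarrow> 'x \<Rightarrow> 'c::real_normed_vector"
  assumes J: "directed J le" and Q: "\<forall>j\<in>J. Q (f j)"
    and lim: "\<forall>p\<in>S. ((\<lambda>j. d p (f j)) \<longlongrightarrow> 0) (net_filter J le)"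
  shows "\<exists>(I :: ('p set \<times> nat) set) le' g. directed I le' \<and> (\<forall>i\<in>I. Q (g i)) \<and>
           (\<forall>p\<in>S. ((\<lambda>i. d p (g i)) \<longlongrightarrow> 0) (net_filter I le'))"
proof -
  define I where "I = {F :: 'p set. finite F \<and> F \<subseteq> S} \<times> (UNIV :: nat set)"
  define le' where "le' = (\<lambda>(F :: 'p set, m :: nat) (G, n). F \<subseteq> G \<and> m \<le> n)"
  have dI: "directed I le'"
    unfolding directed_def
  proof (intro conjI ballI)
    show "I \<noteq> {}" by (auto simp: I_def)
    show "reflp_on I le'" "transp_on I le'"
      by (auto simp: le'_def reflp_on_def transp_on_def)
    fix a b assume "a \<in> I" "b \<in> I"
    then show "\<exists>c\<in>I. le' a c \<and> le' b c"
      by (intro bexI[of _ "(fst a \<union> fst b, max (snd a) (snd b))"]) (auto simp: I_def le'_def)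
  qed
  have "\<exists>x. Q x \<and> (\<forall>p\<in>fst i. norm (d p x) < inverse (real (Suc (snd i))))" if "i \<in> I" for i
  proof -
    have "\<forall>\<^sub>F j in net_filter J le. \<forall>p\<in>fst i. norm (d p (f j)) < inverse (real (Suc (snd i)))"
    proof (rule eventually_ball_finite)
      show "finite (fst i)" using that by (auto simp: I_def)
      show "\<forall>p\<in>fst i. \<forall>\<^sub>F j in net_filter J le. norm (d p (f j)) < inverse (real (Suc (snd i)))"
      proof
        fix p assume "p \<in> fst i"
        then have "((\<lambda>j. d p (f j)) \<longlongrightarrow> 0) (net_filter J le)"
          using that lim by (auto simp: I_def)
        then show "\<forall>\<^sub>F j in net_filter J le. norm (d p (f j)) < inverse (real (Suc (snd i)))"
          by (auto simp: tendsto_iff)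
      qed
    qed
    then obtain a where a: "a \<in> J" and
      "\<forall>b\<in>J. le a b \<longrightarrow> (\<forall>p\<in>fst i. norm (d p (f b)) < inverse (real (Suc (snd i))))"
      unfolding eventually_net_filter[OF J] by blast
    moreover have "le a a" using J a by (auto simp: directed_def reflp_on_def)
    ultimately show ?thesis using Q by blast
  qed
  then obtain g where g: "\<And>i. i \<in> I \<Longrightarrow> Q (g i)"
    "\<And>i p. i \<in> I \<Longrightarrow> p \<in> fst i \<Longrightarrow> norm (d p (g i)) < inverse (real (Suc (snd i)))"
    by metis
  have "((\<lambda>i. d p (g i)) \<longlongrightarrow> 0) (net_filter I le')" if "p \<in> S" for p
    unfolding tendsto_iff eventually_net_filter[OF dI]
  proof (intro allI impI)
    fix e :: real assume "0 < e"
    then obtain n where n: "inverse (real (Suc n)) < e" using reals_Archimedean by blast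
    show "\<exists>a\<in>I. \<forall>b\<in>I. le' a b \<longrightarrow> dist (d p (g b)) 0 < e"
    proof (intro bexI[of _ "({p}, n)"] ballI impI)
      show "({p}, n) \<in> I" using that by (auto simp: I_def)
      fix b assume b: "b \<in> I" "le' ({p}, n) b"
      then have "p \<in> fst b" "n \<le> snd b" by (auto simp: le'_def)
      then have "norm (d p (g b)) < inverse (real (Suc (snd b)))" using g(2) b by blast
      also have "\<dots> \<le> inverse (real (Suc n))" using \<open>n \<le> snd b\<close> by (simp add: le_imp_inverse_le)
      finally show "dist (d p (g b)) 0 < e" using n by simp
    qed
  qed
  then show ?thesis using dI g(1) by blast
qed

end

theory Submission
  imports Defs
begin

text \<open>All three conditions are equivalent to the existence of functions \<open>\<phi>\<close> in the Fourier algebra that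
  converge to 1 pointwise and whose Schur multipliers \<open>M\<^sub>\<phi> : (a\<^sub>t\<^sub>s) \<mapsto> (\<phi>(t - s) a\<^sub>t\<^sub>s)\<close> on the group von
  Neumann algebra have completely bounded norm at most \<open>k\<close>. The transpose of multiplication by \<open>\<phi>\<close> is
  \<open>M\<^sub>\<phi>\<close>. Truncating the two vectors of which \<open>\<phi>\<close> is a coefficient and rescaling, one may take \<open>\<phi>\<close>
  finitely supported, and then \<open>M\<^sub>\<phi>\<close> has finite rank and is \<open>\<sigma>\<close>-weakly continuous; uniform boundedness turns
  pointwise convergence into convergence in each of the three topologies. Conversely, a finite rank map \<open>T\<close> on
  either algebra yields \<open>\<phi>(x) = \<langle>T \<lambda>(x) \<delta>\<^sub>0, \<delta>\<^sub>x\<rangle>\<close>, which is square summable, hence in the Fourier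
  algebra, and satisfies \<open>\<parallel>M\<^sub>\<phi>\<parallel>\<^sub>c\<^sub>b \<le> \<parallel>T\<parallel>\<^sub>c\<^sub>b\<close>.\<close>

section \<open>Square summable functions\<close>

text \<open>The transpose of a multiplier is given only by a description, in terms of functionals
  that are themselves only described. Both become computable once a normal functional on the von
  Neumann algebra is known to be determined by its values at the \<lambda>(p). This is the density
  theorem for functionals, and it is proved in the classical way: amplify to countably many copies
  of the Hilbert space and project onto an invariant subspace. From there on everything is an
  estimate on scalar matrices. Finite rank is used through one fact: on a finite dimensional space
  of square summable functions, the norm of evaluation at x is square summable in x. The bound on M
  for the \<phi> of a finite rank map looks at T on multiples of the \<lambda>(p) only, so a map on
  the reduced C*-algebra controls a multiplier of the whole von Neumann algebra without being
  extended. Truncating the two vectors raises the completely bounded norm by at most some small d;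
  the factor k/(k + d) restores the bound k and is itself within d of 1.\<close>

lemma ell2_eqI: "(\<And>x. ell2_apply f x = ell2_apply g x) \<Longrightarrow> f = g"
  using ell2_apply_inject[of f g] by (simp add: fun_eq_iff)

lemma ell2_apply_simps [simp]:
  "ell2_apply 0 x = 0"
  "ell2_apply (f + g) x = ell2_apply f x + ell2_apply g x"
  "ell2_apply (f - g) x = ell2_apply f x - ell2_apply g x"
  "ell2_apply (- f) x = - ell2_apply f x"
  "ell2_apply (r *\<^sub>R f) x = r *\<^sub>R ell2_apply f x"
  "ell2_apply (ell2_scale c f) x = c * ell2_apply f x"
  by (transfer; simp)+

lemma ell2_apply_sum [simp]: "ell2_apply (sum f A) x = (\<Sum>i\<in>A. ell2_apply (f i) x)"
  by (induction A rule: infinite_finite_induct) auto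

lemma ell2_scale_simps [simp]:
  "ell2_scale c (f + g) = ell2_scale c f + ell2_scale c g"
  "ell2_scale c (f - g) = ell2_scale c f - ell2_scale c g"
  "ell2_scale c 0 = 0" "ell2_scale 0 f = 0" "ell2_scale 1 f = f"
  "ell2_scale a (ell2_scale b f) = ell2_scale (a * b) f"
  by (rule ell2_eqI; simp add: algebra_simps)+

lemma ell2_scale_sum: "ell2_scale c (sum f A) = (\<Sum>i\<in>A. ell2_scale c (f i))"
  by (rule ell2_eqI) (simp add: sum_distrib_left)

lemma scaleR_eq_ell2_scale: "r *\<^sub>R f = ell2_scale (of_real r) f"
  by (rule ell2_eqI) (simp add: scaleR_conv_of_real)

lemma ell2_summable: "(\<lambda>x. (cmod (ell2_apply f x))\<^sup>2) summable_on UNIV"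
  using ell2_apply[of f] by simp

lemma norm_ell2_power2: "(norm f)\<^sup>2 = (\<Sum>\<^sub>\<infinity>x. (cmod (ell2_apply f x))\<^sup>2)"
  by (simp add: norm_ell2_eq infsum_nonneg)

lemma ell2_has_sum_norm: "((\<lambda>x. (cmod (ell2_apply f x))\<^sup>2) has_sum (norm f)\<^sup>2) UNIV"
  using ell2_summable[of f] by (simp add: norm_ell2_power2)

lemma ell2_sum_le_norm: "finite F \<Longrightarrow> (\<Sum>x\<in>F. (cmod (ell2_apply f x))\<^sup>2) \<le> (norm f)\<^sup>2"
  unfolding norm_ell2_power2 by (rule finite_sum_le_infsum[OF ell2_summable]) auto

lemma cmod_ell2_apply_le: "cmod (ell2_apply f x) \<le> norm f"
  using ell2_sum_le_norm[of "{x}" f] by (simp add: power2_le_iff_abs_le)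

text \<open>Membership and norm are both controlled by finite partial sums, so a vector can be given
  by its coordinates together with bounds on finite sets.\<close>

lemma ell2_exI:
  assumes "\<And>F. finite F \<Longrightarrow> (\<Sum>x\<in>F. (cmod (h x))\<^sup>2) \<le> C\<^sup>2" "0 \<le> C"
  obtains f where "ell2_apply f = h" "norm f \<le> C"
proof -
  have s: "(\<lambda>x. (cmod (h x))\<^sup>2) summable_on UNIV"
    by (rule nonneg_bdd_above_summable_on) (auto intro!: bdd_aboveI[of _ "C\<^sup>2"] assms)
  define f where "f = Abs_ell2 h"
  have f: "ell2_apply f = h" using s by (simp add: f_def Abs_ell2_inverse)
  have "(norm f)\<^sup>2 \<le> C\<^sup>2"
    unfolding norm_ell2_power2 f by (rule infsum_le_finite_sums[OF s assms(1)])
  then have "norm f \<le> C" using assms(2) by (simp add: power2_le_iff_abs_le)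
  then show ?thesis using f that by blast
qed

section \<open>The complex inner product and the Cauchy-Schwarz inequality\<close>

lemma cinner_abs_summable: "(\<lambda>x. cmod (ell2_apply f x * cnj (ell2_apply g x))) summable_on UNIV"
  using square_summable_prod[OF ell2_summable ell2_summable] by (simp add: norm_mult)

lemma cinner_summable: "(\<lambda>x. ell2_apply f x * cnj (ell2_apply g x)) summable_on UNIV"
  by (rule abs_summable_summable[OF cinner_abs_summable])

lemma cinner_has_sum: "((\<lambda>x. ell2_apply f x * cnj (ell2_apply g x)) has_sum cinner f g) UNIV"
  unfolding cinner_def by (rule has_sum_infsum[OF cinner_summable])

lemma cinner_add_left: "cinner (f + g) h = cinner f h + cinner g h"
  unfolding cinner_def by (simp add: distrib_right infsum_add cinner_summable)

lemma cinner_add_right: "cinner h (f + g) = cinner h f + cinner h g"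
  unfolding cinner_def by (simp add: distrib_left infsum_add cinner_summable)

lemma cinner_scale_left [simp]: "cinner (ell2_scale c f) g = c * cinner f g"
  unfolding cinner_def by (simp add: infsum_cmult_right' mult.assoc)

lemma cinner_scale_right [simp]: "cinner f (ell2_scale c g) = cnj c * cinner f g"
  unfolding cinner_def by (simp add: infsum_cmult_right' mult.left_commute)

lemma cinner_cnj: "cnj (cinner f g) = cinner g f"
  unfolding cinner_def infsum_cnj[symmetric] by (simp add: mult.commute)

lemma cinner_self: "cinner f f = of_real ((norm f)\<^sup>2)"
proof (rule has_sum_unique[OF cinner_has_sum])
  show "((\<lambda>x. ell2_apply f x * cnj (ell2_apply f x)) has_sum complex_of_real ((norm f)\<^sup>2)) UNIV"
    using has_sum_of_real[OF ell2_has_sum_norm[of f], where 'a = complex]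
    by (simp only: complex_norm_square)
qed

lemma Re_cinner: "Re (cinner f g) = f \<bullet> g"
proof -
  have "Re (cinner f g) = (\<Sum>\<^sub>\<infinity>x. Re (ell2_apply f x * cnj (ell2_apply g x)))"
    unfolding cinner_def by (rule infsum_Re[OF cinner_summable, symmetric])
  then show ?thesis by (simp add: inner_ell2.rep_eq inner_complex_def)
qed

lemma cmod_cinner_le: "cmod (cinner f g) \<le> norm f * norm g"
proof -
  \<comment> \<open>A phase that makes the inner product real and nonnegative reduces the claim to
    the real Cauchy-Schwarz inequality.\<close>
  obtain u where u: "cmod u = 1" "u * cinner f g = of_real (cmod (cinner f g))"
  proof (cases "cinner f g = 0")
    case False
    then show ?thesis
      by (intro that[of "cnj (cinner f g) / of_real (cmod (cinner f g))"])
        (auto simp: norm_divide complex_norm_square[symmetric] field_simps power2_eq_square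
          simp flip: of_real_mult complex_norm_square)
  qed (use that[of 1] in auto)
  have "cmod (cinner f g) = Re (cinner (ell2_scale u f) g)" by (simp add: u)
  also have "\<dots> \<le> norm (ell2_scale u f) * norm g"
    unfolding Re_cinner by (rule norm_cauchy_schwarz)
  finally show ?thesis by (simp add: norm_ell2_scale u)
qed

lemma bounded_bilinear_cinner: "bounded_bilinear cinner"
proof
  show "\<exists>K. \<forall>a b. norm (cinner a b) \<le> norm a * norm b * K"
    by (intro exI[of _ 1]) (simp add: cmod_cinner_le)
qed (auto simp: cinner_add_left cinner_add_right scaleR_eq_ell2_scale scaleR_conv_of_real)

lemmas bounded_linear_cinner_left = bounded_bilinear.bounded_linear_left[OF bounded_bilinear_cinner]
lemmas cinner_zero [simp] = bounded_bilinear.zero_left[OF bounded_bilinear_cinner]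
  bounded_bilinear.zero_right[OF bounded_bilinear_cinner]
lemmas cinner_diff_left = bounded_bilinear.diff_left[OF bounded_bilinear_cinner]
lemmas cinner_diff_right = bounded_bilinear.diff_right[OF bounded_bilinear_cinner]
lemmas cinner_sum_left = bounded_bilinear.sum_left[OF bounded_bilinear_cinner]
lemmas tendsto_cinner = bounded_bilinear.tendsto[OF bounded_bilinear_cinner]

section \<open>Finitely supported vectors, truncation and completeness\<close>

lemma bounded_linear_ell2_apply: "bounded_linear (\<lambda>f. ell2_apply f x)"
  by (rule bounded_linear_intro[where K = 1]) (auto simp: cmod_ell2_apply_le)

text \<open>The test for finiteness sits inside the function to make the lifting total; an infinite
  \<open>F\<close> gives the zero vector.\<close>

lift_definition ell2_fin :: "'a set \<Rightarrow> ('a \<Rightarrow> complex) \<Rightarrow> 'a ell2" is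
  "\<lambda>F h x. if finite F \<and> x \<in> F then h x else 0"
proof -
  fix F :: "'a set" and h :: "'a \<Rightarrow> complex"
  show "(\<lambda>x. (cmod (if finite F \<and> x \<in> F then h x else 0))\<^sup>2) summable_on UNIV"
    by (cases "finite F")
      (auto intro!: finite_nonzero_values_imp_summable_on elim: rev_finite_subset split: if_splits)
qed

lemma ell2_apply_fin [simp]: "finite F \<Longrightarrow> ell2_apply (ell2_fin F h) x = (if x \<in> F then h x else 0)"
  by (simp add: ell2_fin.rep_eq)

definition delta :: "'a \<Rightarrow> 'a ell2" where "delta s = ell2_fin {s} (\<lambda>_. 1)"

lemma ell2_apply_delta [simp]: "ell2_apply (delta s) x = (if x = s then 1 else 0)"
  by (simp add: delta_def)

lemma ell2_fin_eq_sum: "finite F \<Longrightarrow> ell2_fin F h = (\<Sum>s\<in>F. ell2_scale (h s) (delta s))"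
  by (rule ell2_eqI) (simp add: if_distrib sum.delta cong: if_cong)

lemma cinner_fin_right: "finite F \<Longrightarrow> cinner f (ell2_fin F h) = (\<Sum>t\<in>F. ell2_apply f t * cnj (h t))"
  unfolding cinner_def
  by (rule infsumI, rule has_sum_finite_neutralI[of F]) (auto intro!: sum.cong)

lemma cinner_delta [simp]: "cinner f (delta s) = ell2_apply f s"
  by (simp add: delta_def cinner_fin_right)

lemma norm_fin_power2: "finite F \<Longrightarrow> (norm (ell2_fin F h))\<^sup>2 = (\<Sum>t\<in>F. (cmod (h t))\<^sup>2)"
  unfolding norm_ell2_power2
  by (rule infsumI, rule has_sum_finite_neutralI[of F]) (auto intro!: sum.cong)

lemma norm_fin: "finite F \<Longrightarrow> norm (ell2_fin F h) = L2_set (\<lambda>t. cmod (h t)) F"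
  by (simp add: norm_fin_power2[symmetric] L2_set_def)

lemma norm_delta [simp]: "norm (delta s) = 1"
  by (simp add: delta_def norm_fin L2_set_def)

text \<open>Pythagoras: the squared norm of the remainder is that of \<open>f\<close> minus the
  partial sum over \<open>F\<close>, and the partial sums converge to the squared norm of
  \<open>f\<close>.\<close>

lemma truncate_tendsto:
  "((\<lambda>F. ell2_fin F (ell2_apply f)) \<longlongrightarrow> f) (finite_subsets_at_top UNIV)"
proof -
  have eq: "(norm (f - ell2_fin F (ell2_apply f)))\<^sup>2
      = (norm f)\<^sup>2 - (\<Sum>x\<in>F. (cmod (ell2_apply f x))\<^sup>2)" if F: "finite F" for F
  proof -
    let ?g = "ell2_fin F (ell2_apply f)"
    have "((\<lambda>x. (cmod (ell2_apply f x))\<^sup>2 - (if x \<in> F then (cmod (ell2_apply f x))\<^sup>2 else 0)) has_sum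
        (norm f)\<^sup>2 - (\<Sum>x\<in>F. (cmod (ell2_apply f x))\<^sup>2)) UNIV"
      using has_sum_add[OF ell2_has_sum_norm[of f] has_sum_uminusI[OF has_sum_finite_neutralI[of F UNIV
        "\<lambda>x. (if x \<in> F then (cmod (ell2_apply f x))\<^sup>2 else 0)"]]] F by simp
    moreover have "(cmod (ell2_apply (f - ?g) x))\<^sup>2
        = (cmod (ell2_apply f x))\<^sup>2 - (if x \<in> F then (cmod (ell2_apply f x))\<^sup>2 else 0)" for x
      using F by simp
    ultimately show ?thesis
      using ell2_has_sum_norm[of "f - ?g"] by (auto intro: has_sum_unique)
  qed
  have "((\<lambda>F. \<Sum>x\<in>F. (cmod (ell2_apply f x))\<^sup>2) \<longlongrightarrow> (norm f)\<^sup>2) (finite_subsets_at_top UNIV)"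
    using ell2_has_sum_norm by (simp add: has_sum_def)
  then have "((\<lambda>F. (norm f)\<^sup>2 - (\<Sum>x\<in>F. (cmod (ell2_apply f x))\<^sup>2)) \<longlongrightarrow> (norm f)\<^sup>2 - (norm f)\<^sup>2)
      (finite_subsets_at_top UNIV)"
    by (intro tendsto_intros)
  then have "((\<lambda>F. sqrt ((norm (f - ell2_fin F (ell2_apply f)))\<^sup>2)) \<longlongrightarrow> sqrt 0) (finite_subsets_at_top UNIV)"
    by (intro tendsto_real_sqrt, subst tendsto_cong)
      (auto intro!: eventually_finite_subsets_at_top_weakI simp: eq)
  then have "((\<lambda>F. norm (ell2_fin F (ell2_apply f) - f)) \<longlongrightarrow> 0) (finite_subsets_at_top UNIV)"
    by (simp add: norm_minus_commute)
  then show ?thesis using LIM_zero_iff tendsto_norm_zero_iff by blast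
qed

lemma truncate_close:
  assumes "0 < e"
  obtains F where "finite F" "norm (f - ell2_fin F (ell2_apply f)) < e"
proof -
  have "eventually (\<lambda>F. dist (ell2_fin F (ell2_apply f)) f < e) (finite_subsets_at_top UNIV)"
    using truncate_tendsto assms by (rule tendstoD)
  then show ?thesis
    using that by (auto simp: eventually_finite_subsets_at_top dist_norm norm_minus_commute)
qed

lemma norm_truncate_le: "finite F \<Longrightarrow> norm (ell2_fin F (ell2_apply f)) \<le> norm f"
  using ell2_sum_le_norm[of F f] by (simp add: norm_fin_power2[symmetric] power2_le_iff_abs_le)

text \<open>Completeness is wanted for orthogonal projections. Coordinates of a Cauchy sequence
  converge, and the Cauchy estimate on each finite set of coordinates survives the limit.\<close>

lemma complete_ell2: "Cauchy (X :: nat \<Rightarrow> 'a ell2) \<Longrightarrow> convergent X"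
proof -
  assume X: "Cauchy X"
  have "Cauchy (\<lambda>n. ell2_apply (X n) x)" for x
    using bounded_linear.Cauchy[OF bounded_linear_ell2_apply X] .
  then obtain h where h: "\<And>x. (\<lambda>n. ell2_apply (X n) x) \<longlonglongrightarrow> h x"
    unfolding Cauchy_convergent_iff convergent_def by metis
  have fin: "(\<Sum>x\<in>F. (cmod (h x - ell2_apply (X m) x))\<^sup>2) \<le> e\<^sup>2"
    if e: "0 < e" "\<forall>n\<ge>m. norm (X n - X m) \<le> e" and F: "finite F" for e m F
  proof (rule LIMSEQ_le_const2)
    show "(\<lambda>n. \<Sum>x\<in>F. (cmod (ell2_apply (X n) x - ell2_apply (X m) x))\<^sup>2)
        \<longlonglongrightarrow> (\<Sum>x\<in>F. (cmod (h x - ell2_apply (X m) x))\<^sup>2)"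
      by (intro tendsto_intros h)
    have "(\<Sum>x\<in>F. (cmod (ell2_apply (X n) x - ell2_apply (X m) x))\<^sup>2) \<le> e\<^sup>2" if "n \<ge> m" for n
    proof -
      have "(\<Sum>x\<in>F. (cmod (ell2_apply (X n - X m) x))\<^sup>2) \<le> (norm (X n - X m))\<^sup>2"
        by (rule ell2_sum_le_norm[OF F])
      also have "\<dots> \<le> e\<^sup>2" using e that by (intro power_mono) auto
      finally show ?thesis by simp
    qed
    then show "\<exists>N. \<forall>n\<ge>N. (\<Sum>x\<in>F. (cmod (ell2_apply (X n) x - ell2_apply (X m) x))\<^sup>2) \<le> e\<^sup>2" by blast
  qed
  have ex: "\<exists>d. (\<forall>x. ell2_apply d x = h x - ell2_apply (X m) x) \<and> norm d \<le> e"
    if "0 < e" "\<forall>n\<ge>m. norm (X n - X m) \<le> e" for e m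
    using ell2_exI[OF fin[OF that]] that(1) by (metis less_imp_le)
  have cau: "\<exists>M. \<forall>m\<ge>M. \<forall>n\<ge>M. norm (X n - X m) \<le> e" if "0 < e" for e
    using CauchyD[OF X that] by (meson less_imp_le)
  \<comment> \<open>The bounds on finite sets speak of differences, so the limit is assembled as a
    far member of the sequence plus a limiting difference.\<close>
  obtain m0 where "\<forall>n\<ge>m0. norm (X n - X m0) \<le> 1" using cau[of 1] by auto
  then obtain d0 where d0: "\<forall>x. ell2_apply d0 x = h x - ell2_apply (X m0) x" using ex[of 1 m0] by auto
  define L where "L = d0 + X m0"
  have L: "ell2_apply L x = h x" for x by (simp add: L_def d0)
  have "X \<longlonglongrightarrow> L"
    unfolding LIMSEQ_iff
  proof (intro allI impI)
    fix r :: real assume "0 < r"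
    then obtain M where M: "\<forall>m\<ge>M. \<forall>n\<ge>M. norm (X n - X m) \<le> r / 2" using cau[of "r/2"] by auto
    have "norm (X m - L) < r" if "m \<ge> M" for m
    proof -
      have "\<forall>n\<ge>m. norm (X n - X m) \<le> r / 2" using M that by simp
      from ex[OF _ this] obtain d where d: "\<forall>x. ell2_apply d x = h x - ell2_apply (X m) x" "norm d \<le> r / 2"
        using \<open>0 < r\<close> by auto
      have "X m - L = - d" by (rule ell2_eqI) (simp add: L d)
      then show ?thesis using d \<open>0 < r\<close> by simp
    qed
    then show "\<exists>no. \<forall>n\<ge>no. norm (X n - L) < r" by blast
  qed
  then show "convergent X" by (auto simp: convergent_def)
qed

section \<open>Orthogonal projections\<close>

text \<open>A minimising sequence is Cauchy by the parallelogram law, and its limit minimises the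
  distance to \<open>v\<close>; minimality along each line through the limit gives orthogonality.
  Everything refers to the real inner product.\<close>

lemma closest_point_exists:
  fixes E :: "'a ell2 set"
  assumes E: "subspace E" "closed E"
  obtains p where "p \<in> E" "\<And>e. e \<in> E \<Longrightarrow> (v - p) \<bullet> e = 0"
proof -
  define d where "d = (INF e\<in>E. norm (v - e))"
  have bdd: "bdd_below ((\<lambda>e. norm (v - e)) ` E)" by (auto intro!: bdd_belowI[of _ 0])
  have ne: "E \<noteq> {}" using E(1) subspace_0 by blast
  have dle: "d \<le> norm (v - e)" if "e \<in> E" for e
    unfolding d_def by (rule cINF_lower[OF bdd that])
  have d0: "0 \<le> d" unfolding d_def using ne by (intro cINF_greatest) auto
  have "\<exists>e\<in>E. norm (v - e) < d + inverse (real (Suc n))" for n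
    using cINF_less_iff[OF ne bdd, of "d + inverse (real (Suc n))"] by (simp add: d_def)
  then obtain p where p: "\<And>n. p n \<in> E" "\<And>n. norm (v - p n) < d + inverse (real (Suc n))"
    by metis
  have lim: "(\<lambda>n. norm (v - p n)) \<longlonglongrightarrow> d"
  proof (rule tendsto_sandwich[of "\<lambda>_. d"])
    show "(\<lambda>n. d + inverse (real (Suc n))) \<longlonglongrightarrow> d"
      using tendsto_add[OF tendsto_const LIMSEQ_inverse_real_of_nat, of d] by simp
  qed (use dle p in \<open>auto intro!: always_eventually less_imp_le\<close>)
  \<comment> \<open>The midpoint lies in \<open>E\<close>, so its distance to \<open>v\<close> is at
    least \<open>d\<close>; the parallelogram law turns this into closeness of \<open>p m\<close>
    and \<open>p n\<close>.\<close>
  have par: "(norm (p m - p n))\<^sup>2 \<le> 2 * (norm (v - p m))\<^sup>2 + 2 * (norm (v - p n))\<^sup>2 - 4 * d\<^sup>2" for m n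
  proof -
    have "(1/2) *\<^sub>R (p m + p n) \<in> E" using p E(1) by (intro subspace_scale subspace_add)
    then have "d \<le> norm (v - (1/2) *\<^sub>R (p m + p n))" by (rule dle)
    then have "d\<^sup>2 \<le> (norm (v - (1/2) *\<^sub>R (p m + p n)))\<^sup>2" using d0 by (rule power_mono)
    moreover have "(norm (p m - p n))\<^sup>2 = 2 * (norm (v - p m))\<^sup>2 + 2 * (norm (v - p n))\<^sup>2
        - 4 * (norm (v - (1/2) *\<^sub>R (p m + p n)))\<^sup>2"
      by (simp add: power2_norm_eq_inner algebra_simps inner_commute)
    ultimately show ?thesis by simp
  qed
  have "Cauchy p"
  proof (rule CauchyI)
    fix e :: real assume "0 < e"
    have "(\<lambda>n. 2 * (norm (v - p n))\<^sup>2 - 2 * d\<^sup>2) \<longlonglongrightarrow> 2 * d\<^sup>2 - 2 * d\<^sup>2"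
      by (intro tendsto_intros lim)
    then have "eventually (\<lambda>n. 2 * (norm (v - p n))\<^sup>2 - 2 * d\<^sup>2 < e\<^sup>2 / 2) sequentially"
      using \<open>0 < e\<close> by (intro order_tendstoD(2)) auto
    then obtain M where M: "\<forall>n\<ge>M. 2 * (norm (v - p n))\<^sup>2 - 2 * d\<^sup>2 < e\<^sup>2 / 2"
      by (auto simp: eventually_sequentially)
    have "norm (p m - p n) < e" if "m \<ge> M" "n \<ge> M" for m n
    proof -
      have "(norm (p m - p n))\<^sup>2 < e\<^sup>2"
        using par[of m n] M[rule_format, of m] M[rule_format, of n] that by simp
      then show ?thesis using \<open>0 < e\<close> by (simp add: power2_less_imp_less)
    qed
    then show "\<exists>M. \<forall>m\<ge>M. \<forall>n\<ge>M. norm (p m - p n) < e" by blast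
  qed
  then obtain q where q: "p \<longlonglongrightarrow> q" using complete_ell2 convergent_def by blast
  have qE: "q \<in> E" using closed_sequentially[OF E(2)] p(1) q by blast
  have "norm (v - q) = d"
    using tendsto_norm[OF tendsto_diff[OF tendsto_const q]] lim LIMSEQ_unique by blast
  have "(v - q) \<bullet> e = 0" if e: "e \<in> E" for e
  proof (cases "e = 0")
    case False
    \<comment> \<open>The minimiser of \<open>norm ((v - q) - t *\<^sub>R e)\<close> over
      \<open>t\<close>, so a nonzero inner product would strictly decrease the distance.\<close>
    define t where "t = ((v - q) \<bullet> e) / (e \<bullet> e)"
    have "norm (v - q) \<le> norm (v - (q + t *\<^sub>R e))"
      unfolding \<open>norm (v - q) = d\<close> using qE e E(1) by (intro dle subspace_add subspace_scale)
    then have "(norm (v - q))\<^sup>2 \<le> (norm ((v - q) - t *\<^sub>R e))\<^sup>2"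
      by (intro power_mono) (auto simp: algebra_simps)
    also have "\<dots> = (norm (v - q))\<^sup>2 - 2 * t * ((v - q) \<bullet> e) + t\<^sup>2 * (e \<bullet> e)"
      unfolding power2_norm_eq_inner by (simp add: inner_diff inner_commute power2_eq_square algebra_simps)
    also have "\<dots> = (norm (v - q))\<^sup>2 - ((v - q) \<bullet> e)\<^sup>2 / (e \<bullet> e)"
      using False by (simp add: t_def power2_eq_square field_simps)
    finally have "((v - q) \<bullet> e)\<^sup>2 / (e \<bullet> e) \<le> 0" by simp
    then show ?thesis using False
      by (simp add: divide_le_0_iff not_le[symmetric]) (meson inner_gt_zero_iff not_le)
  qed simp
  then show ?thesis using that qE by blast
qed

section \<open>Matrix entries of operators\<close>

definition entry :: "'a op \<Rightarrow> 'a \<Rightarrow> 'a \<Rightarrow> complex" where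
  "entry T t s = ell2_apply (blinfun_apply T (delta s)) t"

lemma bounded_opsD:
  "T \<in> bounded_ops \<Longrightarrow> blinfun_apply T (ell2_scale c f) = ell2_scale c (blinfun_apply T f)"
  by (simp add: bounded_ops_def)

lemma bounded_ops_intros [intro, simp]:
  "0 \<in> bounded_ops"
  "T \<in> bounded_ops \<Longrightarrow> S \<in> bounded_ops \<Longrightarrow> T + S \<in> bounded_ops"
  "T \<in> bounded_ops \<Longrightarrow> S \<in> bounded_ops \<Longrightarrow> T - S \<in> bounded_ops"
  "T \<in> bounded_ops \<Longrightarrow> S \<in> bounded_ops \<Longrightarrow> T o\<^sub>L S \<in> bounded_ops"
  "T \<in> bounded_ops \<Longrightarrow> op_scale c T \<in> bounded_ops"
  by (auto simp: bounded_ops_def op_scale_apply blinfun.bilinear_simps mult.commute)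

lemma entry_simps [simp]:
  "entry 0 t s = 0"
  "entry (T + S) t s = entry T t s + entry S t s"
  "entry (T - S) t s = entry T t s - entry S t s"
  "entry (op_scale c T) t s = c * entry T t s"
  by (simp_all add: entry_def op_scale_apply blinfun.bilinear_simps)

lemma entry_sum [simp]: "entry (sum f A) t s = (\<Sum>i\<in>A. entry (f i) t s)"
  by (induction A rule: infinite_finite_induct) auto

lemma cmod_entry_le: "cmod (entry T t s) \<le> norm T"
  using cmod_ell2_apply_le[of "blinfun_apply T (delta s)" t] norm_blinfun[of T "delta s"]
  by (simp add: entry_def)

lemma op_apply_fin:
  assumes "T \<in> bounded_ops" "finite F"
  shows "ell2_apply (blinfun_apply T (ell2_fin F h)) t = (\<Sum>s\<in>F. entry T t s * h s)"
  using assms by (simp add: ell2_fin_eq_sum blinfun.sum_right bounded_opsD entry_def mult.commute)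

lemma op_has_sum:
  assumes "T \<in> bounded_ops"
  shows "((\<lambda>s. entry T t s * ell2_apply f s) has_sum ell2_apply (blinfun_apply T f) t) UNIV"
proof -
  have "((\<lambda>F. ell2_apply (blinfun_apply T (ell2_fin F (ell2_apply f))) t)
      \<longlongrightarrow> ell2_apply (blinfun_apply T f) t) (finite_subsets_at_top UNIV)"
    by (rule bounded_linear.tendsto[OF bounded_linear_compose[OF bounded_linear_ell2_apply
          blinfun.bounded_linear_right] truncate_tendsto])
  then show ?thesis
    unfolding has_sum_def
    by (rule Lim_transform_eventually)
      (auto intro!: eventually_finite_subsets_at_top_weakI simp: op_apply_fin[OF assms])
qed

lemma op_eqI:
  assumes "T \<in> bounded_ops" "S \<in> bounded_ops" "\<And>t s. entry T t s = entry S t s"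
  shows "T = S"
proof (rule blinfun_eqI, rule ell2_eqI)
  fix f t
  show "ell2_apply (blinfun_apply T f) t = ell2_apply (blinfun_apply S f) t"
    using has_sum_unique[OF op_has_sum[OF assms(1)], of t f] op_has_sum[OF assms(2), of t f] assms(3)
    by simp
qed

lemma le_if_mult_self_le: "0 \<le> (a::real) \<Longrightarrow> 0 \<le> C \<Longrightarrow> a * a \<le> C * a \<Longrightarrow> a \<le> C"
  by (cases "a = 0") auto

text \<open>Uniform bounds on finite square sections make each row a vector \<open>r t\<close> up to
  conjugation, so row \<open>t\<close> of the operator can be \<open>cinner f (r t)\<close>; the
  same bounds then control the image of \<open>f\<close>.\<close>

lemma op_of_matrix:
  fixes m :: "'a \<Rightarrow> 'a \<Rightarrow> complex"
  assumes bound: "\<And>F x y. finite F \<Longrightarrow> cmod (\<Sum>t\<in>F. \<Sum>s\<in>F. m t s * x s * cnj (y t))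
      \<le> C * L2_set (\<lambda>s. cmod (x s)) F * L2_set (\<lambda>t. cmod (y t)) F"
    and C: "0 \<le> C"
  shows "\<exists>T\<in>bounded_ops. \<forall>t s. entry T t s = m t s"
proof -
  \<comment> \<open>Testing the form on the conjugated row \<open>t\<close> and on the unit vector
    at \<open>t\<close> gives \<open>S \<le> C * sqrt S\<close>; \<open>G\<close> contains
    \<open>t\<close> so that this unit vector is supported in it.\<close>
  have row: "(\<Sum>s\<in>F. (cmod (cnj (m t s)))\<^sup>2) \<le> C\<^sup>2" if F: "finite F" for t F
  proof -
    define G where "G = insert t F"
    have G: "finite G" "t \<in> G" using F by (auto simp: G_def)
    define S where "S = (\<Sum>s\<in>G. (cmod (m t s))\<^sup>2)"
    have S0: "0 \<le> S" by (simp add: S_def sum_nonneg)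
    have "(\<Sum>t'\<in>G. \<Sum>s\<in>G. m t' s * cnj (m t s) * cnj (if t' = t then 1 else 0))
        = (\<Sum>t'\<in>G. if t' = t then (\<Sum>s\<in>G. m t s * cnj (m t s)) else 0)"
      by (intro sum.cong) auto
    also have "\<dots> = (\<Sum>s\<in>G. m t s * cnj (m t s))"
      using G by simp
    also have "\<dots> = of_real S" unfolding S_def of_real_sum complex_norm_square ..
    finally have "cmod (of_real S) \<le> C * L2_set (\<lambda>s. cmod (cnj (m t s))) G
        * L2_set (\<lambda>t'. cmod (if t' = t then 1 else 0)) G"
      using bound[OF G(1), of "\<lambda>s. cnj (m t s)" "\<lambda>t'. if t' = t then 1 else 0"] by simp
    moreover have "L2_set (\<lambda>t'. cmod (if t' = t then 1 else 0)) G = 1"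
      using G by (simp add: L2_set_def if_distrib[of cmod] if_distrib[of "\<lambda>x. x\<^sup>2"] cong: if_cong)
    moreover have "L2_set (\<lambda>s. cmod (cnj (m t s))) G = sqrt S" by (simp add: L2_set_def S_def)
    ultimately have "sqrt S * sqrt S \<le> C * sqrt S" using S0 by simp
    then have "sqrt S \<le> C" using C S0 by - (rule le_if_mult_self_le, auto)
    then have "S \<le> C\<^sup>2" by (rule sqrt_le_D)
    moreover have "(\<Sum>s\<in>F. (cmod (cnj (m t s)))\<^sup>2) \<le> S"
      unfolding S_def using G by (auto simp: G_def intro!: sum_mono2)
    ultimately show ?thesis by linarith
  qed
  have "\<exists>r. \<forall>t. ell2_apply (r t) = (\<lambda>s. cnj (m t s))"
    by (rule choice, rule allI) (metis ell2_exI[OF row C])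
  then obtain r where r: "\<And>t s. ell2_apply (r t) s = cnj (m t s)" by (metis (full_types))
  \<comment> \<open>The image of \<open>f\<close>, cut to \<open>G\<close>, is tested against
    itself. As \<open>f\<close> may have infinite support, the bound is applied on growing sets
    \<open>F\<close> and passed to the limit.\<close>
  have col: "(\<Sum>t\<in>G. (cmod (cinner f (r t)))\<^sup>2) \<le> (C * norm f)\<^sup>2" if G: "finite G" for f G
  proof -
    define y where "y t = (if t \<in> G then cinner f (r t) else 0)" for t
    define S where "S = (\<Sum>t\<in>G. (cmod (cinner f (r t)))\<^sup>2)"
    have S0: "0 \<le> S" by (simp add: S_def sum_nonneg)
    have "((\<lambda>F. \<Sum>t\<in>G. (\<Sum>s\<in>F. ell2_apply f s * cnj (ell2_apply (r t) s)) * cnj (y t))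
        \<longlongrightarrow> (\<Sum>t\<in>G. cinner f (r t) * cnj (y t))) (finite_subsets_at_top UNIV)"
      using cinner_has_sum by (intro tendsto_intros) (auto simp: has_sum_def)
    moreover have "(\<Sum>t\<in>G. cinner f (r t) * cnj (y t)) = of_real S"
      unfolding S_def of_real_sum complex_norm_square by (rule sum.cong) (auto simp: y_def)
    ultimately have lim: "((\<lambda>F. cmod (\<Sum>t\<in>G. (\<Sum>s\<in>F. ell2_apply f s * cnj (ell2_apply (r t) s)) * cnj (y t)))
        \<longlongrightarrow> S) (finite_subsets_at_top UNIV)"
      using tendsto_norm S0 by fastforce
    have "S \<le> C * norm f * sqrt S"
    proof (rule tendsto_upperbound[OF lim _ finite_subsets_at_top_neq_bot])
      have "eventually (\<lambda>F. finite F \<and> G \<subseteq> F) (finite_subsets_at_top UNIV)"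
        using G by (auto simp: eventually_finite_subsets_at_top)
      then show "\<forall>\<^sub>F F in finite_subsets_at_top UNIV. cmod (\<Sum>t\<in>G. (\<Sum>s\<in>F. ell2_apply f s
          * cnj (ell2_apply (r t) s)) * cnj (y t)) \<le> C * norm f * sqrt S"
      proof eventually_elim
        case (elim F)
        have "(\<Sum>t\<in>G. (\<Sum>s\<in>F. ell2_apply f s * cnj (ell2_apply (r t) s)) * cnj (y t))
            = (\<Sum>t\<in>F. (\<Sum>s\<in>F. ell2_apply f s * cnj (ell2_apply (r t) s)) * cnj (y t))"
          using elim by (intro sum.mono_neutral_left) (auto simp: y_def)
        also have "\<dots> = (\<Sum>t\<in>F. \<Sum>s\<in>F. m t s * ell2_apply f s * cnj (y t))"
          by (simp add: r sum_distrib_left ac_simps)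
        also have "cmod \<dots> \<le> C * L2_set (\<lambda>s. cmod (ell2_apply f s)) F * L2_set (\<lambda>t. cmod (y t)) F"
          using elim by (intro bound) simp
        also have "L2_set (\<lambda>t. cmod (y t)) F = sqrt S"
          unfolding L2_set_def S_def using elim
          by (intro arg_cong[of _ _ sqrt] sum.mono_neutral_cong_right) (auto simp: y_def)
        also have "C * L2_set (\<lambda>s. cmod (ell2_apply f s)) F * sqrt S \<le> C * norm f * sqrt S"
          using elim norm_truncate_le[of F f] C S0
          by (intro mult_right_mono mult_left_mono) (auto simp: norm_fin)
        finally show ?case .
      qed
    qed
    then have "sqrt S * sqrt S \<le> C * norm f * sqrt S" using S0 by simp
    then have "sqrt S \<le> C * norm f" using C S0 by - (rule le_if_mult_self_le, auto)
    then show ?thesis unfolding S_def[symmetric] by (rule sqrt_le_D)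
  qed
  have "\<exists>g. \<forall>f. ell2_apply (g f) = (\<lambda>t. cinner f (r t)) \<and> norm (g f) \<le> C * norm f"
    by (rule choice, rule allI) (metis ell2_exI[OF col] C mult_nonneg_nonneg norm_ge_zero)
  then obtain g where g: "\<And>f t. ell2_apply (g f) t = cinner f (r t)" "\<And>f. norm (g f) \<le> C * norm f"
    by (metis (full_types))
  have "bounded_linear g"
    by (rule bounded_linear_intro[where K = C])
      (auto intro!: ell2_eqI simp: g cinner_add_left scaleR_eq_ell2_scale mult.commute)
  then have "blinfun_apply (Blinfun g) = g" by (simp add: bounded_linear_Blinfun_apply)
  then have "Blinfun g \<in> bounded_ops" "entry (Blinfun g) t s = m t s" for t s
    using cinner_cnj[of "delta s" "r t"]
    by (auto simp: bounded_ops_def entry_def g r intro!: ell2_eqI)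
  then show ?thesis by blast
qed

section \<open>Norms of operator matrices\<close>

lemma L2_set_ge_member: "finite A \<Longrightarrow> i \<in> A \<Longrightarrow> L2_set f A \<le> C \<Longrightarrow> f i \<le> C"
  using member_le_L2_set[of A i f] by linarith

lemma matrix_norm_bdd:
  fixes a :: "nat \<Rightarrow> nat \<Rightarrow> 'a op"
  shows "bdd_above {L2_set (\<lambda>i. norm (\<Sum>j<n. blinfun_apply (a i j) (\<xi> j))) {..<n} | \<xi>.
     L2_set (\<lambda>j. norm (\<xi> j)) {..<n} \<le> 1}"
proof (rule bdd_aboveI, clarify)
  fix \<xi> :: "nat \<Rightarrow> 'a ell2" assume \<xi>: "L2_set (\<lambda>j. norm (\<xi> j)) {..<n} \<le> 1"
  have "L2_set (\<lambda>i. norm (\<Sum>j<n. blinfun_apply (a i j) (\<xi> j))) {..<n}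
      \<le> (\<Sum>i<n. norm (\<Sum>j<n. blinfun_apply (a i j) (\<xi> j)))"
    by (rule L2_set_le_sum) auto
  also have "\<dots> \<le> (\<Sum>i<n. \<Sum>j<n. norm (a i j))"
  proof (intro sum_mono order_trans[OF norm_sum])
    fix i j assume "i \<in> {..<n}" "j \<in> {..<n}"
    have "norm (\<xi> j) \<le> 1" using L2_set_ge_member[OF _ \<open>j \<in> {..<n}\<close> \<xi>] by simp
    then show "norm (blinfun_apply (a i j) (\<xi> j)) \<le> norm (a i j)"
      by (meson mult_left_le norm_blinfun norm_ge_zero order_trans)
  qed
  finally show "L2_set (\<lambda>i. norm (\<Sum>j<n. blinfun_apply (a i j) (\<xi> j))) {..<n}
      \<le> (\<Sum>i<n. \<Sum>j<n. norm (a i j))" .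
qed

lemma matrix_norm_upper1:
  assumes "L2_set (\<lambda>j. norm (\<xi> j)) {..<n} \<le> 1"
  shows "L2_set (\<lambda>i. norm (\<Sum>j<n. blinfun_apply (a i j) (\<xi> j))) {..<n} \<le> matrix_norm n a"
  unfolding matrix_norm_def using assms by (intro cSup_upper matrix_norm_bdd) blast

lemma matrix_norm_nonneg: "0 \<le> matrix_norm n a"
  using matrix_norm_upper1[of "\<lambda>_. 0" n a] by (simp add: L2_set_0')

lemma matrix_norm_upper:
  "L2_set (\<lambda>i. norm (\<Sum>j<n. blinfun_apply (a i j) (\<xi> j))) {..<n}
    \<le> matrix_norm n a * L2_set (\<lambda>j. norm (\<xi> j)) {..<n}" (is "?l \<le> _ * ?N")
proof (cases "?N = 0")
  case True
  then have "\<forall>j<n. \<xi> j = 0" by (simp add: L2_set_eq_0_iff)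
  then show ?thesis using True by (simp add: L2_set_0')
next
  case False
  then have N: "0 < ?N" using L2_set_nonneg[of "\<lambda>j. norm (\<xi> j)" "{..<n}"] by linarith
  have "?l / ?N = L2_set (\<lambda>i. norm (\<Sum>j<n. blinfun_apply (a i j) (\<xi> j /\<^sub>R ?N))) {..<n}"
    using N by (simp add: blinfun.scaleR_right scaleR_sum_right[symmetric] L2_set_right_distrib
        divide_inverse_commute)
  also have "\<dots> \<le> matrix_norm n a"
    using N by (intro matrix_norm_upper1) (simp add: L2_set_right_distrib[symmetric])
  finally show ?thesis using N by (simp add: field_simps)
qed

lemma matrix_norm_least:
  assumes "0 \<le> C" "\<And>\<xi>. L2_set (\<lambda>i. norm (\<Sum>j<n. blinfun_apply (a i j) (\<xi> j))) {..<n}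
    \<le> C * L2_set (\<lambda>j. norm (\<xi> j)) {..<n}"
  shows "matrix_norm n a \<le> C"
  unfolding matrix_norm_def
proof (rule cSup_least)
  show "{L2_set (\<lambda>i. norm (\<Sum>j<n. blinfun_apply (a i j) (\<xi> j))) {..<n} | \<xi>.
     L2_set (\<lambda>j. norm (\<xi> j)) {..<n} \<le> 1} \<noteq> {}"
    by (auto intro!: exI[of _ "\<lambda>_. 0"] simp: L2_set_0')
  fix x assume "x \<in> {L2_set (\<lambda>i. norm (\<Sum>j<n. blinfun_apply (a i j) (\<xi> j))) {..<n} | \<xi>.
     L2_set (\<lambda>j. norm (\<xi> j)) {..<n} \<le> 1}"
  then obtain \<xi> where x: "x = L2_set (\<lambda>i. norm (\<Sum>j<n. blinfun_apply (a i j) (\<xi> j))) {..<n}"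
    and \<xi>: "L2_set (\<lambda>j. norm (\<xi> j)) {..<n} \<le> 1" by blast
  show "x \<le> C" unfolding x
    using assms(2)[of \<xi>] mult_left_le[OF \<xi> assms(1)] by linarith
qed

lemma matrix_norm_cong:
  "(\<And>i j. i < n \<Longrightarrow> j < n \<Longrightarrow> a i j = b i j) \<Longrightarrow> matrix_norm n a = matrix_norm n b"
proof -
  assume ab: "\<And>i j. i < n \<Longrightarrow> j < n \<Longrightarrow> a i j = b i j"
  have "L2_set (\<lambda>i. norm (\<Sum>j<n. blinfun_apply (a i j) (\<xi> j))) {..<n}
      = L2_set (\<lambda>i. norm (\<Sum>j<n. blinfun_apply (b i j) (\<xi> j))) {..<n}" for \<xi>
    by (rule L2_set_cong) (simp_all add: ab)
  then show ?thesis by (simp add: matrix_norm_def)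
qed

lemma matrix_norm_scale: "matrix_norm n (\<lambda>i j. op_scale c (a i j)) \<le> cmod c * matrix_norm n a"
proof (rule matrix_norm_least)
  fix \<xi> :: "nat \<Rightarrow> 'a ell2"
  show "L2_set (\<lambda>i. norm (\<Sum>j<n. blinfun_apply (op_scale c (a i j)) (\<xi> j))) {..<n}
    \<le> cmod c * matrix_norm n a * L2_set (\<lambda>j. norm (\<xi> j)) {..<n}"
    using mult_left_mono[OF matrix_norm_upper[where n = n and a = a and \<xi> = \<xi>], of "cmod c"]
    by (simp add: op_scale_apply ell2_scale_sum[symmetric] norm_ell2_scale L2_set_right_distrib mult.assoc)
qed (simp add: matrix_norm_nonneg)

lemma matrix_norm_1: "matrix_norm 1 (\<lambda>_ _. T) = norm T"
proof (rule antisym)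
  show "matrix_norm 1 (\<lambda>_ _. T) \<le> norm T"
    by (rule matrix_norm_least) (auto simp: L2_set_def norm_blinfun)
  show "norm T \<le> matrix_norm 1 (\<lambda>_ _. T)"
  proof (rule norm_blinfun_bound)
    fix f
    show "norm (blinfun_apply T f) \<le> matrix_norm 1 (\<lambda>_ _. T) * norm f"
      using matrix_norm_upper[where n = 1 and a = "\<lambda>_ _. T" and \<xi> = "\<lambda>_. f"] by (simp add: L2_set_def)
  qed (rule matrix_norm_nonneg)
qed

section \<open>Testing matrix norms by sesquilinear forms on finitely supported vectors\<close>

lemma matrix_norm_cinner:
  "cmod (\<Sum>i<n. \<Sum>j<n. cinner (blinfun_apply (a i j) (\<xi> j)) (\<eta> i))
    \<le> matrix_norm n a * L2_set (\<lambda>j. norm (\<xi> j)) {..<n} * L2_set (\<lambda>i. norm (\<eta> i)) {..<n}"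
proof -
  have "cmod (\<Sum>i<n. \<Sum>j<n. cinner (blinfun_apply (a i j) (\<xi> j)) (\<eta> i))
      = cmod (\<Sum>i<n. cinner (\<Sum>j<n. blinfun_apply (a i j) (\<xi> j)) (\<eta> i))"
    by (simp add: cinner_sum_left)
  also have "\<dots> \<le> (\<Sum>i<n. \<bar>norm (\<Sum>j<n. blinfun_apply (a i j) (\<xi> j))\<bar> * \<bar>norm (\<eta> i)\<bar>)"
    by (rule sum_norm_le) (simp add: cmod_cinner_le)
  also have "\<dots> \<le> L2_set (\<lambda>i. norm (\<Sum>j<n. blinfun_apply (a i j) (\<xi> j))) {..<n}
      * L2_set (\<lambda>i. norm (\<eta> i)) {..<n}"
    by (rule L2_set_mult_ineq)
  also have "\<dots> \<le> matrix_norm n a * L2_set (\<lambda>j. norm (\<xi> j)) {..<n} * L2_set (\<lambda>i. norm (\<eta> i)) {..<n}"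
    by (intro mult_right_mono matrix_norm_upper) simp
  finally show ?thesis .
qed

text \<open>The entries \<open>m i j t s\<close> are scalars, so a Schur multiplied matrix can be
  estimated before it is known to define operators. One set \<open>F\<close> serves rows and
  columns, since it can always be enlarged.\<close>

definition matrix_form ::
    "nat \<Rightarrow> (nat \<Rightarrow> nat \<Rightarrow> 'a \<Rightarrow> 'a \<Rightarrow> complex) \<Rightarrow> 'a set \<Rightarrow> (nat \<Rightarrow> 'a \<Rightarrow> complex) \<Rightarrow> (nat \<Rightarrow> 'a \<Rightarrow> complex) \<Rightarrow> complex"
  where "matrix_form n m F x y =
    (\<Sum>i<n. \<Sum>j<n. \<Sum>t\<in>F. \<Sum>s\<in>F. m i j t s * x j s * cnj (y i t))"

definition fin_norm :: "nat \<Rightarrow> 'a set \<Rightarrow> (nat \<Rightarrow> 'a \<Rightarrow> complex) \<Rightarrow> real" where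
  "fin_norm n F x = L2_set (\<lambda>j. L2_set (\<lambda>s. cmod (x j s)) F) {..<n}"

lemma fin_norm_nonneg [simp]: "0 \<le> fin_norm n F x"
  by (simp add: fin_norm_def)

lemma fin_norm_power2: "(fin_norm n F x)\<^sup>2 = (\<Sum>j<n. \<Sum>s\<in>F. (cmod (x j s))\<^sup>2)"
  by (simp add: fin_norm_def L2_set_def sum_nonneg)

lemma fin_norm_eq: "finite F \<Longrightarrow> fin_norm n F x = L2_set (\<lambda>j. norm (ell2_fin F (x j))) {..<n}"
  by (simp add: fin_norm_def norm_fin)

lemma matrix_form_eq:
  assumes "finite F" "\<And>i j. i < n \<Longrightarrow> j < n \<Longrightarrow> a i j \<in> bounded_ops"
  shows "matrix_form n (\<lambda>i j. entry (a i j)) F x y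
    = (\<Sum>i<n. \<Sum>j<n. cinner (blinfun_apply (a i j) (ell2_fin F (x j))) (ell2_fin F (y i)))"
  unfolding matrix_form_def using assms
  by (intro sum.cong refl) (simp add: cinner_fin_right op_apply_fin sum_distrib_right)

lemma matrix_form_bound:
  assumes "finite F" "\<And>i j. i < n \<Longrightarrow> j < n \<Longrightarrow> a i j \<in> bounded_ops"
  shows "cmod (matrix_form n (\<lambda>i j. entry (a i j)) F x y) \<le> matrix_norm n a * fin_norm n F x * fin_norm n F y"
  using matrix_norm_cinner[where n = n and a = a and \<xi> = "\<lambda>j. ell2_fin F (x j)" and \<eta> = "\<lambda>i. ell2_fin F (y i)"]
  by (simp add: matrix_form_eq assms fin_norm_eq)

text \<open>Truncation extends the bound from finitely supported vectors to all vectors; testing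
  against the image itself turns a bound on the form into a bound on the norm.\<close>

lemma matrix_norm_le_form:
  assumes a: "\<And>i j. i < n \<Longrightarrow> j < n \<Longrightarrow> a i j \<in> bounded_ops" and C: "0 \<le> C"
    and bound: "\<And>F x y. finite F \<Longrightarrow>
      cmod (matrix_form n (\<lambda>i j. entry (a i j)) F x y) \<le> C * fin_norm n F x * fin_norm n F y"
  shows "matrix_norm n a \<le> C"
proof (rule matrix_norm_least[OF C])
  fix \<xi> :: "nat \<Rightarrow> 'a ell2"
  define N where "N \<zeta> = L2_set (\<lambda>j. norm (\<zeta> j)) {..<n}" for \<zeta> :: "nat \<Rightarrow> 'a ell2"
  have N0: "0 \<le> N \<zeta>" for \<zeta> by (simp add: N_def)
  have all: "cmod (\<Sum>i<n. \<Sum>j<n. cinner (blinfun_apply (a i j) (\<xi> j)) (\<eta> i)) \<le> C * N \<xi> * N \<eta>" for \<eta>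
  proof (rule tendsto_upperbound)
    let ?c = "\<lambda>F (f :: 'a ell2). ell2_fin F (ell2_apply f)"
    show "((\<lambda>F. cmod (\<Sum>i<n. \<Sum>j<n. cinner (blinfun_apply (a i j) (?c F (\<xi> j))) (?c F (\<eta> i))))
        \<longlongrightarrow> cmod (\<Sum>i<n. \<Sum>j<n. cinner (blinfun_apply (a i j) (\<xi> j)) (\<eta> i))) (finite_subsets_at_top UNIV)"
      by (intro tendsto_norm tendsto_sum tendsto_cinner truncate_tendsto
          bounded_linear.tendsto[OF blinfun.bounded_linear_right])
    show "\<forall>\<^sub>F F in finite_subsets_at_top UNIV. cmod (\<Sum>i<n. \<Sum>j<n.
        cinner (blinfun_apply (a i j) (?c F (\<xi> j))) (?c F (\<eta> i))) \<le> C * N \<xi> * N \<eta>"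
    proof (rule eventually_finite_subsets_at_top_weakI)
      fix F :: "'a set" assume F: "finite F"
      have le: "fin_norm n F (\<lambda>j. ell2_apply (\<zeta> j)) \<le> N \<zeta>" for \<zeta>
        unfolding fin_norm_eq[OF F] N_def by (intro L2_set_mono norm_truncate_le F) auto
      have "cmod (\<Sum>i<n. \<Sum>j<n. cinner (blinfun_apply (a i j) (?c F (\<xi> j))) (?c F (\<eta> i)))
          \<le> C * fin_norm n F (\<lambda>j. ell2_apply (\<xi> j)) * fin_norm n F (\<lambda>j. ell2_apply (\<eta> j))"
        using bound[OF F, of "\<lambda>j. ell2_apply (\<xi> j)" "\<lambda>j. ell2_apply (\<eta> j)"]
        by (simp add: matrix_form_eq[OF F a])
      also have "\<dots> \<le> C * N \<xi> * N \<eta>"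
        by (intro mult_mono le C mult_nonneg_nonneg N0) auto
      finally show "cmod (\<Sum>i<n. \<Sum>j<n. cinner (blinfun_apply (a i j) (?c F (\<xi> j))) (?c F (\<eta> i)))
          \<le> C * N \<xi> * N \<eta>" .
    qed
  qed simp
  define \<eta> where "\<eta> i = (\<Sum>j<n. blinfun_apply (a i j) (\<xi> j))" for i
  have "(\<Sum>i<n. \<Sum>j<n. cinner (blinfun_apply (a i j) (\<xi> j)) (\<eta> i)) = (\<Sum>i<n. cinner (\<eta> i) (\<eta> i))"
    by (simp add: \<eta>_def cinner_sum_left)
  also have "\<dots> = of_real ((N \<eta>)\<^sup>2)"
    by (simp add: cinner_self N_def L2_set_def sum_nonneg)
  finally have "N \<eta> * N \<eta> \<le> C * N \<xi> * N \<eta>"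
    using all[of \<eta>] by (simp add: power2_eq_square norm_mult N0)
  then have "N \<eta> \<le> C * N \<xi>"
    using N0 C by - (rule le_if_mult_self_le, auto)
  then show "L2_set (\<lambda>i. norm (\<Sum>j<n. blinfun_apply (a i j) (\<xi> j))) {..<n}
      \<le> C * L2_set (\<lambda>j. norm (\<xi> j)) {..<n}"
    by (simp add: N_def \<eta>_def)
qed

section \<open>Completely bounded norms\<close>

lemma cb_norm_le_iff:
  assumes "0 \<le> k"
  shows "cb_norm V T \<le> ennreal k \<longleftrightarrow>
    (\<forall>n a. (\<forall>i<n. \<forall>j<n. a i j \<in> V) \<and> matrix_norm n a \<le> 1 \<longrightarrow> matrix_norm n (\<lambda>i j. T (a i j)) \<le> k)"
  unfolding cb_norm_def using assms by (simp add: SUP_le_iff)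

lemma cb_norm_leD:
  assumes "cb_norm V T \<le> ennreal k" "0 \<le> k" "\<And>i j. i < n \<Longrightarrow> j < n \<Longrightarrow> a i j \<in> V" "matrix_norm n a \<le> 1"
  shows "matrix_norm n (\<lambda>i j. T (a i j)) \<le> k"
  using assms cb_norm_le_iff by blast

lemma cb_norm_cong:
  assumes "\<And>x. x \<in> V \<Longrightarrow> T x = S x"
  shows "cb_norm V T = cb_norm V S"
  unfolding cb_norm_def
  by (intro SUP_cong refl arg_cong[of _ _ ennreal] matrix_norm_cong assms) auto

lemma cb_norm_mono: "V \<subseteq> W \<Longrightarrow> cb_norm V T \<le> cb_norm W T"
  unfolding cb_norm_def by (intro SUP_mono' SUP_subset_mono) auto

lemma norm_op_scale: "norm (op_scale c T) = cmod c * norm T"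
proof -
  have le: "norm (op_scale c T) \<le> cmod c * norm T" for c and T :: "'a op"
  proof (rule norm_blinfun_bound)
    fix f show "norm (blinfun_apply (op_scale c T) f) \<le> cmod c * norm T * norm f"
      using mult_left_mono[OF norm_blinfun[of T f], of "cmod c"]
      by (simp add: op_scale_apply norm_ell2_scale mult.assoc)
  qed simp
  show ?thesis
  proof (cases "c = 0")
    case False
    have "norm T = norm (op_scale (inverse c) (op_scale c T))" using False by simp
    also have "\<dots> \<le> inverse (cmod c) * norm (op_scale c T)" using le by (metis norm_inverse)
    finally show ?thesis using le[of c T] False by (simp add: field_simps)
  qed (use le[of 0 T] in simp)
qed

text \<open>Level \<open>n = 1\<close> of the definition, applied to \<open>x\<close> scaled to norm
  one.\<close>

lemma cb_norm_le_norm: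
  assumes cb: "cb_norm V T \<le> ennreal k" "0 \<le> k" and T: "clinear_on V op_scale T" and x: "x \<in> V"
    and V: "\<And>c y. y \<in> V \<Longrightarrow> op_scale c y \<in> V"
  shows "norm (T x) \<le> k * norm x"
proof (cases "norm x = 0")
  case True
  \<comment> \<open>Here \<open>x\<close> cannot be normalised, but linearity on \<open>V\<close>
    makes \<open>T\<close> vanish at 0.\<close>
  then have "T x = T (op_scale 0 x)" by simp
  also have "\<dots> = op_scale 0 (T x)" using T x unfolding clinear_on_def by blast
  finally show ?thesis using True by simp
next
  case False
  define c where "c = complex_of_real (inverse (norm x))"
  have c: "cmod c = inverse (norm x)" unfolding c_def norm_of_real by simp
  have "norm (op_scale c x) = 1" using False by (simp add: norm_op_scale c)
  then have "matrix_norm 1 (\<lambda>_ _. T (op_scale c x)) \<le> k"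
    using x V cb_norm_leD[OF cb, where n = 1 and a = "\<lambda>_ _. op_scale c x"] by (simp add: matrix_norm_1[simplified])
  then have "norm (T (op_scale c x)) \<le> k" by (simp add: matrix_norm_1[simplified])
  moreover have "T (op_scale c x) = op_scale c (T x)" using T x unfolding clinear_on_def by blast
  ultimately show ?thesis using False by (simp add: norm_op_scale c field_simps)
qed

section \<open>The group von Neumann algebra\<close>

text \<open>A normal form for words in a noncommutative group: differences become sums of negated
  letters, associated to the right, with adjacent inverses cancelled.\<close>

lemmas group_normalize = diff_conv_add_uminus minus_add add.assoc minus_minus add_minus_cancel
  minus_add_cancel add.right_inverse add.left_inverse add_0 add_0_right

lemma bij_diff_add: "bij (\<lambda>x. t - x + s :: 'g::group_add)"
  by (rule bij_betw_byWitness[where f' = "\<lambda>y. s - y + t"]) (auto simp only: group_normalize)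

lemma left_regular_apply_apply [simp]:
  "ell2_apply (blinfun_apply (left_regular p) f) t = ell2_apply f (- p + t)"
  by (simp add: left_regular_apply left_translate.rep_eq)

lemma left_regular_bounded_ops [simp]: "left_regular p \<in> bounded_ops"
  by (auto simp: bounded_ops_def intro!: ell2_eqI)

lemma left_regular_delta [simp]: "blinfun_apply (left_regular p) (delta s) = delta (p + s)"
  by (rule ell2_eqI) (auto simp: add.assoc[symmetric] eq_neg_iff_add_eq_0 minus_add_cancel)

lemma left_regular_add: "blinfun_apply (left_regular (p + q)) f = blinfun_apply (left_regular p) (blinfun_apply (left_regular q) f)"
  by (rule ell2_eqI) (simp only: left_regular_apply_apply group_normalize)

lemma entry_left_regular [simp]: "entry (left_regular p) t s = (if t = p + s then 1 else 0)"
  by (simp add: entry_def)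

lemma norm_left_regular [simp]: "norm (blinfun_apply (left_regular p) f) = norm f"
  by (simp add: left_regular_apply norm_left_translate)

section \<open>Right translations and the commutation theorem\<close>

lemma bij_right_translation: "bij (\<lambda>y. y + x :: 'g::group_add)"
  by (rule bij_betw_byWitness[where f' = "\<lambda>y. y - x"]) auto

lift_definition right_translate :: "'g::group_add \<Rightarrow> 'g ell2 \<Rightarrow> 'g ell2" is "\<lambda>x f y. f (y + x)"
  by (subst summable_on_reindex_bij_betw[OF bij_right_translation])

lemma norm_right_translate: "norm (right_translate x f) = norm f"
  unfolding norm_ell2_eq right_translate.rep_eq
  by (subst infsum_reindex_bij_betw[OF bij_right_translation]) simp

lemma right_translate_delta: "right_translate x (delta s) = delta (s - x)"
  by (rule ell2_eqI) (auto simp: right_translate.rep_eq eq_diff_eq)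

text \<open>Associativity makes right translations commute with left ones. They are the elements of
  the commutant against which the von Neumann algebra is tested.\<close>

lemma right_translate_op:
  obtains R where "R \<in> commutant (range left_regular)" "blinfun_apply R = right_translate x"
proof -
  have "bounded_linear (right_translate x)"
    by (rule bounded_linear_intro[where K = 1])
      (auto intro!: ell2_eqI simp: right_translate.rep_eq norm_right_translate)
  then have "blinfun_apply (Blinfun (right_translate x)) = right_translate x"
    by (simp add: bounded_linear_Blinfun_apply)
  then show ?thesis
    by (intro that[of "Blinfun (right_translate x)"])
      (auto simp: commutant_def bounded_ops_def right_translate.rep_eq add.assoc intro!: ell2_eqI blinfun_eqI)
qed

lemma commutant_subset_bounded_ops: "commutant S \<subseteq> bounded_ops"
  by (auto simp: commutant_def)

lemma commutant_commute:
  "T \<in> commutant S \<Longrightarrow> s \<in> S \<Longrightarrow> blinfun_apply T (blinfun_apply s f) = blinfun_apply s (blinfun_apply T f)"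
  by (auto simp: commutant_def blinfun_apply_blinfun_compose[symmetric] simp del: blinfun_apply_blinfun_compose)

lemma group_vN_bounded_ops: "T \<in> group_vN \<Longrightarrow> T \<in> bounded_ops"
  using commutant_subset_bounded_ops by (auto simp: group_vN_def)

text \<open>\<open>T\<close> commutes with the right translation that takes
  \<open>delta (s + x)\<close> to \<open>delta s\<close>; as a consequence its entries depend on
  \<open>t - s\<close> only.\<close>

lemma group_vN_entry:
  assumes "T \<in> group_vN"
  shows "entry T (t + x) (s + x) = entry T t s"
proof -
  obtain R where R: "R \<in> commutant (range left_regular)" "blinfun_apply R = right_translate x"
    by (rule right_translate_op)
  have "blinfun_apply T (blinfun_apply R (delta (s + x))) = blinfun_apply R (blinfun_apply T (delta (s + x)))"
    using assms R(1) unfolding group_vN_def by (rule commutant_commute)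
  then have "blinfun_apply T (delta s) = right_translate x (blinfun_apply T (delta (s + x)))"
    by (simp add: R right_translate_delta)
  then show ?thesis
    by (simp add: entry_def right_translate.rep_eq)
qed

lemma group_vN_entry_0: "T \<in> group_vN \<Longrightarrow> entry T t s = entry T (t - s) 0"
  using group_vN_entry[of T "t - s" s 0] by simp

lemma commutant_left_regular_entry:
  assumes "S \<in> commutant (range left_regular)"
  shows "entry S (x + t) (x + s) = entry S t s"
proof -
  have "blinfun_apply S (blinfun_apply (left_regular x) (delta s))
      = blinfun_apply (left_regular x) (blinfun_apply S (delta s))"
    using assms by (rule commutant_commute) simp
  then show ?thesis by (simp add: entry_def add.assoc[symmetric])
qed

lemma has_sum_entry_compose:
  assumes "T \<in> bounded_ops"
  shows "((\<lambda>x. entry T t x * entry S x s) has_sum entry (T o\<^sub>L S) t s) UNIV"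
  using op_has_sum[OF assms, of t "blinfun_apply S (delta s)"] by (simp add: entry_def)

text \<open>The commutation theorem: convolution operators from the left commute with convolution
  operators from the right because both products have the same matrix entries, up to the
  substitution \<open>x \<mapsto> t - x + s\<close> of the summation index.\<close>

lemma group_vN_iff:
  "T \<in> group_vN \<longleftrightarrow> T \<in> bounded_ops \<and> (\<forall>t s x. entry T (t + x) (s + x) = entry T t s)"
proof (intro iffI conjI allI)
  assume T: "T \<in> bounded_ops \<and> (\<forall>t s x. entry T (t + x) (s + x) = entry T t s)"
  have "T o\<^sub>L S = S o\<^sub>L T" if S: "S \<in> commutant (range left_regular)" for S
  proof (rule op_eqI)
    have Sb: "S \<in> bounded_ops" using S commutant_subset_bounded_ops by blast
    then show "T o\<^sub>L S \<in> bounded_ops" "S o\<^sub>L T \<in> bounded_ops" using T by auto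
    fix t s
    \<comment> \<open>The two sums agree term by term after the substitution: left translation by
      \<open>x - t\<close> moves the factor of \<open>S\<close>, right translation by
      \<open>- s + x\<close> moves the factor of \<open>T\<close>.\<close>
    have eq: "entry S t (t - x + s) * entry T (t - x + s) s = entry T t x * entry S x s" for x
    proof -
      have "(x - t) + (t - x + s) = s" "(x - t) + t = x" by (simp_all only: group_normalize)
      then have "entry S t (t - x + s) = entry S x s"
        using commutant_left_regular_entry[OF S, of "x - t" t "t - x + s"] by simp
      moreover have "(t - x + s) + (- s + x) = t" "s + (- s + x) = x" by (simp_all only: group_normalize)
      then have "entry T (t - x + s) s = entry T t x"
        using T[THEN conjunct2, rule_format, of "t - x + s" "- s + x" s] by simp
      ultimately show ?thesis by simp
    qed
    show "entry (T o\<^sub>L S) t s = entry (S o\<^sub>L T) t s"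
      using has_sum_entry_compose[of T t S s] has_sum_entry_compose[of S t T s] T Sb
        has_sum_reindex_bij_betw[OF bij_diff_add[of t s], of "\<lambda>x. entry S t x * entry T x s"] has_sum_unique
      unfolding eq by blast
  qed
  then show "T \<in> group_vN" unfolding group_vN_def commutant_def[of "commutant _"] using T by blast
qed (auto simp: group_vN_bounded_ops group_vN_entry)

lemma group_vN_intros [intro, simp]:
  "0 \<in> group_vN"
  "T \<in> group_vN \<Longrightarrow> S \<in> group_vN \<Longrightarrow> T + S \<in> group_vN"
  "T \<in> group_vN \<Longrightarrow> S \<in> group_vN \<Longrightarrow> T - S \<in> group_vN"
  "T \<in> group_vN \<Longrightarrow> op_scale c T \<in> group_vN"
  "left_regular p \<in> group_vN"
  by (auto simp: group_vN_iff add.assoc[symmetric])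

lemma op_span_left_regular_subset: "op_span (range left_regular) \<subseteq> group_vN"
proof
  fix x assume "x \<in> op_span (range left_regular)"
  then show "x \<in> group_vN"
    by (induction rule: op_complex.span_induct_alt) auto
qed

lemma closed_commutant: "closed (commutant S)"
  unfolding closed_sequential_limits
proof (intro allI impI, elim conjE)
  fix X T assume X: "\<forall>n. X n \<in> commutant S" and lim: "X \<longlonglongrightarrow> T"
  have ap: "(\<lambda>n. blinfun_apply (X n) f) \<longlonglongrightarrow> blinfun_apply T f" for f
    by (rule bounded_linear.tendsto[OF blinfun.bounded_linear_left lim])
  have "blinfun_apply T (ell2_scale c f) = ell2_scale c (blinfun_apply T f)" for c f
  proof (rule LIMSEQ_unique[OF ap])
    have "X n \<in> bounded_ops" for n using X commutant_subset_bounded_ops by blast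
    then show "(\<lambda>n. blinfun_apply (X n) (ell2_scale c f)) \<longlonglongrightarrow> ell2_scale c (blinfun_apply T f)"
      using bounded_linear.tendsto[OF bounded_linear_ell2_scale ap] by (simp add: bounded_opsD)
  qed
  moreover have "blinfun_apply T (blinfun_apply s f) = blinfun_apply s (blinfun_apply T f)" if s: "s \<in> S" for s f
  proof (rule LIMSEQ_unique[OF ap])
    show "(\<lambda>n. blinfun_apply (X n) (blinfun_apply s f)) \<longlonglongrightarrow> blinfun_apply s (blinfun_apply T f)"
    proof -
      have "blinfun_apply (X n) (blinfun_apply s f) = blinfun_apply s (blinfun_apply (X n) f)" for n
        using X s commutant_commute by blast
      then show ?thesis using bounded_linear.tendsto[OF blinfun.bounded_linear_right ap, of s] by simp
    qed
  qed
  ultimately show "T \<in> commutant S"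
    by (auto simp: commutant_def bounded_ops_def intro!: blinfun_eqI)
qed

lemma reduced_Cstar_subset: "reduced_Cstar \<subseteq> group_vN"
  unfolding reduced_Cstar_def
  by (rule closure_minimal[OF op_span_left_regular_subset]) (simp add: group_vN_def closed_commutant)

lemma left_regular_in_reduced_Cstar: "left_regular p \<in> reduced_Cstar"
  unfolding reduced_Cstar_def by (rule subsetD[OF closure_subset op_complex.span_base[OF rangeI]])

section \<open>Schur multiplication by Fourier algebra functions\<close>

definition coefficient :: "'g::group_add ell2 \<Rightarrow> 'g ell2 \<Rightarrow> 'g \<Rightarrow> complex" where
  "coefficient f g x = cinner (blinfun_apply (left_regular x) f) g"

lemma fourier_algebra_iff: "\<phi> \<in> fourier_algebra \<longleftrightarrow> (\<exists>f g. \<phi> = coefficient f g)"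
  by (auto simp: fourier_algebra_def coefficient_def[abs_def])

lemma coefficient_in_fourier_algebra: "coefficient f g \<in> fourier_algebra"
  by (auto simp: fourier_algebra_iff)

text \<open>Shifting the summation index by \<open>t\<close> separates the variables: every term is
  a function of \<open>s\<close> times a function of \<open>t\<close>. This separation is what makes
  the Schur multiplier bounded.\<close>

lemma coefficient_has_sum:
  "((\<lambda>z. ell2_apply f (s + z) * cnj (ell2_apply g (t + z))) has_sum coefficient f g (t - s)) UNIV"
proof -
  have bij: "bij (\<lambda>z. t + z)" using bij_left_translation[of "- t"] by simp
  have "- (t - s) + (t + z) = s + z" for z
    by (metis add.assoc diff_add_cancel minus_diff_eq)
  then show ?thesis
    using has_sum_reindex_bij_betw[OF bij, of "\<lambda>z. ell2_apply f (- (t - s) + z) * cnj (ell2_apply g z)"]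
      cinner_has_sum[of "blinfun_apply (left_regular (t - s)) f" g]
    by (simp add: coefficient_def)
qed

lemma coefficient_diff:
  "coefficient f g x - coefficient f' g' x = coefficient (f - f') g x + coefficient f' (g - g') x"
  by (simp add: coefficient_def blinfun.diff_right cinner_diff_left cinner_diff_right)

lemma has_sum_sum:
  fixes f :: "'i \<Rightarrow> 'b \<Rightarrow> 'c::{topological_comm_monoid_add, t2_space}"
  assumes "\<And>i. i \<in> A \<Longrightarrow> (f i has_sum s i) B"
  shows "((\<lambda>x. \<Sum>i\<in>A. f i x) has_sum (\<Sum>i\<in>A. s i)) B"
  using assms by (induction A rule: infinite_finite_induct) (auto intro: has_sum_add)

lemma has_sum_norm_le:
  assumes "(f has_sum s) A" "\<And>F. finite F \<Longrightarrow> F \<subseteq> A \<Longrightarrow> norm (sum f F) \<le> B"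
  shows "norm s \<le> B"
  using assms unfolding has_sum_def
  by (intro tendsto_upperbound[OF tendsto_norm])
    (auto intro!: eventually_finite_subsets_at_top_weakI finite_subsets_at_top_neq_bot)

text \<open>Writing \<open>\<phi>(t - s)\<close> as \<open>\<Sum>\<^sub>z f(s + z) cnj(g(t + z))\<close> exhibits Schur multiplication by \<open>\<phi>\<close>
  as \<open>T \<mapsto> \<Sum>\<^sub>z G\<^sub>z\<^sup>* T F\<^sub>z\<close> with diagonal operators.\<close>

lemma schur_form_bound:
  assumes F: "finite F" and a: "\<And>i j. i < n \<Longrightarrow> j < n \<Longrightarrow> a i j \<in> bounded_ops"
  shows "cmod (matrix_form n (\<lambda>i j t s. coefficient f g (t - s) * entry (a i j) t s) F x y)
    \<le> norm f * norm g * matrix_norm n a * fin_norm n F x * fin_norm n F y"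
proof (rule has_sum_norm_le)
  define X where "X f z j s = ell2_apply f (s + z) * x j s" for f :: "'a ell2" and z :: 'a and j :: nat and s
  define Y where "Y z i t = ell2_apply g (t + z) * y i t" for z :: 'a and i :: nat and t
  show "((\<lambda>z. matrix_form n (\<lambda>i j. entry (a i j)) F (X f z) (Y z)) has_sum
      matrix_form n (\<lambda>i j t s. coefficient f g (t - s) * entry (a i j) t s) F x y) UNIV"
    unfolding matrix_form_def
  proof (intro has_sum_sum)
    fix i j t s
    show "((\<lambda>z. entry (a i j) t s * X f z j s * cnj (Y z i t)) has_sum
        coefficient f g (t - s) * entry (a i j) t s * x j s * cnj (y i t)) UNIV"
      using has_sum_cmult_right[OF coefficient_has_sum[of f s g t], of "entry (a i j) t s * x j s * cnj (y i t)"]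
      by (simp add: X_def Y_def ac_simps)
  qed
  \<comment> \<open>When the sum over \<open>z\<close> is taken first, every \<open>s\<close> meets
    a translate of \<open>h\<close>, which contributes at most \<open>(norm h)\<^sup>2\<close>. The
    bound is therefore uniform in \<open>Z\<close>.\<close>
  have N: "L2_set (\<lambda>z. fin_norm n F (\<lambda>i t. ell2_apply h (t + z) * w i t)) Z \<le> norm h * fin_norm n F w"
    if Z: "finite Z" for Z and h :: "'a ell2" and w
  proof -
    have "(\<Sum>z\<in>Z. (fin_norm n F (\<lambda>i t. ell2_apply h (t + z) * w i t))\<^sup>2)
        = (\<Sum>j<n. \<Sum>s\<in>F. \<Sum>z\<in>Z. (cmod (ell2_apply h (s + z)))\<^sup>2 * (cmod (w j s))\<^sup>2)"
      unfolding fin_norm_power2 norm_mult power_mult_distrib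
      by (rule trans[OF sum.swap], rule sum.cong[OF refl], rule sum.swap)
    also have "\<dots> \<le> (\<Sum>j<n. \<Sum>s\<in>F. (norm h)\<^sup>2 * (cmod (w j s))\<^sup>2)"
    proof (intro sum_mono)
      fix j s
      have "(\<Sum>z\<in>Z. (cmod (ell2_apply h (s + z)))\<^sup>2) = (\<Sum>z\<in>(+) s ` Z. (cmod (ell2_apply h z))\<^sup>2)"
        by (subst sum.reindex) (auto simp: inj_on_def)
      also have "\<dots> \<le> (norm h)\<^sup>2" using Z by (intro ell2_sum_le_norm) simp
      finally show "(\<Sum>z\<in>Z. (cmod (ell2_apply h (s + z)))\<^sup>2 * (cmod (w j s))\<^sup>2) \<le> (norm h)\<^sup>2 * (cmod (w j s))\<^sup>2"
        unfolding sum_distrib_right[symmetric] by (intro mult_right_mono) auto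
    qed
    also have "\<dots> = (norm h * fin_norm n F w)\<^sup>2"
      by (simp add: power_mult_distrib fin_norm_power2 sum_distrib_left)
    finally show ?thesis unfolding L2_set_def by (intro real_le_lsqrt) (auto intro: sum_nonneg)
  qed
  fix Z :: "'a set" assume Z: "finite Z" "Z \<subseteq> UNIV"
  \<comment> \<open>Each \<open>z\<close> contributes one form of the original \<open>a\<close> on
    reweighted vectors; Cauchy-Schwarz over \<open>z\<close> then recombines them.\<close>
  have "cmod (\<Sum>z\<in>Z. matrix_form n (\<lambda>i j. entry (a i j)) F (X f z) (Y z))
      \<le> (\<Sum>z\<in>Z. matrix_norm n a * (\<bar>fin_norm n F (X f z)\<bar> * \<bar>fin_norm n F (Y z)\<bar>))"
    by (rule sum_norm_le) (use matrix_form_bound[OF F a] in \<open>simp add: mult.assoc\<close>)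
  also have "\<dots> \<le> matrix_norm n a * (L2_set (\<lambda>z. fin_norm n F (X f z)) Z * L2_set (\<lambda>z. fin_norm n F (Y z)) Z)"
    unfolding sum_distrib_left[symmetric] by (intro mult_left_mono L2_set_mult_ineq matrix_norm_nonneg)
  also have "\<dots> \<le> matrix_norm n a * ((norm f * fin_norm n F x) * (norm g * fin_norm n F y))"
    using N[OF Z(1), of f x] N[OF Z(1), of g y] unfolding X_def Y_def
    by (intro mult_left_mono mult_mono matrix_norm_nonneg) auto
  finally show "cmod (\<Sum>z\<in>Z. matrix_form n (\<lambda>i j. entry (a i j)) F (X f z) (Y z))
      \<le> norm f * norm g * matrix_norm n a * fin_norm n F x * fin_norm n F y"
    by (simp add: ac_simps)
qed

text \<open>Entries determine a complex linear operator, so the choice is unique where it exists;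
  existence is shown for \<phi> in the Fourier algebra.\<close>

definition schur :: "('g::group_add \<Rightarrow> complex) \<Rightarrow> 'g op \<Rightarrow> 'g op" where
  "schur \<phi> T = (SOME S. S \<in> bounded_ops \<and> (\<forall>t s. entry S t s = \<phi> (t - s) * entry T t s))"

text \<open>The case \<open>n = 1\<close> of \<open>schur_form_bound\<close> is the bound on finite
  sections that \<open>op_of_matrix\<close> asks for.\<close>

lemma
  fixes T :: "'g::group_add op"
  assumes \<phi>: "\<phi> \<in> fourier_algebra" and T: "T \<in> bounded_ops"
  shows schur_bounded_ops [simp]: "schur \<phi> T \<in> bounded_ops"
    and entry_schur [simp]: "entry (schur \<phi> T) t s = \<phi> (t - s) * entry T t s"
proof -
  obtain f g where fg: "\<phi> = coefficient f g" using \<phi> by (auto simp: fourier_algebra_iff)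
  have one: "L2_set h {..<Suc 0} = \<bar>h 0\<bar>" for h by (simp add: L2_set_def)
  have "\<exists>S\<in>bounded_ops. \<forall>t s. entry S t s = \<phi> (t - s) * entry T t s"
  proof (rule op_of_matrix)
    fix F :: "'g set" and x y :: "'g \<Rightarrow> complex" assume F: "finite F"
    show "cmod (\<Sum>t\<in>F. \<Sum>s\<in>F. \<phi> (t - s) * entry T t s * x s * cnj (y t))
      \<le> norm f * norm g * norm T * L2_set (\<lambda>s. cmod (x s)) F * L2_set (\<lambda>t. cmod (y t)) F"
    proof -
      have fn: "fin_norm 1 F (\<lambda>_. w) = L2_set (\<lambda>s. cmod (w s)) F" for w by (simp add: fin_norm_def one)
      have mf: "matrix_form 1 (\<lambda>i j t s. coefficient f g (t - s) * entry T t s) F (\<lambda>_. x) (\<lambda>_. y)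
          = (\<Sum>t\<in>F. \<Sum>s\<in>F. \<phi> (t - s) * entry T t s * x s * cnj (y t))"
        by (simp add: matrix_form_def fg)
      have "cmod (matrix_form 1 (\<lambda>i j t s. coefficient f g (t - s) * entry T t s) F (\<lambda>_. x) (\<lambda>_. y))
          \<le> norm f * norm g * matrix_norm 1 (\<lambda>_ _. T) * fin_norm 1 F (\<lambda>_. x) * fin_norm 1 F (\<lambda>_. y)"
        by (rule schur_form_bound[OF F T])
      then show ?thesis unfolding mf fn matrix_norm_1 .
    qed
  qed simp
  then have "schur \<phi> T \<in> bounded_ops \<and> (\<forall>t s. entry (schur \<phi> T) t s = \<phi> (t - s) * entry T t s)"
    unfolding schur_def by - (rule someI_ex, blast)
  then show "schur \<phi> T \<in> bounded_ops" "entry (schur \<phi> T) t s = \<phi> (t - s) * entry T t s" by auto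
qed

lemma schur_group_vN [simp]: "\<phi> \<in> fourier_algebra \<Longrightarrow> T \<in> group_vN \<Longrightarrow> schur \<phi> T \<in> group_vN"
proof -
  have "(t + x) - (s + x) = t - s" for t s x :: 'a by (simp only: group_normalize)
  then show "\<phi> \<in> fourier_algebra \<Longrightarrow> T \<in> group_vN \<Longrightarrow> schur \<phi> T \<in> group_vN"
    by (simp add: group_vN_iff)
qed

lemma schur_left_regular:
  "\<phi> \<in> fourier_algebra \<Longrightarrow> schur \<phi> (left_regular p) = op_scale (\<phi> p) (left_regular p)"
  by (rule op_eqI) auto

lemma schur_add:
  "\<phi> \<in> fourier_algebra \<Longrightarrow> T \<in> bounded_ops \<Longrightarrow> S \<in> bounded_ops \<Longrightarrow> schur \<phi> (T + S) = schur \<phi> T + schur \<phi> S"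
  by (rule op_eqI) (auto simp: algebra_simps)

lemma schur_scale:
  "\<phi> \<in> fourier_algebra \<Longrightarrow> T \<in> bounded_ops \<Longrightarrow> schur \<phi> (op_scale c T) = op_scale c (schur \<phi> T)"
  by (rule op_eqI) (auto simp: algebra_simps)

lemma clinear_on_schur: "\<phi> \<in> fourier_algebra \<Longrightarrow> V \<subseteq> group_vN \<Longrightarrow> clinear_on V op_scale (schur \<phi>)"
  by (auto simp: clinear_on_def subset_iff intro!: schur_add schur_scale group_vN_bounded_ops)

lemma schur_scale_left:
  "\<phi> \<in> fourier_algebra \<Longrightarrow> (\<lambda>x. c * \<phi> x) \<in> fourier_algebra \<Longrightarrow> T \<in> bounded_ops
    \<Longrightarrow> schur (\<lambda>x. c * \<phi> x) T = op_scale c (schur \<phi> T)"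
  by (rule op_eqI) auto

lemma scale_in_fourier_algebra: "\<phi> \<in> fourier_algebra \<Longrightarrow> (\<lambda>x. c * \<phi> x) \<in> fourier_algebra"
proof -
  assume "\<phi> \<in> fourier_algebra"
  then obtain f g where "\<phi> = coefficient f g" by (auto simp: fourier_algebra_iff)
  then have "(\<lambda>x. c * \<phi> x) = coefficient (ell2_scale c f) g"
    by (auto simp: coefficient_def bounded_opsD)
  then show ?thesis by (auto simp: fourier_algebra_iff)
qed

text \<open>\<open>left_regular x\<close> moves \<open>delta 0\<close> to \<open>delta x\<close>, so
  pairing with the conjugate of \<phi> reads off the value of \<phi> at \<open>x\<close>.\<close>

lemma square_summable_in_fourier_algebra:
  assumes "(\<lambda>x. (cmod (\<phi> x))\<^sup>2) summable_on UNIV"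
  shows "\<phi> \<in> fourier_algebra"
proof -
  define g where "g = Abs_ell2 (\<lambda>x. cnj (\<phi> x))"
  have "ell2_apply g = (\<lambda>x. cnj (\<phi> x))" using assms by (simp add: g_def Abs_ell2_inverse)
  then have "\<phi> = coefficient (delta 0) g"
    using cinner_cnj[of g "delta _"] by (auto simp: coefficient_def fun_eq_iff)
  then show ?thesis by (auto simp: fourier_algebra_iff)
qed

text \<open>Any \<open>T\<close> induces the multiplier \<open>\<phi>(x) = \<langle>T \<lambda>(x) \<delta>\<^sub>0, \<delta>\<^sub>x\<rangle>\<close>. The matrix with entries
  \<open>\<langle>a\<^sub>i\<^sub>j \<delta>\<^sub>s, \<delta>\<^sub>t\<rangle> \<lambda>(t - s)\<close>, rows indexed by \<open>(i, t)\<close> and columns by \<open>(j, s)\<close>, is a compression of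
  \<open>a\<close> conjugated by diagonal unitaries; applying \<open>T\<close> to its entries and testing on the vectors
  \<open>x\<^sub>j(s) \<delta>\<^sub>s\<close> and \<open>y\<^sub>i(t) \<delta>\<^sub>t\<close> gives the form of \<open>schur \<phi>\<close>.\<close>

lemma matrix_norm_transference:
  fixes a :: "nat \<Rightarrow> nat \<Rightarrow> 'g::group_add op"
  assumes F: "finite F" and e: "bij_betw e {..<N} ({..<n} \<times> F)"
    and a: "\<And>i j. i < n \<Longrightarrow> j < n \<Longrightarrow> a i j \<in> bounded_ops"
  shows "matrix_norm N (\<lambda>k l. op_scale (entry (a (fst (e k)) (fst (e l))) (snd (e k)) (snd (e l)))
      (left_regular (snd (e k) - snd (e l)))) \<le> matrix_norm n a"
proof (rule matrix_norm_least[OF matrix_norm_nonneg])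
  fix \<xi> :: "nat \<Rightarrow> 'g ell2"
  define c where "c k l = entry (a (fst (e k)) (fst (e l))) (snd (e k)) (snd (e l))" for k l
  \<comment> \<open>The unitary belonging to column \<open>l\<close> is absorbed into the vector;
    the unitary of row \<open>k\<close> can be pulled out of the sum and disappears from the
    norm.\<close>
  define \<zeta> where "\<zeta> l = blinfun_apply (left_regular (- snd (e l))) (\<xi> l)" for l
  have re: "(\<Sum>k<N. h (fst (e k)) (snd (e k))) = (\<Sum>i<n. \<Sum>t\<in>F. h i t)" for h :: "nat \<Rightarrow> 'g \<Rightarrow> 'z::comm_monoid_add"
    using sum.reindex_bij_betw[OF e, of "\<lambda>p. h (fst p) (snd p)"] by (simp add: sum.cartesian_product case_prod_unfold)
  \<comment> \<open>The scalar matrix \<open>c\<close> is \<open>a\<close> compressed to finitely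
    many coordinates: inverting \<open>e\<close> reads \<open>z\<close> as vectors
    \<open>v j\<close> supported in \<open>F\<close>, and dropping the coordinates of the image
    outside \<open>F\<close> only lowers its norm.\<close>
  have scalar: "(\<Sum>k<N. (cmod (\<Sum>l<N. c k l * z l))\<^sup>2) \<le> (matrix_norm n a)\<^sup>2 * (\<Sum>l<N. (cmod (z l))\<^sup>2)" for z
  proof -
    define e' where "e' = the_inv_into {..<N} e"
    have e': "e' (e l) = l" if "l < N" for l
      using e that unfolding e'_def bij_betw_def by (intro the_inv_into_f_f) auto
    define x where "x j s = z (e' (j, s))" for j s
    define v where "v j = ell2_fin F (x j)" for j
    have z: "z l = x (fst (e l)) (snd (e l))" if "l < N" for l using that by (simp add: x_def e')
    have inner: "(\<Sum>l<N. c k l * z l) = ell2_apply (\<Sum>j<n. blinfun_apply (a (fst (e k)) j) (v j)) (snd (e k))"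
      if "k < N" for k
    proof -
      have "e k \<in> {..<n} \<times> F" using bij_betw_apply[OF e] that by blast
      then have "fst (e k) < n" by auto
      have "(\<Sum>l<N. c k l * z l) = (\<Sum>l<N. entry (a (fst (e k)) (fst (e l))) (snd (e k)) (snd (e l)) * x (fst (e l)) (snd (e l)))"
        by (intro sum.cong) (auto simp: c_def z)
      also have "\<dots> = (\<Sum>j<n. \<Sum>s\<in>F. entry (a (fst (e k)) j) (snd (e k)) s * x j s)" by (rule re)
      also have "\<dots> = ell2_apply (\<Sum>j<n. blinfun_apply (a (fst (e k)) j) (v j)) (snd (e k))"
        using a \<open>fst (e k) < n\<close> F by (simp add: v_def op_apply_fin)
      finally show ?thesis .
    qed
    have "(\<Sum>k<N. (cmod (\<Sum>l<N. c k l * z l))\<^sup>2)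
        = (\<Sum>k<N. (cmod (ell2_apply (\<Sum>j<n. blinfun_apply (a (fst (e k)) j) (v j)) (snd (e k))))\<^sup>2)"
      by (intro sum.cong) (auto simp: inner simp del: ell2_apply_sum)
    also have "\<dots> = (\<Sum>i<n. \<Sum>t\<in>F. (cmod (ell2_apply (\<Sum>j<n. blinfun_apply (a i j) (v j)) t))\<^sup>2)"
      by (rule re[of "\<lambda>i t. (cmod (ell2_apply (\<Sum>j<n. blinfun_apply (a i j) (v j)) t))\<^sup>2"])
    also have "\<dots> \<le> (\<Sum>i<n. (norm (\<Sum>j<n. blinfun_apply (a i j) (v j)))\<^sup>2)"
      by (intro sum_mono ell2_sum_le_norm F)
    also have "\<dots> = (L2_set (\<lambda>i. norm (\<Sum>j<n. blinfun_apply (a i j) (v j))) {..<n})\<^sup>2"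
      by (simp add: L2_set_def sum_nonneg)
    also have "\<dots> \<le> (matrix_norm n a * L2_set (\<lambda>j. norm (v j)) {..<n})\<^sup>2"
      by (intro power_mono matrix_norm_upper) simp
    also have "\<dots> = (matrix_norm n a)\<^sup>2 * (\<Sum>j<n. \<Sum>s\<in>F. (cmod (x j s))\<^sup>2)"
      by (simp add: power_mult_distrib L2_set_def sum_nonneg v_def norm_fin_power2 F)
    also have "(\<Sum>j<n. \<Sum>s\<in>F. (cmod (x j s))\<^sup>2) = (\<Sum>l<N. (cmod (z l))\<^sup>2)"
      unfolding re[symmetric, of "\<lambda>j s. (cmod (x j s))\<^sup>2"] by (intro sum.cong) (auto simp: z)
    finally show ?thesis .
  qed
  \<comment> \<open>\<open>c\<close> acts on tuples of vectors coordinatewise, so the scalar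
    estimate is applied in each coordinate and summed.\<close>
  have "(\<Sum>k<N. (norm (\<Sum>l<N. ell2_scale (c k l) (\<zeta> l)))\<^sup>2) \<le> (matrix_norm n a)\<^sup>2 * (\<Sum>l<N. (norm (\<zeta> l))\<^sup>2)"
  proof (rule has_sum_mono)
    show "((\<lambda>x. \<Sum>k<N. (cmod (\<Sum>l<N. c k l * ell2_apply (\<zeta> l) x))\<^sup>2) has_sum
        (\<Sum>k<N. (norm (\<Sum>l<N. ell2_scale (c k l) (\<zeta> l)))\<^sup>2)) UNIV"
      using ell2_has_sum_norm[of "\<Sum>l<N. ell2_scale (c _ l) (\<zeta> l)"] by (intro has_sum_sum) simp
    show "((\<lambda>x. (matrix_norm n a)\<^sup>2 * (\<Sum>l<N. (cmod (ell2_apply (\<zeta> l) x))\<^sup>2)) has_sum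
        (matrix_norm n a)\<^sup>2 * (\<Sum>l<N. (norm (\<zeta> l))\<^sup>2)) UNIV"
      by (intro has_sum_cmult_right has_sum_sum ell2_has_sum_norm)
  qed (rule scalar)
  from real_sqrt_le_mono[OF this] have "L2_set (\<lambda>k. norm (\<Sum>l<N. ell2_scale (c k l) (\<zeta> l))) {..<N}
      \<le> matrix_norm n a * L2_set (\<lambda>l. norm (\<zeta> l)) {..<N}"
    by (simp add: L2_set_def real_sqrt_mult matrix_norm_nonneg)
  moreover have "norm (\<Sum>l<N. blinfun_apply (op_scale (c k l) (left_regular (snd (e k) - snd (e l)))) (\<xi> l))
      = norm (\<Sum>l<N. ell2_scale (c k l) (\<zeta> l))" for k
  proof -
    have "(\<Sum>l<N. blinfun_apply (op_scale (c k l) (left_regular (snd (e k) - snd (e l)))) (\<xi> l))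
        = blinfun_apply (left_regular (snd (e k))) (\<Sum>l<N. ell2_scale (c k l) (\<zeta> l))"
      using left_regular_add[of "snd (e k)" "- snd (e _)"]
      by (simp add: blinfun.sum_right bounded_opsD op_scale_apply \<zeta>_def)
    then show ?thesis by simp
  qed
  ultimately show "L2_set (\<lambda>k. norm (\<Sum>l<N. blinfun_apply (op_scale (entry (a (fst (e k)) (fst (e l))) (snd (e k)) (snd (e l)))
      (left_regular (snd (e k) - snd (e l)))) (\<xi> l))) {..<N} \<le> matrix_norm n a * L2_set (\<lambda>l. norm (\<xi> l)) {..<N}"
    by (simp add: c_def \<zeta>_def)
qed

text \<open>\<open>T\<close> is evaluated only on multiples of the \<open>left_regular p\<close>, so
  a bound on a small \<open>V\<close> such as the reduced C*-algebra passes to the multiplier on the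
  whole von Neumann algebra.\<close>

lemma cb_norm_schur_le:
  fixes T :: "'g::group_add op \<Rightarrow> 'g op"
  assumes V: "range left_regular \<subseteq> V" "\<And>c x. x \<in> V \<Longrightarrow> op_scale c x \<in> V"
    and T: "clinear_on V op_scale T" "T ` V \<subseteq> group_vN" and k: "0 \<le> k" "cb_norm V T \<le> ennreal k"
    and \<phi>: "\<phi> \<in> fourier_algebra" "\<And>x. \<phi> x = entry (T (left_regular x)) x 0"
  shows "cb_norm group_vN (schur \<phi>) \<le> ennreal k"
  unfolding cb_norm_le_iff[OF k(1)]
proof (intro allI impI, elim conjE)
  fix n and a :: "nat \<Rightarrow> nat \<Rightarrow> 'g op"
  assume a: "\<forall>i<n. \<forall>j<n. a i j \<in> group_vN" "matrix_norm n a \<le> 1"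
  have ab: "a i j \<in> bounded_ops" if "i < n" "j < n" for i j using a that group_vN_bounded_ops by blast
  show "matrix_norm n (\<lambda>i j. schur \<phi> (a i j)) \<le> k"
  proof (rule matrix_norm_le_form[OF _ k(1)])
    show "schur \<phi> (a i j) \<in> bounded_ops" if "i < n" "j < n" for i j using ab that \<phi> by simp
    fix F :: "'g set" and x y assume F: "finite F"
    then obtain e where e: "bij_betw e {..<card ({..<n} \<times> F)} ({..<n} \<times> F)"
      using ex_bij_betw_nat_finite[of "{..<n} \<times> F"] by (auto simp: atLeast0LessThan)
    define N where "N = card ({..<n} \<times> F)"
    note e = e[folded N_def]
    have re: "(\<Sum>k<N. h (fst (e k)) (snd (e k))) = (\<Sum>i<n. \<Sum>t\<in>F. h i t)" for h :: "nat \<Rightarrow> 'g \<Rightarrow> 'z::comm_monoid_add"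
      using sum.reindex_bij_betw[OF e, of "\<lambda>p. h (fst p) (snd p)"] by (simp add: sum.cartesian_product case_prod_unfold)
    define A where "A k l = op_scale (entry (a (fst (e k)) (fst (e l))) (snd (e k)) (snd (e l)))
      (left_regular (snd (e k) - snd (e l)))" for k l
    have AV: "A k l \<in> V" for k l using V by (auto simp: A_def)
    have "matrix_norm N A \<le> 1"
      using matrix_norm_transference[OF F e, of a, OF ab] a(2) unfolding A_def by linarith
    then have TA: "matrix_norm N (\<lambda>k l. T (A k l)) \<le> k" using AV by (intro cb_norm_leD[OF k(2,1)]) auto
    define \<xi> where "\<xi> w k = ell2_scale (w (fst (e k)) (snd (e k))) (delta (snd (e k)))" for w :: "nat \<Rightarrow> 'g \<Rightarrow> complex" and k
    have N\<xi>: "L2_set (\<lambda>k. norm (\<xi> w k)) {..<N} = fin_norm n F w" for w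
      using re[of "\<lambda>i t. (cmod (w i t))\<^sup>2"]
      by (simp add: L2_set_def \<xi>_def norm_ell2_scale sum_nonneg fin_norm_def)
    have TA_in: "T (A k l) = op_scale (entry (a (fst (e k)) (fst (e l))) (snd (e k)) (snd (e l)))
        (T (left_regular (snd (e k) - snd (e l))))" for k l
      using T(1) V unfolding A_def clinear_on_def by blast
    \<comment> \<open>\<open>T\<close> takes values in the von Neumann algebra, so the entry at
      \<open>(x, 0)\<close> that defines \<phi> is also the entry at every \<open>(t, s)\<close>
      with \<open>t - s = x\<close>.\<close>
    have ent: "entry (T (left_regular (t - s))) t s = \<phi> (t - s)" for t s
    proof -
      have "T (left_regular (t - s)) \<in> group_vN" using T(2) V(1) by blast
      then show ?thesis unfolding \<phi>(2) by (rule group_vN_entry_0)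
    qed
    have inner: "cinner (blinfun_apply (T (A k l)) (\<xi> x l)) (\<xi> y k)
      = \<phi> (snd (e k) - snd (e l)) * entry (a (fst (e k)) (fst (e l))) (snd (e k)) (snd (e l))
         * x (fst (e l)) (snd (e l)) * cnj (y (fst (e k)) (snd (e k)))" for k l
    proof -
      have "T (left_regular (snd (e k) - snd (e l))) \<in> bounded_ops"
        using T(2) V(1) group_vN_bounded_ops by blast
      then show ?thesis
        using ent[of "snd (e k)" "snd (e l)"]
        by (simp add: TA_in \<xi>_def op_scale_apply bounded_opsD entry_def)
    qed
    have "matrix_form n (\<lambda>i j. entry (schur \<phi> (a i j))) F x y
        = (\<Sum>i<n. \<Sum>j<n. \<Sum>t\<in>F. \<Sum>s\<in>F. \<phi> (t - s) * entry (a i j) t s * x j s * cnj (y i t))"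
      unfolding matrix_form_def using ab by (intro sum.cong refl) (simp add: \<phi>(1))
    also have "\<dots> = (\<Sum>i<n. \<Sum>t\<in>F. \<Sum>j<n. \<Sum>s\<in>F. \<phi> (t - s) * entry (a i j) t s * x j s * cnj (y i t))"
      by (intro sum.cong refl sum.swap)
    also have "\<dots> = (\<Sum>k<N. \<Sum>j<n. \<Sum>s\<in>F. \<phi> (snd (e k) - s) * entry (a (fst (e k)) j) (snd (e k)) s
        * x j s * cnj (y (fst (e k)) (snd (e k))))"
      by (rule re[symmetric])
    also have "\<dots> = (\<Sum>k<N. \<Sum>l<N. cinner (blinfun_apply (T (A k l)) (\<xi> x l)) (\<xi> y k))"
      unfolding inner by (rule sum.cong[OF refl], rule re[symmetric])
    also have "cmod \<dots> \<le> matrix_norm N (\<lambda>k l. T (A k l)) * fin_norm n F x * fin_norm n F y"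
      unfolding N\<xi>[symmetric] by (rule matrix_norm_cinner)
    also have "\<dots> \<le> k * fin_norm n F x * fin_norm n F y"
      by (intro mult_right_mono TA) auto
    finally show "cmod (matrix_form n (\<lambda>i j. entry (schur \<phi> (a i j))) F x y) \<le> k * fin_norm n F x * fin_norm n F y" .
  qed
qed

text \<open>The difference of the two coefficients splits into \<open>coefficient (f - f') g\<close>
  and \<open>coefficient f' (g - g')\<close>, and \<open>schur_form_bound\<close> bounds each by the
  product of the norms of its two vectors.\<close>

lemma cb_norm_schur_perturb:
  assumes cb: "cb_norm group_vN (schur (coefficient f g)) \<le> ennreal k" and k: "0 \<le> k"
  shows "cb_norm group_vN (schur (coefficient f' g'))
    \<le> ennreal (k + norm (f - f') * norm g + norm f' * norm (g - g'))"
proof -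
  define d where "d = norm (f - f') * norm g + norm f' * norm (g - g')"
  have d: "0 \<le> d" by (simp add: d_def)
  have "matrix_norm n (\<lambda>i j. schur (coefficient f' g') (a i j)) \<le> k + d"
    if a: "\<forall>i<n. \<forall>j<n. a i j \<in> group_vN" "matrix_norm n a \<le> 1" for n a
  proof (rule matrix_norm_le_form)
    have ab: "a i j \<in> bounded_ops" if "i < n" "j < n" for i j using a that group_vN_bounded_ops by blast
    then show "schur (coefficient f' g') (a i j) \<in> bounded_ops" if "i < n" "j < n" for i j
      using that by (simp add: coefficient_in_fourier_algebra)
    show "0 \<le> k + d" using k d by simp
    fix F :: "'a set" and x y assume F: "finite F"
    let ?m = "\<lambda>f g. matrix_form n (\<lambda>i j t s. coefficient f g (t - s) * entry (a i j) t s) F x y"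
    have sm: "matrix_form n (\<lambda>i j. entry (schur (coefficient f g) (a i j))) F x y = ?m f g" for f g
      unfolding matrix_form_def using ab by (intro sum.cong refl) (simp add: coefficient_in_fourier_algebra)
    have bd: "cmod (?m f g) \<le> norm f * norm g * (fin_norm n F x * fin_norm n F y)" for f g
    proof -
      have "norm f * norm g * matrix_norm n a * (fin_norm n F x * fin_norm n F y)
          \<le> norm f * norm g * (fin_norm n F x * fin_norm n F y)"
        using a(2) by (intro mult_right_mono mult_left_le) auto
      then show ?thesis using schur_form_bound[OF F, where n = n and a = a and f = f and g = g and x = x and y = y, OF ab]
          by (simp add: mult.assoc)
    qed
    have coe: "coefficient f' g' u = coefficient f g u - coefficient (f - f') g u - coefficient f' (g - g') u" for u
      using coefficient_diff[of f g u f' g'] by (simp add: algebra_simps)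
    have "?m f' g' = ?m f g - ?m (f - f') g - ?m f' (g - g')"
      unfolding matrix_form_def coe by (simp add: left_diff_distrib sum_subtractf)
    moreover have "cmod (?m f g) \<le> k * (fin_norm n F x * fin_norm n F y)"
    proof -
      have "matrix_norm n (\<lambda>i j. schur (coefficient f g) (a i j)) \<le> k"
        using a by (intro cb_norm_leD[OF cb k]) auto
      moreover have "cmod (?m f g) \<le> matrix_norm n (\<lambda>i j. schur (coefficient f g) (a i j)) * fin_norm n F x * fin_norm n F y"
        unfolding sm[symmetric] using ab by (intro matrix_form_bound F) (simp add: coefficient_in_fourier_algebra)
      ultimately show ?thesis
        by (smt (verit) mult.assoc mult_right_mono fin_norm_nonneg mult_nonneg_nonneg)
    qed
    ultimately have "cmod (?m f' g') \<le> k * (fin_norm n F x * fin_norm n F y)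
        + norm (f - f') * norm g * (fin_norm n F x * fin_norm n F y)
        + norm f' * norm (g - g') * (fin_norm n F x * fin_norm n F y)"
      using bd[of "f - f'" g] bd[of f' "g - g'"] norm_triangle_ineq4[of "?m f g - ?m (f - f') g" "?m f' (g - g')"]
        norm_triangle_ineq4[of "?m f g" "?m (f - f') g"] by (smt (verit))
    then show "cmod (matrix_form n (\<lambda>i j. entry (schur (coefficient f' g') (a i j))) F x y)
        \<le> (k + d) * fin_norm n F x * fin_norm n F y"
      unfolding sm by (simp add: d_def algebra_simps)
  qed
  then show ?thesis
    unfolding d_def[symmetric] add.assoc using k d by (subst cb_norm_le_iff) auto
qed

section \<open>Normal functionals\<close>

abbreviation square_summable :: "(nat \<Rightarrow> 'a ell2) \<Rightarrow> bool" where
  "square_summable \<xi> \<equiv> summable (\<lambda>n. (norm (\<xi> n))\<^sup>2)"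

definition normal_functionals :: "('a op \<Rightarrow> complex) set" where
  "normal_functionals = {normal_functional \<xi> \<eta> | \<xi> \<eta>. square_summable \<xi> \<and> square_summable \<eta>}"

lemma norm_product_summable:
  assumes "square_summable \<xi>" "square_summable \<eta>"
  shows "summable (\<lambda>n. norm (\<xi> n) * norm (\<eta> n))"
proof (rule summable_comparison_test')
  show "summable (\<lambda>n. (norm (\<xi> n))\<^sup>2 + (norm (\<eta> n))\<^sup>2)" using assms by (rule summable_add)
  fix n show "norm (norm (\<xi> n) * norm (\<eta> n)) \<le> (norm (\<xi> n))\<^sup>2 + (norm (\<eta> n))\<^sup>2"
  proof -
    have "0 \<le> norm (\<xi> n) * norm (\<eta> n)" by simp
    then show ?thesis
      using sum_squares_bound[of "norm (\<xi> n)" "norm (\<eta> n)"]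
      unfolding real_norm_def mult.assoc by linarith
  qed
qed

lemma square_summable_op:
  assumes "square_summable \<xi>"
  shows "square_summable (\<lambda>n. blinfun_apply a (\<xi> n))"
proof (rule summable_comparison_test'[OF summable_mult[OF assms, of "(norm a)\<^sup>2"]])
  fix n show "norm ((norm (blinfun_apply a (\<xi> n)))\<^sup>2) \<le> (norm a)\<^sup>2 * (norm (\<xi> n))\<^sup>2"
    using power_mono[OF norm_blinfun[of a "\<xi> n"], of 2] by (simp add: power_mult_distrib)
qed

lemma cmod_cinner_op_le: "cmod (cinner (blinfun_apply x f) g) \<le> norm x * (norm f * norm g)"
  using cmod_cinner_le[of "blinfun_apply x f" g] mult_right_mono[OF norm_blinfun[of x f], of "norm g"]
  by (simp add: mult.assoc)

lemma normal_functional_has_sum: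
  assumes "square_summable \<xi>" "square_summable \<eta>"
  shows "((\<lambda>n. cinner (blinfun_apply x (\<xi> n)) (\<eta> n)) has_sum normal_functional \<xi> \<eta> x) UNIV"
proof (rule norm_summable_imp_has_sum)
  show s: "summable (\<lambda>n. norm (cinner (blinfun_apply x (\<xi> n)) (\<eta> n)))"
    by (rule summable_comparison_test'[OF summable_mult[OF norm_product_summable[OF assms], of "norm x"]])
      (simp add: cmod_cinner_op_le)
  show "(\<lambda>n. cinner (blinfun_apply x (\<xi> n)) (\<eta> n)) sums normal_functional \<xi> \<eta> x"
    unfolding normal_functional_def using summable_norm_cancel[OF s] by (rule summable_sums)
qed

text \<open>Zero padding along an injection, to reindex a countably supported family by the natural
  numbers.\<close>

lemma has_sum_transport:
  assumes "inj_on f Z"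
  shows "((\<lambda>n. if n \<in> f ` Z then h (inv_into Z f n) else 0) has_sum S) UNIV \<longleftrightarrow> (h has_sum S) Z"
proof -
  have "((\<lambda>n. if n \<in> f ` Z then h (inv_into Z f n) else 0) has_sum S) UNIV
      \<longleftrightarrow> ((\<lambda>n. if n \<in> f ` Z then h (inv_into Z f n) else 0) has_sum S) (f ` Z)"
    by (rule has_sum_cong_neutral) auto
  also have "\<dots> \<longleftrightarrow> (h has_sum S) Z"
    unfolding has_sum_reindex[OF assms] by (rule has_sum_cong) (simp add: assms)
  finally show ?thesis .
qed

lemma has_sum_sum_type:
  fixes h :: "'i + 'j \<Rightarrow> 'z::{topological_comm_monoid_add, t2_space}"
  assumes "((\<lambda>n. h (Inl n)) has_sum A) UNIV" "((\<lambda>n. h (Inr n)) has_sum B) UNIV"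
  shows "(h has_sum A + B) UNIV"
proof -
  have "(h has_sum A) (range Inl)" "(h has_sum B) (range Inr)"
    using assms by (auto simp: has_sum_reindex o_def)
  then have "(h has_sum A + B) (range Inl \<union> range Inr)" by (rule has_sum_Un_disjoint) auto
  then show ?thesis by (simp add: UNIV_sum)
qed

text \<open>Only countably many members of a square summable family are nonzero, so arbitrary index sets
  give no further functionals.\<close>

lemma normal_functionals_family:
  fixes \<xi> \<eta> :: "'i \<Rightarrow> 'a ell2" and \<omega> :: "'a op \<Rightarrow> complex"
  assumes "(\<lambda>i. (norm (\<xi> i))\<^sup>2) summable_on UNIV" "(\<lambda>i. (norm (\<eta> i))\<^sup>2) summable_on UNIV"
    and \<omega>: "\<And>x. ((\<lambda>i. cinner (blinfun_apply x (\<xi> i)) (\<eta> i)) has_sum \<omega> x) UNIV"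
  shows "\<omega> \<in> normal_functionals"
proof -
  \<comment> \<open>Where \<xi> vanishes the term is 0 whatever \<eta> is, so the support of \<xi>
    alone is enumerated.\<close>
  define Z where "Z = {i. \<xi> i \<noteq> 0}"
  have "countable {i \<in> UNIV. (norm (\<xi> i))\<^sup>2 \<noteq> 0}"
    using assms(1) by (intro abs_summable_countable) simp
  then have "countable Z" by (simp add: Z_def)
  then obtain f :: "'i \<Rightarrow> nat" where f: "inj_on f Z" by (rule countableE)
  define ext where "ext h n = (if n \<in> f ` Z then h (inv_into Z f n) else 0)"
    for h :: "'i \<Rightarrow> 'a ell2" and n
  have sq: "square_summable (ext h)" if "(\<lambda>i. (norm (h i))\<^sup>2) summable_on UNIV" for h
  proof -
    have "(\<lambda>i. (norm (h i))\<^sup>2) summable_on Z" using that by (rule summable_on_subset) simp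
    then have "(\<lambda>n. (norm (ext h n))\<^sup>2) summable_on UNIV"
      unfolding summable_on_def has_sum_transport[OF f, of "\<lambda>i. (norm (h i))\<^sup>2", symmetric]
      by (simp add: ext_def if_distrib[of "\<lambda>u. (norm u)\<^sup>2"] cong: if_cong)
    then show ?thesis by (rule summable_on_imp_summable)
  qed
  have "\<omega> = normal_functional (ext \<xi>) (ext \<eta>)"
  proof
    fix x
    have "((\<lambda>i. cinner (blinfun_apply x (\<xi> i)) (\<eta> i)) has_sum \<omega> x) Z"
      using \<omega>[of x] by (rule has_sum_cong_neutral[THEN iffD1, rotated -1]) (auto simp: Z_def)
    then have "((\<lambda>n. cinner (blinfun_apply x (ext \<xi> n)) (ext \<eta> n)) has_sum \<omega> x) UNIV"
      unfolding has_sum_transport[OF f, symmetric]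
      by (rule has_sum_cong[THEN iffD1, rotated]) (simp add: ext_def)
    then show "\<omega> x = normal_functional (ext \<xi>) (ext \<eta>) x"
      using normal_functional_has_sum[OF sq[OF assms(1)] sq[OF assms(2)]] has_sum_unique by blast
  qed
  then show ?thesis using sq assms unfolding normal_functionals_def by blast
qed

lemma square_summable_imp_summable_on: "square_summable \<xi> \<Longrightarrow> (\<lambda>n. (norm (\<xi> n))\<^sup>2) summable_on UNIV"
  by (simp add: summable_on_UNIV_nonneg_real_iff)

lemma normal_functionals_cinner: "(\<lambda>x. cinner (blinfun_apply x f) g) \<in> normal_functionals"
proof (rule normal_functionals_family)
  show "((\<lambda>i::unit. cinner (blinfun_apply x f) g) has_sum cinner (blinfun_apply x f) g) UNIV" for x
    by (rule has_sum_finiteI) auto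
qed auto

text \<open>The two pairs of sequences are placed side by side over a sum type, and
  \<open>normal_functionals_family\<close> returns to a sequence.\<close>

lemma normal_functionals_add:
  assumes "\<omega>1 \<in> normal_functionals" "\<omega>2 \<in> normal_functionals"
  shows "(\<lambda>x. \<omega>1 x + \<omega>2 x) \<in> normal_functionals"
proof -
  obtain \<xi>1 \<eta>1 \<xi>2 \<eta>2 where
    1: "\<omega>1 = normal_functional \<xi>1 \<eta>1" "square_summable \<xi>1" "square_summable \<eta>1" and
    2: "\<omega>2 = normal_functional \<xi>2 \<eta>2" "square_summable \<xi>2" "square_summable \<eta>2"
    using assms by (auto simp: normal_functionals_def)
  show ?thesis
  proof (rule normal_functionals_family[where \<xi> = "case_sum \<xi>1 \<xi>2" and \<eta> = "case_sum \<eta>1 \<eta>2"])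
    show "(\<lambda>i. (norm (case_sum \<xi>1 \<xi>2 i))\<^sup>2) summable_on UNIV"
      using 1(2)[THEN square_summable_imp_summable_on] 2(2)[THEN square_summable_imp_summable_on]
        has_sum_sum_type[of "\<lambda>i. (norm (case_sum \<xi>1 \<xi>2 i))\<^sup>2"] unfolding summable_on_def by auto
    show "(\<lambda>i. (norm (case_sum \<eta>1 \<eta>2 i))\<^sup>2) summable_on UNIV"
      using 1(3)[THEN square_summable_imp_summable_on] 2(3)[THEN square_summable_imp_summable_on]
        has_sum_sum_type[of "\<lambda>i. (norm (case_sum \<eta>1 \<eta>2 i))\<^sup>2"] unfolding summable_on_def by auto
    show "((\<lambda>i. cinner (blinfun_apply x (case_sum \<xi>1 \<xi>2 i)) (case_sum \<eta>1 \<eta>2 i)) has_sum \<omega>1 x + \<omega>2 x) UNIV" for x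
      using normal_functional_has_sum[OF 1(2,3)] normal_functional_has_sum[OF 2(2,3)]
      by (intro has_sum_sum_type) (simp_all add: 1(1) 2(1))
  qed
qed

lemma normal_functionals_scale:
  assumes "\<omega> \<in> normal_functionals"
  shows "(\<lambda>x. c * \<omega> x) \<in> normal_functionals"
proof -
  obtain \<xi> \<eta> where \<omega>: "\<omega> = normal_functional \<xi> \<eta>" "square_summable \<xi>" "square_summable \<eta>"
    using assms by (auto simp: normal_functionals_def)
  show ?thesis
  proof (rule normal_functionals_family[where \<xi> = \<xi> and \<eta> = "\<lambda>n. ell2_scale (cnj c) (\<eta> n)"])
    show "(\<lambda>n. (norm (ell2_scale (cnj c) (\<eta> n)))\<^sup>2) summable_on UNIV"
      using square_summable_imp_summable_on[OF \<omega>(3)]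
      by (simp add: norm_ell2_scale power_mult_distrib summable_on_cmult_right)
    show "((\<lambda>n. cinner (blinfun_apply x (\<xi> n)) (ell2_scale (cnj c) (\<eta> n))) has_sum c * \<omega> x) UNIV" for x
      using has_sum_cmult_right[OF normal_functional_has_sum[OF \<omega>(2,3), of x], of c] by (simp add: \<omega>(1))
  qed (rule square_summable_imp_summable_on[OF \<omega>(2)])
qed

lemma normal_functionals_diff:
  "\<omega>1 \<in> normal_functionals \<Longrightarrow> \<omega>2 \<in> normal_functionals \<Longrightarrow> (\<lambda>x. \<omega>1 x - \<omega>2 x) \<in> normal_functionals"
  using normal_functionals_add[OF _ normal_functionals_scale[of \<omega>2 "- 1"]] by simp

lemma normal_functionals_sum:
  "finite I \<Longrightarrow> (\<And>i. i \<in> I \<Longrightarrow> \<omega> i \<in> normal_functionals) \<Longrightarrow> (\<lambda>x. \<Sum>i\<in>I. \<omega> i x) \<in> normal_functionals"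
proof (induction I rule: finite_induct)
  case empty
  then show ?case using normal_functionals_cinner[of 0 0] by simp
qed (simp add: normal_functionals_add)

lemma normal_functional_additive:
  assumes "\<omega> \<in> normal_functionals"
  shows "\<omega> (x + y) = \<omega> x + \<omega> y" "\<omega> (op_scale c x) = c * \<omega> x"
proof -
  obtain \<xi> \<eta> where \<omega>: "\<omega> = normal_functional \<xi> \<eta>" "square_summable \<xi>" "square_summable \<eta>"
    using assms by (auto simp: normal_functionals_def)
  note hs = normal_functional_has_sum[OF \<omega>(2,3), folded \<omega>(1)]
  show "\<omega> (x + y) = \<omega> x + \<omega> y"
    using has_sum_unique[OF hs[of "x + y"]] has_sum_add[OF hs[of x] hs[of y]]
    by (simp add: blinfun.add_left cinner_add_left)
  show "\<omega> (op_scale c x) = c * \<omega> x"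
    using has_sum_unique[OF hs[of "op_scale c x"]] has_sum_cmult_right[OF hs[of x], of c]
    by (simp add: op_scale_apply)
qed

lemma clinear_on_normal_functional:
  "\<omega> \<in> normal_functionals \<Longrightarrow> clinear_on group_vN (*) \<omega>"
  using normal_functional_additive unfolding clinear_on_def by blast

section \<open>The predual\<close>

lemma topspace_sigma_weak: "topspace sigma_weak_topology = (UNIV :: 'a op set)"
proof -
  have "(UNIV :: 'a op set) \<in> {normal_functional \<xi> \<eta> -` U | \<xi> \<eta> U.
        summable (\<lambda>n. (norm (\<xi> n))\<^sup>2) \<and> summable (\<lambda>n. (norm (\<eta> n))\<^sup>2) \<and> open U}"
    by (auto intro!: exI[of _ "\<lambda>_. 0"] exI[of _ UNIV])
  then show ?thesis unfolding sigma_weak_topology_def topology_generated_by_topspace by blast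
qed

lemma topspace_sigma_weak_vN [simp]: "topspace sigma_weak_vN = group_vN"
  by (simp add: sigma_weak_vN_def topspace_sigma_weak)

lemma openin_normal_functional_vimage:
  assumes "\<omega> \<in> normal_functionals" "open U"
  shows "openin sigma_weak_topology (\<omega> -` U)"
  unfolding sigma_weak_topology_def
  by (rule topology_generated_by_Basis) (use assms in \<open>auto simp: normal_functionals_def\<close>)

lemma continuous_map_normal_functional:
  assumes "\<omega> \<in> normal_functionals"
  shows "continuous_map sigma_weak_vN euclidean \<omega>"
  unfolding sigma_weak_vN_def
proof (rule continuous_map_from_subtopology)
  show "continuous_map sigma_weak_topology euclidean \<omega>"
    using openin_normal_functional_vimage[OF assms]
    by (auto simp: continuous_map_def topspace_sigma_weak vimage_def)
qed

lemma restrict_normal_functional_in_predual: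
  assumes "\<omega> \<in> normal_functionals"
  shows "restrict \<omega> group_vN \<in> vN_predual"
proof -
  have "clinear_on group_vN (*) (restrict \<omega> group_vN)"
    using clinear_on_normal_functional[OF assms] by (simp add: clinear_on_def)
  moreover have "continuous_map sigma_weak_vN euclidean (restrict \<omega> group_vN)"
    by (rule continuous_map_eq[OF continuous_map_normal_functional[OF assms]]) simp
  ultimately show ?thesis by (simp add: vN_predual_def)
qed

text \<open>Normal functionals vanish at 0, so a ball around 0 can replace each open set
  \<open>U\<close>; for an intersection the sets of functionals are united and the smaller radius is
  kept.\<close>

lemma sigma_weak_neighbourhood:
  assumes "generate_topology_on {normal_functional \<xi> \<eta> -` U | \<xi> \<eta> U.
        summable (\<lambda>n. (norm (\<xi> n))\<^sup>2) \<and> summable (\<lambda>n. (norm (\<eta> n))\<^sup>2) \<and> open U} W"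
    and "(0 :: 'a op) \<in> W"
  shows "\<exists>\<F> e. finite \<F> \<and> \<F> \<subseteq> normal_functionals \<and> 0 < e \<and> {x. \<forall>\<omega>\<in>\<F>. cmod (\<omega> x) < e} \<subseteq> W"
  using assms
proof (induction rule: generate_topology_on.induct)
  case (Int a b)
  have "0 \<in> a" "0 \<in> b" using Int.prems by auto
  from Int.IH(1)[OF this(1)] obtain \<F> e where 1: "finite \<F>" "\<F> \<subseteq> normal_functionals" "0 < e"
    "{x. \<forall>\<omega>\<in>\<F>. cmod (\<omega> x) < e} \<subseteq> a" by blast
  from Int.IH(2)[OF \<open>0 \<in> b\<close>] obtain \<G> d where 2: "finite \<G>" "\<G> \<subseteq> normal_functionals" "0 < d"
    "{x. \<forall>\<omega>\<in>\<G>. cmod (\<omega> x) < d} \<subseteq> b" by blast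
  show ?case using 1 2 by (intro exI[of _ "\<F> \<union> \<G>"] exI[of _ "min e d"]) auto
next
  case (UN K)
  then obtain k where k: "k \<in> K" "0 \<in> k" by blast
  from UN.IH[OF k] obtain \<F> e where \<F>: "finite \<F>" "\<F> \<subseteq> normal_functionals" "0 < e"
    "{x. \<forall>\<omega>\<in>\<F>. cmod (\<omega> x) < e} \<subseteq> k" by blast
  have "k \<subseteq> \<Union>K" using k by blast
  then show ?case using \<F> by (meson order_trans)
next
  case (Basis s)
  then obtain \<xi> \<eta> U where s: "s = normal_functional \<xi> \<eta> -` U" "square_summable \<xi>" "square_summable \<eta>" "open U"
    by blast
  have "normal_functional \<xi> \<eta> (0 :: 'a op) = 0" by (simp add: normal_functional_def)
  then have "0 \<in> U" using Basis s by auto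
  then obtain e where "0 < e" "ball 0 e \<subseteq> U" using s(4) by (meson open_contains_ball)
  then show ?case
    using s by (intro exI[of _ "{normal_functional \<xi> \<eta>}"] exI[of _ e]) (auto simp: normal_functionals_def)
qed simp

text \<open>Induction on the number of functionals: on the kernel of \<mu> the others suffice, and a
  vector with \<open>\<mu> u = 1\<close> fixes the coefficient of \<mu>.\<close>

lemma functional_combination:
  fixes \<F> :: "('a op \<Rightarrow> complex) set"
  assumes "finite \<F>" "\<And>\<nu>. \<nu> \<in> \<F> \<Longrightarrow> clinear_on V (*) \<nu>" "clinear_on V (*) \<omega>"
    and "\<And>x y. x \<in> V \<Longrightarrow> y \<in> V \<Longrightarrow> x + y \<in> V" "\<And>c x. x \<in> V \<Longrightarrow> op_scale c x \<in> V"
    and "\<And>x. x \<in> V \<Longrightarrow> (\<And>\<nu>. \<nu> \<in> \<F> \<Longrightarrow> \<nu> x = 0) \<Longrightarrow> \<omega> x = 0"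
  shows "\<exists>c. \<forall>x\<in>V. \<omega> x = (\<Sum>\<nu>\<in>\<F>. c \<nu> * \<nu> x)"
  using assms
proof (induction \<F> arbitrary: V rule: finite_induct)
  case empty
  then show ?case by simp
next
  case (insert \<mu> \<F>)
  define V' where "V' = {x \<in> V. \<mu> x = 0}"
  have sub: "clinear_on V' (*) \<nu>" if "clinear_on V (*) \<nu>" for \<nu>
    using that by (auto simp: clinear_on_def V'_def)
  have \<mu>: "clinear_on V (*) \<mu>" using insert.prems by simp
  have "\<exists>c. \<forall>x\<in>V'. \<omega> x = (\<Sum>\<nu>\<in>\<F>. c \<nu> * \<nu> x)"
  proof (rule insert.IH)
    show "clinear_on V' (*) \<omega>" "\<And>\<nu>. \<nu> \<in> \<F> \<Longrightarrow> clinear_on V' (*) \<nu>" using insert.prems sub by auto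
    show "x + y \<in> V'" if "x \<in> V'" "y \<in> V'" for x y
      using that insert.prems(3) \<mu> by (auto simp: V'_def clinear_on_def)
    show "op_scale c x \<in> V'" if "x \<in> V'" for c x
      using that insert.prems(4) \<mu> by (auto simp: V'_def clinear_on_def)
    show "\<omega> x = 0" if "x \<in> V'" "\<And>\<nu>. \<nu> \<in> \<F> \<Longrightarrow> \<nu> x = 0" for x
      using that insert.prems(5)[of x] by (auto simp: V'_def)
  qed
  then obtain c where c: "\<And>x. x \<in> V' \<Longrightarrow> \<omega> x = (\<Sum>\<nu>\<in>\<F>. c \<nu> * \<nu> x)" by blast
  show ?case
  proof (cases "\<forall>x\<in>V. \<mu> x = 0")
    case True
    then have "\<omega> x = (\<Sum>\<nu>\<in>insert \<mu> \<F>. c \<nu> * \<nu> x)" if "x \<in> V" for x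
      using that c[of x] insert.hyps by (simp add: V'_def)
    then show ?thesis by blast
  next
    case False
    then obtain z where z: "z \<in> V" "\<mu> z \<noteq> 0" by blast
    define u where "u = op_scale (inverse (\<mu> z)) z"
    have u: "u \<in> V" "\<mu> u = 1" using z insert.prems(4) \<mu> by (auto simp: u_def clinear_on_def)
    \<comment> \<open>Chosen to make both sides agree at \<open>u\<close>; every \<open>x\<close> is
      a multiple of \<open>u\<close> plus an element of the kernel \<open>V'\<close>.\<close>
    define c' where "c' = c(\<mu> := \<omega> u - (\<Sum>\<nu>\<in>\<F>. c \<nu> * \<nu> u))"
    have "\<omega> x = (\<Sum>\<nu>\<in>insert \<mu> \<F>. c' \<nu> * \<nu> x)" if x: "x \<in> V" for x
    proof -
      define d where "d = - \<mu> x"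
      define y where "y = x + op_scale d u"
      have lin: "\<nu> y = \<nu> x - \<mu> x * \<nu> u" if "clinear_on V (*) \<nu>" for \<nu>
      proof -
        have "\<nu> y = \<nu> x + d * \<nu> u"
          using that x u insert.prems(4)[OF u(1)] by (simp add: y_def clinear_on_def)
        then show ?thesis by (simp add: d_def)
      qed
      have "y \<in> V" using x u insert.prems(3,4) by (simp add: y_def)
      then have "y \<in> V'" using lin[OF \<mu>] u by (simp add: V'_def)
      then have "\<omega> x - \<mu> x * \<omega> u = (\<Sum>\<nu>\<in>\<F>. c \<nu> * (\<nu> x - \<mu> x * \<nu> u))"
        using c[of y] lin insert.prems(1,2) by simp
      then have "\<omega> x = \<mu> x * (\<omega> u - (\<Sum>\<nu>\<in>\<F>. c \<nu> * \<nu> u)) + (\<Sum>\<nu>\<in>\<F>. c \<nu> * \<nu> x)"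
        by (simp add: algebra_simps sum_subtractf sum_distrib_left)
      moreover have "(\<Sum>\<nu>\<in>\<F>. c' \<nu> * \<nu> x) = (\<Sum>\<nu>\<in>\<F>. c \<nu> * \<nu> x)"
        using insert.hyps by (intro sum.cong) (auto simp: c'_def)
      ultimately show ?thesis using insert.hyps by (simp add: c'_def)
    qed
    then show ?thesis by blast
  qed
qed

text \<open>Continuity at 0 keeps \<omega> below 1 in modulus wherever finitely many normal
  functionals are small. Scaling then forces \<omega> to vanish on their common kernel, so it is a
  linear combination of them.\<close>

lemma predual_normal:
  assumes "\<omega> \<in> vN_predual"
  obtains \<nu> where "\<nu> \<in> normal_functionals" "\<And>x. x \<in> group_vN \<Longrightarrow> \<omega> x = \<nu> x"
proof -
  have lin: "clinear_on group_vN (*) \<omega>" and cont: "continuous_map sigma_weak_vN euclidean \<omega>"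
    using assms by (auto simp: vN_predual_def)
  have \<omega>0: "\<omega> 0 = 0"
    using lin unfolding clinear_on_def by (metis group_vN_intros(1) mult_zero_left op_complex.scale_zero_right)
  have "openin sigma_weak_vN {x \<in> group_vN. \<omega> x \<in> ball 0 1}"
    using openin_continuous_map_preimage[OF cont, of "ball 0 1"] by simp
  then obtain W where W: "openin sigma_weak_topology W" "{x \<in> group_vN. \<omega> x \<in> ball 0 1} = W \<inter> group_vN"
    by (auto simp: sigma_weak_vN_def openin_subtopology)
  have "0 \<in> {x \<in> group_vN. \<omega> x \<in> ball 0 1}" using \<omega>0 by simp
  then have "0 \<in> W" unfolding W(2) by (rule IntD1)
  from sigma_weak_neighbourhood[OF openin_topology_generated_by[OF W(1)[unfolded sigma_weak_topology_def]] this]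
  obtain \<F> e where \<F>: "finite \<F>" "\<F> \<subseteq> normal_functionals" "0 < e" "{x. \<forall>\<omega>\<in>\<F>. cmod (\<omega> x) < e} \<subseteq> W"
    by blast
  have "\<exists>c. \<forall>x\<in>group_vN. \<omega> x = (\<Sum>\<nu>\<in>\<F>. c \<nu> * \<nu> x)"
  proof (rule functional_combination[OF \<F>(1) _ lin])
    fix x :: "'a op" assume x: "x \<in> group_vN" and 0: "\<And>\<nu>. \<nu> \<in> \<F> \<Longrightarrow> \<nu> x = 0"
    show "\<omega> x = 0"
    proof (rule ccontr)
      assume nz: "\<omega> x \<noteq> 0"
      define y where "y = op_scale (inverse (\<omega> x)) x"
      have "\<nu> y = 0" if "\<nu> \<in> \<F>" for \<nu>
        using that 0[OF that] \<F>(2) by (auto simp: y_def normal_functional_additive(2))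
      then have "y \<in> W" using \<F>(3) by (intro subsetD[OF \<F>(4)] CollectI ballI) (metis norm_zero \<open>\<And>\<nu>. \<nu> \<in> \<F> \<Longrightarrow> \<nu> y = 0\<close>)
      moreover have "y \<in> group_vN" using x by (simp add: y_def)
      ultimately have "y \<in> {x \<in> group_vN. \<omega> x \<in> ball 0 1}" unfolding W(2) by simp
      then have "\<omega> y \<in> ball 0 1" by simp
      moreover have "\<omega> y = 1" using lin x nz unfolding y_def clinear_on_def by simp
      ultimately show False by simp
    qed
  qed (use \<F>(2) clinear_on_normal_functional in auto)
  then obtain c where c: "\<forall>x\<in>group_vN. \<omega> x = (\<Sum>\<nu>\<in>\<F>. c \<nu> * \<nu> x)" by blast
  have "(\<lambda>x. \<Sum>\<nu>\<in>\<F>. c \<nu> * \<nu> x) \<in> normal_functionals"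
    using \<F>(1,2) by (intro normal_functionals_sum normal_functionals_scale) auto
  then show ?thesis using that c by blast
qed

section \<open>Amplification and the density theorem\<close>

text \<open>The Hilbert sum of countably many copies of the space, indexed by pairs so that it is an
  \<open>ell2\<close> space again and inherits its projections. Meant for square summable
  sequences.\<close>

definition stack :: "(nat \<Rightarrow> 'a ell2) \<Rightarrow> (nat \<times> 'a) ell2" where
  "stack \<xi> = Abs_ell2 (\<lambda>(n, t). ell2_apply (\<xi> n) t)"

lemma
  assumes "square_summable \<xi>"
  shows ell2_apply_stack: "ell2_apply (stack \<xi>) (n, t) = ell2_apply (\<xi> n) t"
    and norm_stack_le: "(norm (stack \<xi>))\<^sup>2 \<le> (\<Sum>n. (norm (\<xi> n))\<^sup>2)"
proof -
  define C where "C = sqrt (\<Sum>n. (norm (\<xi> n))\<^sup>2)"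
  have C2: "C\<^sup>2 = (\<Sum>n. (norm (\<xi> n))\<^sup>2)" using assms by (simp add: C_def suminf_nonneg)
  have "(\<Sum>p\<in>F. (cmod (case p of (n, t) \<Rightarrow> ell2_apply (\<xi> n) t))\<^sup>2) \<le> C\<^sup>2" if F: "finite F" for F
  proof -
    have "(\<Sum>p\<in>F. (cmod (case p of (n, t) \<Rightarrow> ell2_apply (\<xi> n) t))\<^sup>2)
        \<le> (\<Sum>p\<in>fst ` F \<times> snd ` F. (cmod (case p of (n, t) \<Rightarrow> ell2_apply (\<xi> n) t))\<^sup>2)"
      using F by (intro sum_mono2 finite_cartesian_product finite_imageI subset_fst_snd) auto
    also have "\<dots> = (\<Sum>n\<in>fst ` F. \<Sum>t\<in>snd ` F. (cmod (ell2_apply (\<xi> n) t))\<^sup>2)"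
      by (simp add: sum.cartesian_product case_prod_unfold)
    also have "\<dots> \<le> (\<Sum>n\<in>fst ` F. (norm (\<xi> n))\<^sup>2)"
      using F by (intro sum_mono ell2_sum_le_norm) simp
    also have "\<dots> \<le> C\<^sup>2"
      unfolding C2 using F assms by (intro sum_le_suminf) auto
    finally show ?thesis .
  qed
  then obtain f where f: "ell2_apply f = (\<lambda>(n, t). ell2_apply (\<xi> n) t)" "norm f \<le> C"
    using ell2_exI[of "\<lambda>(n, t). ell2_apply (\<xi> n) t" C] assms by (auto simp: C_def suminf_nonneg)
  have "stack \<xi> = f" unfolding stack_def f(1)[symmetric] by (rule ell2_apply_inverse)
  then show "ell2_apply (stack \<xi>) (n, t) = ell2_apply (\<xi> n) t"
    "(norm (stack \<xi>))\<^sup>2 \<le> (\<Sum>n. (norm (\<xi> n))\<^sup>2)"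
    using f(2) by (auto simp: f(1) C2[symmetric] intro!: power_mono)
qed

lift_definition slice :: "nat \<Rightarrow> (nat \<times> 'a) ell2 \<Rightarrow> 'a ell2" is "\<lambda>n f t. f (n, t)"
proof -
  fix n :: nat and f :: "nat \<times> 'a \<Rightarrow> complex"
  assume "(\<lambda>x. (cmod (f x))\<^sup>2) summable_on UNIV"
  then have "(\<lambda>x. (cmod (f x))\<^sup>2) summable_on range (Pair n)"
    by (rule summable_on_subset) simp
  then show "(\<lambda>t. (cmod (f (n, t)))\<^sup>2) summable_on UNIV"
    by (simp add: summable_on_reindex o_def inj_on_def)
qed

lemmas ell2_apply_slice [simp] = slice.rep_eq

lemma sum_slice_le: "finite I \<Longrightarrow> (\<Sum>n\<in>I. (norm (slice n \<Phi>))\<^sup>2) \<le> (norm \<Phi>)\<^sup>2"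
proof (rule has_sum_le_finite_sums)
  assume I: "finite I"
  show "((\<lambda>t. \<Sum>n\<in>I. (cmod (ell2_apply \<Phi> (n, t)))\<^sup>2) has_sum (\<Sum>n\<in>I. (norm (slice n \<Phi>))\<^sup>2)) UNIV"
    using ell2_has_sum_norm[of "slice _ \<Phi>"] by (intro has_sum_sum) simp
  fix F :: "'a set" assume F: "finite F"
  have "(\<Sum>t\<in>F. \<Sum>n\<in>I. (cmod (ell2_apply \<Phi> (n, t)))\<^sup>2) = (\<Sum>p\<in>I \<times> F. (cmod (ell2_apply \<Phi> p))\<^sup>2)"
    by (subst sum.swap) (simp add: sum.cartesian_product case_prod_unfold)
  also have "\<dots> \<le> (norm \<Phi>)\<^sup>2" using I F by (intro ell2_sum_le_norm) simp
  finally show "(\<Sum>t\<in>F. \<Sum>n\<in>I. (cmod (ell2_apply \<Phi> (n, t)))\<^sup>2) \<le> (norm \<Phi>)\<^sup>2" .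
qed

lemma norm_slice_le: "norm (slice n \<Phi>) \<le> norm \<Phi>"
  using sum_slice_le[of "{n}" \<Phi>] by (simp add: power2_le_iff_abs_le)

lemma square_summable_slice: "square_summable (\<lambda>n. slice n \<Phi>)"
  by (rule bounded_imp_summable[where B = "(norm \<Phi>)\<^sup>2"]) (auto intro: sum_slice_le)

lemma bounded_linear_slice: "bounded_linear (slice n)"
  by (rule bounded_linear_intro[where K = 1]) (auto intro!: ell2_eqI simp: norm_slice_le)

lemma slice_stack: "square_summable \<xi> \<Longrightarrow> slice n (stack \<xi>) = \<xi> n"
  by (rule ell2_eqI) (simp add: ell2_apply_stack)

definition inject :: "nat \<Rightarrow> 'a ell2 \<Rightarrow> (nat \<times> 'a) ell2" where
  "inject m f = stack (\<lambda>n. if n = m then f else 0)"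

lemma inject_sums: "(\<lambda>n. (norm (if n = m then f else 0))\<^sup>2) sums (norm f)\<^sup>2"
  using sums_single[of m "\<lambda>_. (norm f)\<^sup>2"] by (rule sums_cong[THEN iffD1, rotated]) simp

lemma ell2_apply_inject [simp]: "ell2_apply (inject m f) (n, t) = (if n = m then ell2_apply f t else 0)"
  unfolding inject_def using inject_sums[THEN sums_summable] by (subst ell2_apply_stack) auto

lemma norm_inject_le: "norm (inject m f) \<le> norm f"
proof (rule power2_le_imp_le)
  show "(norm (inject m f))\<^sup>2 \<le> (norm f)\<^sup>2"
    using norm_stack_le[OF inject_sums[THEN sums_summable], of m f]
    unfolding inject_def sums_unique[OF inject_sums, symmetric] .
qed simp

lemma bounded_linear_inject: "bounded_linear (inject m)"
  by (rule bounded_linear_intro[where K = 1]) (auto intro!: ell2_eqI simp: norm_inject_le)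

text \<open>The remainder is the stack of the slices from \<open>M\<close> on, and its squared norm
  is at most a tail of a convergent series.\<close>

lemma inject_slice_tendsto: "(\<lambda>M. \<Sum>m<M. inject m (slice m \<Phi>)) \<longlonglongrightarrow> \<Phi>"
proof -
  define tail where "tail M = (\<lambda>n. if n < M then 0 else slice n \<Phi>)" for M
  have sq: "square_summable (tail M)" for M
    by (rule summable_comparison_test'[OF square_summable_slice[of \<Phi>]]) (simp add: tail_def)
  have diff: "\<Phi> - (\<Sum>m<M. inject m (slice m \<Phi>)) = stack (tail M)" for M
    by (rule ell2_eqI, rename_tac p, case_tac p)
      (simp add: ell2_apply_stack[OF sq], simp add: tail_def)
  have le: "(norm (\<Phi> - (\<Sum>m<M. inject m (slice m \<Phi>))))\<^sup>2
      \<le> (\<Sum>n. (norm (slice n \<Phi>))\<^sup>2) - (\<Sum>n<M. (norm (slice n \<Phi>))\<^sup>2)" for M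
  proof -
    have "(\<Sum>n. (norm (tail M n))\<^sup>2) = (\<Sum>n. (norm (tail M (n + M)))\<^sup>2) + (\<Sum>n<M. (norm (tail M n))\<^sup>2)"
      by (rule suminf_split_initial_segment[OF sq])
    also have "\<dots> = (\<Sum>n. (norm (slice (n + M) \<Phi>))\<^sup>2)" by (simp add: tail_def)
    also have "\<dots> = (\<Sum>n. (norm (slice n \<Phi>))\<^sup>2) - (\<Sum>n<M. (norm (slice n \<Phi>))\<^sup>2)"
      using suminf_split_initial_segment[OF square_summable_slice[of \<Phi>], of M] by simp
    finally show ?thesis unfolding diff using norm_stack_le[OF sq, of M] by linarith
  qed
  have "(\<lambda>M. (\<Sum>n. (norm (slice n \<Phi>))\<^sup>2) - (\<Sum>n<M. (norm (slice n \<Phi>))\<^sup>2)) \<longlonglongrightarrow> 0"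
    using tendsto_diff[OF tendsto_const summable_LIMSEQ[OF square_summable_slice[of \<Phi>]],
        of "\<Sum>n. (norm (slice n \<Phi>))\<^sup>2"] by simp
  then have "(\<lambda>M. (norm (\<Phi> - (\<Sum>m<M. inject m (slice m \<Phi>))))\<^sup>2) \<longlonglongrightarrow> 0"
    by (rule tendsto_sandwich[OF _ _ tendsto_const, rotated -1])
      (rule always_eventually, rule allI, rule zero_le_power2,
       rule always_eventually, rule allI, rule le)
  from tendsto_real_sqrt[OF this] have "(\<lambda>M. norm (\<Phi> - (\<Sum>m<M. inject m (slice m \<Phi>)))) \<longlonglongrightarrow> 0"
    by simp
  then have "(\<lambda>M. \<Phi> - (\<Sum>m<M. inject m (slice m \<Phi>))) \<longlonglongrightarrow> 0"
    by (rule tendsto_norm_zero_cancel)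
  from tendsto_diff[OF tendsto_const this, of \<Phi>] show ?thesis by simp
qed

text \<open>Summation row by row. It turns a normal functional into a single inner product in the
  amplified space.\<close>

lemma cinner_stack:
  assumes "square_summable \<xi>" "square_summable \<eta>"
  shows "cinner (stack \<xi>) (stack \<eta>) = (\<Sum>n. cinner (\<xi> n) (\<eta> n))"
proof -
  have "((\<lambda>n. cinner (\<xi> n) (\<eta> n)) has_sum cinner (stack \<xi>) (stack \<eta>)) UNIV"
    using cinner_has_sum[of "stack \<xi>" "stack \<eta>"] cinner_has_sum[of "\<xi> _" "\<eta> _"]
    by - (rule has_sum_SigmaD[where B = "\<lambda>_. UNIV"], auto simp: ell2_apply_stack assms)
  then show ?thesis using has_sum_imp_sums sums_unique by blast
qed

lift_definition translate_all :: "'g::group_add \<Rightarrow> (nat \<times> 'g) ell2 \<Rightarrow> (nat \<times> 'g) ell2"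
  is "\<lambda>q f (n, t). f (n, - q + t)"
proof -
  fix q :: 'g and f :: "nat \<times> 'g \<Rightarrow> complex"
  have bij: "bij (\<lambda>(n :: nat, t). (n, - q + t))"
    by (rule bij_betw_byWitness[where f' = "\<lambda>(n, t). (n, q + t)"]) (auto simp: add.assoc[symmetric])
  assume "(\<lambda>x. (cmod (f x))\<^sup>2) summable_on UNIV"
  then show "(\<lambda>x. (cmod (case x of (n, t) \<Rightarrow> f (n, - q + t)))\<^sup>2) summable_on UNIV"
    using summable_on_reindex_bij_betw[OF bij, of "\<lambda>x. (cmod (f x))\<^sup>2"] by (simp add: case_prod_unfold)
qed

lemma ell2_apply_translate_all [simp]:
  "ell2_apply (translate_all q f) (n, t) = ell2_apply f (n, - q + t)"
  by (simp add: translate_all.rep_eq)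

lemma translate_all_inverse: "translate_all q (translate_all (- q) f) = f"
  by (rule ell2_eqI, rename_tac p, case_tac p) (simp add: add.assoc[symmetric])

lemma inner_translate_all: "translate_all q f \<bullet> g = f \<bullet> translate_all (- q) g"
proof -
  have bij: "bij (\<lambda>(n :: nat, t). (n, - q + t))"
    by (rule bij_betw_byWitness[where f' = "\<lambda>(n, t). (n, q + t)"]) (auto simp: add.assoc[symmetric])
  have "(\<Sum>\<^sub>\<infinity>x. ell2_apply (translate_all q f) x \<bullet> ell2_apply g x)
      = (\<Sum>\<^sub>\<infinity>x. ell2_apply f (case x of (n, t) \<Rightarrow> (n, - q + t))
          \<bullet> ell2_apply (translate_all (- q) g) (case x of (n, t) \<Rightarrow> (n, - q + t)))"
    by (intro infsum_cong) (auto simp: add.assoc[symmetric])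
  also have "\<dots> = (\<Sum>\<^sub>\<infinity>x. ell2_apply f x \<bullet> ell2_apply (translate_all (- q) g) x)"
    by (rule infsum_reindex_bij_betw[OF bij])
  finally show ?thesis by (simp add: inner_ell2.rep_eq)
qed

lemma norm_translate_all: "norm (translate_all q f) = norm f"
  using inner_translate_all[of q f "translate_all q f"] translate_all_inverse[of "- q" f]
  by (simp add: norm_eq_sqrt_inner)

lemma bounded_linear_translate_all: "bounded_linear (translate_all q)"
  by (rule bounded_linear_intro[where K = 1]) (auto intro!: ell2_eqI simp: norm_translate_all)

lemma inner_ell2_scale: "ell2_scale c f \<bullet> g = f \<bullet> ell2_scale (cnj c) g"
  by (simp flip: Re_cinner)

text \<open>The projection onto an invariant closed subspace has matrix blocks in the commutant.\<close>

lemma invariant_subspace_amplification: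
  fixes E :: "(nat \<times> 'g::group_add) ell2 set"
  assumes E: "subspace E" "closed E"
    and scale: "\<And>c v. v \<in> E \<Longrightarrow> ell2_scale c v \<in> E"
    and inv: "\<And>q v. v \<in> E \<Longrightarrow> translate_all q v \<in> E"
    and \<xi>: "square_summable \<xi>" "stack \<xi> \<in> E" and a: "a \<in> group_vN"
  shows "stack (\<lambda>n. blinfun_apply a (\<xi> n)) \<in> E"
proof -
  have "\<exists>p. p \<in> E \<and> (\<forall>e\<in>E. (v - p) \<bullet> e = 0)" for v
    by (rule closest_point_exists[OF E, of v]) blast
  then obtain p where p: "\<And>v. p v \<in> E" "\<And>v e. e \<in> E \<Longrightarrow> (v - p v) \<bullet> e = 0" by metis
  \<comment> \<open>Orthogonality of the remainder characterises \<open>p v\<close> within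
    \<open>E\<close>. Additivity, homogeneity and equivariance of the projection are all read off
    from this.\<close>
  have uniq: "p v = w" if "w \<in> E" "\<And>e. e \<in> E \<Longrightarrow> (v - w) \<bullet> e = 0" for v w
  proof -
    have e: "p v - w \<in> E" using p(1) that(1) E(1) by (intro subspace_diff)
    have "(p v - w) \<bullet> (p v - w) = (v - w) \<bullet> (p v - w) - (v - p v) \<bullet> (p v - w)"
      by (simp add: inner_diff_left)
    also have "\<dots> = 0" using p(2)[OF e] that(2)[OF e] by simp
    finally show ?thesis by simp
  qed
  have padd: "p (u + v) = p u + p v" for u v
  proof (rule uniq)
    show "p u + p v \<in> E" using p(1) E(1) by (intro subspace_add)
    fix e assume "e \<in> E"
    then show "(u + v - (p u + p v)) \<bullet> e = 0"
      using p(2)[of e u] p(2)[of e v] by (simp add: inner_diff_left inner_add_left)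
  qed
  have pscale: "p (ell2_scale c u) = ell2_scale c (p u)" for c u
  proof (rule uniq)
    fix e assume "e \<in> E"
    then show "(ell2_scale c u - ell2_scale c (p u)) \<bullet> e = 0"
      using p(2)[OF scale[of e "cnj c"], of u] by (simp add: inner_ell2_scale flip: ell2_scale_simps(2))
  qed (use scale p in auto)
  have ptrans: "p (translate_all q u) = translate_all q (p u)" for q u
  proof (rule uniq)
    fix e assume "e \<in> E"
    then show "(translate_all q u - translate_all q (p u)) \<bullet> e = 0"
      using p(2)[OF inv[of e "- q"], of u]
      by (simp add: inner_translate_all flip: linear_diff[OF bounded_linear.linear[OF bounded_linear_translate_all]])
  qed (use inv p in auto)
  have pnorm: "norm (p v) \<le> norm v" for v
  proof -
    have "norm (p v) * norm (p v) = v \<bullet> p v"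
      using p(2)[OF p(1), of v v] by (simp add: inner_diff_left norm_eq_sqrt_inner)
    also have "\<dots> \<le> norm v * norm (p v)" by (rule norm_cauchy_schwarz)
    finally show ?thesis by (rule le_if_mult_self_le[rotated 2]) auto
  qed
  have bl: "bounded_linear p"
    by (rule bounded_linear_intro[where K = 1]) (auto simp: padd pscale scaleR_eq_ell2_scale pnorm)
  \<comment> \<open>The block of the projection from copy \<open>m\<close> to copy \<open>n\<close>.
    Equivariance puts it into the commutant, so it commutes with \<open>a\<close>.\<close>
  define B where "B n m = Blinfun (\<lambda>f. slice n (p (inject m f)))" for n m
  have B: "blinfun_apply (B n m) f = slice n (p (inject m f))" for n m f
    unfolding B_def
    by (simp add: bounded_linear_Blinfun_apply bounded_linear_compose[OF bounded_linear_slice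
        bounded_linear_compose[OF bl bounded_linear_inject]])
  have "B n m \<in> commutant (range left_regular)" for n m
  proof -
    have "inject m (ell2_scale c f) = ell2_scale c (inject m f)" for c and f :: "'g ell2"
      by (rule ell2_eqI, rename_tac p, case_tac p) simp
    moreover have "slice n (ell2_scale c \<Phi>) = ell2_scale c (slice n \<Phi>)" for c and \<Phi> :: "(nat \<times> 'g) ell2"
      by (rule ell2_eqI) simp
    moreover have "inject m (blinfun_apply (left_regular q) f) = translate_all q (inject m f)" for q and f :: "'g ell2"
      by (rule ell2_eqI, rename_tac p, case_tac p) simp
    moreover have "slice n (translate_all q \<Phi>) = blinfun_apply (left_regular q) (slice n \<Phi>)" for q and \<Phi> :: "(nat \<times> 'g) ell2"
      by (rule ell2_eqI) simp
    ultimately show ?thesis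
      by (auto simp: commutant_def bounded_ops_def B pscale ptrans intro!: blinfun_eqI)
  qed
  then have comm: "blinfun_apply (B n m) (blinfun_apply a f) = blinfun_apply a (blinfun_apply (B n m) f)" for n m f
    using commutant_commute a unfolding group_vN_def by metis
  have sq: "square_summable (\<lambda>n. blinfun_apply a (\<xi> n))" by (rule square_summable_op[OF \<xi>(1)])
  have lim: "(\<lambda>M. \<Sum>m<M. blinfun_apply (B n m) (slice m \<Phi>)) \<longlonglongrightarrow> slice n (p \<Phi>)" for n \<Phi>
  proof -
    have "bounded_linear (\<lambda>\<Phi>. slice n (p \<Phi>))"
      using bounded_linear_compose[OF bounded_linear_slice bl] .
    from bounded_linear.tendsto[OF this inject_slice_tendsto[of \<Phi>]] show ?thesis
      by (simp add: B linear_sum[OF bounded_linear.linear[OF \<open>bounded_linear (\<lambda>\<Phi>. slice n (p \<Phi>))\<close>]])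
  qed
  have "p (stack \<xi>) = stack \<xi>" using \<xi>(2) by (intro uniq) auto
  let ?\<Psi> = "stack (\<lambda>n. blinfun_apply a (\<xi> n))"
  \<comment> \<open>Expanded into blocks, the projection lets \<open>a\<close> be pulled out of
    every partial sum, which leaves \<open>a\<close> applied to a slice of the fixed vector
    \<open>stack \<xi>\<close>.\<close>
  have "slice n (p ?\<Psi>) = slice n ?\<Psi>" for n
  proof (rule LIMSEQ_unique[OF lim])
    have "(\<lambda>M. blinfun_apply a (\<Sum>m<M. blinfun_apply (B n m) (\<xi> m))) \<longlonglongrightarrow> blinfun_apply a (slice n (p (stack \<xi>)))"
      using lim[of n "stack \<xi>"]
      by (intro bounded_linear.tendsto[OF blinfun.bounded_linear_right]) (simp add: slice_stack[OF \<xi>(1)])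
    then show "(\<lambda>M. \<Sum>m<M. blinfun_apply (B n m) (slice m ?\<Psi>)) \<longlonglongrightarrow> slice n ?\<Psi>"
      by (simp add: slice_stack[OF \<xi>(1)] slice_stack[OF sq] comm blinfun.sum_right \<open>p (stack \<xi>) = stack \<xi>\<close>)
  qed
  then have "p ?\<Psi> = ?\<Psi>"
    by (intro ell2_eqI, rename_tac q, case_tac q) (metis ell2_apply_slice)
  then show ?thesis using p(1) by metis
qed

lemma subspace_closure:
  fixes S :: "'a::real_normed_vector set"
  assumes "subspace S"
  shows "subspace (closure S)"
proof (rule subspaceI)
  show "0 \<in> closure S" using assms closure_subset subspace_0 by blast
  fix x y assume "x \<in> closure S" "y \<in> closure S"
  then obtain u v where "\<forall>n. u n \<in> S" "u \<longlonglongrightarrow> x" "\<forall>n. v n \<in> S" "v \<longlonglongrightarrow> y"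
    by (auto simp: closure_sequential)
  then show "x + y \<in> closure S"
    using assms by (auto simp: closure_sequential intro!: exI[of _ "\<lambda>n. u n + v n"] tendsto_add subspace_add)
next
  fix c x assume "x \<in> closure S"
  then obtain u where "\<forall>n. u n \<in> S" "u \<longlonglongrightarrow> x" by (auto simp: closure_sequential)
  then show "c *\<^sub>R x \<in> closure S"
    using assms by (auto simp: closure_sequential intro!: exI[of _ "\<lambda>n. c *\<^sub>R u n"] tendsto_scaleR subspace_scale)
qed

text \<open>The density theorem in functional form. Let \<open>E\<close> be the closed span of the
  amplified translates of \<xi>: vanishing of \<omega> on translations says that \<open>E\<close> is
  orthogonal to \<open>stack \<eta>\<close>, and \<open>invariant_subspace_amplification\<close>
  puts the vector belonging to \<open>a\<close> into \<open>E\<close>.\<close>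

lemma normal_functional_unique:
  assumes \<omega>: "\<omega> \<in> normal_functionals" and 0: "\<And>p. \<omega> (left_regular p) = 0" and a: "a \<in> group_vN"
  shows "\<omega> a = 0"
proof -
  obtain \<xi> \<eta> where \<omega>_eq: "\<omega> = normal_functional \<xi> \<eta>" and \<xi>: "square_summable \<xi>" and \<eta>: "square_summable \<eta>"
    using \<omega> by (auto simp: normal_functionals_def)
  define L where "L q = stack (\<lambda>n. blinfun_apply (left_regular q) (\<xi> n))" for q
  have sq: "square_summable (\<lambda>n. blinfun_apply (left_regular q) (\<xi> n))" for q using \<xi> by simp
  \<comment> \<open>All complex multiples are included because \<open>span\<close> is the real
    span.\<close>
  define G where "G = {ell2_scale c (L q) | c q. True}"
  define E where "E = closure (span G)"
  have inG: "ell2_scale c v \<in> G" "translate_all q v \<in> G" if "v \<in> G" for c q v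
  proof -
    obtain d r where v: "v = ell2_scale d (L r)" using \<open>v \<in> G\<close> by (auto simp: G_def)
    show "ell2_scale c v \<in> G" by (auto simp: v G_def)
    have "translate_all q v = ell2_scale d (L (q + r))"
      by (rule ell2_eqI, rename_tac p, case_tac p)
        (simp add: v L_def ell2_apply_stack[OF sq], simp only: group_normalize simp_thms)
    then show "translate_all q v \<in> G" by (auto simp: G_def)
  qed
  have closed_under: "h v \<in> E" if h: "bounded_linear h" "\<And>v. v \<in> G \<Longrightarrow> h v \<in> G" and v: "v \<in> E" for h v
  proof -
    have "h ` span G \<subseteq> span G"
      unfolding linear_span_image[OF bounded_linear.linear[OF h(1)], symmetric]
      using h(2) by (intro span_mono) auto
    then have "h ` closure (span G) \<subseteq> closure (span G)"
      by (intro closure_bounded_linear_image_subset[OF h(1), THEN order_trans] closure_mono)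
    then show ?thesis using v by (auto simp: E_def)
  qed
  have "blinfun_apply (left_regular 0) f = f" for f :: "'a ell2" by (rule ell2_eqI) simp
  then have "L 0 = stack \<xi>" by (simp add: L_def)
  then have "stack \<xi> \<in> G" unfolding G_def by (metis (mono_tags, lifting) ell2_scale_simps(5) mem_Collect_eq)
  then have "stack \<xi> \<in> E" unfolding E_def using closure_subset span_base by blast
  then have "stack (\<lambda>n. blinfun_apply a (\<xi> n)) \<in> E"
    using a \<xi>
    by (intro invariant_subspace_amplification)
      (auto simp: E_def[symmetric] intro: closed_under[OF bounded_linear_ell2_scale]
        closed_under[OF bounded_linear_translate_all] inG, auto simp: E_def subspace_closure)
  moreover have "E \<subseteq> {\<Phi>. cinner \<Phi> (stack \<eta>) = 0}"
    unfolding E_def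
  proof (rule closure_minimal)
    show "closed {\<Phi>. cinner \<Phi> (stack \<eta>) = 0}"
      by (intro closed_Collect_eq continuous_on_const linear_continuous_on bounded_linear_cinner_left)
    have "G \<subseteq> {\<Phi>. cinner \<Phi> (stack \<eta>) = 0}"
      using 0 by (auto simp: G_def L_def cinner_stack[OF sq \<eta>] \<omega>_eq normal_functional_def)
    moreover have "subspace {\<Phi>. cinner \<Phi> (stack \<eta>) = 0}"
      by (auto simp: subspace_def cinner_add_left scaleR_eq_ell2_scale)
    ultimately show "span G \<subseteq> {\<Phi>. cinner \<Phi> (stack \<eta>) = 0}" by (rule span_minimal)
  qed
  ultimately have "cinner (stack (\<lambda>n. blinfun_apply a (\<xi> n))) (stack \<eta>) = 0" by blast
  then show ?thesis
    by (simp add: cinner_stack square_summable_op[OF \<xi>] \<eta> \<omega>_eq normal_functional_def)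
qed

section \<open>The functional of a Fourier algebra function\<close>

text \<open>Members of the predual are normal on the von Neumann algebra, and normal functionals
  agreeing at every \<open>left_regular p\<close> agree there; this resolves the
  description.\<close>

lemma fourier_functional_eqI:
  assumes "\<nu> \<in> normal_functionals" "\<And>p. \<nu> (left_regular p) = \<phi> p"
  shows "fourier_functional \<phi> = restrict \<nu> group_vN"
  unfolding fourier_functional_def
proof (rule the_equality)
  show "restrict \<nu> group_vN \<in> vN_predual \<and> (\<forall>x. restrict \<nu> group_vN (left_regular x) = \<phi> x)"
    using restrict_normal_functional_in_predual[OF assms(1)] assms(2) by simp
  fix \<omega> assume \<omega>: "\<omega> \<in> vN_predual \<and> (\<forall>x. \<omega> (left_regular x) = \<phi> x)"
  then obtain \<mu> where \<mu>: "\<mu> \<in> normal_functionals" "\<And>x. x \<in> group_vN \<Longrightarrow> \<omega> x = \<mu> x"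
    using predual_normal by metis
  have "\<mu> x - \<nu> x = 0" if "x \<in> group_vN" for x
  proof (rule normal_functional_unique[OF normal_functionals_diff[OF \<mu>(1) assms(1)] _ that])
    show "\<mu> (left_regular p) - \<nu> (left_regular p) = 0" for p
      using \<omega> \<mu>(2)[of "left_regular p"] assms(2)[of p] by simp
  qed
  then show "\<omega> = restrict \<nu> group_vN"
    using \<omega> \<mu>(2) by (auto simp: vN_predual_def intro!: extensionalityI)
qed

lemma fourier_functional_coefficient:
  "x \<in> group_vN \<Longrightarrow> fourier_functional (coefficient f g) x = cinner (blinfun_apply x f) g"
  using fourier_functional_eqI[OF normal_functionals_cinner[of f g], of "coefficient f g"]
  by (simp add: coefficient_def)

text \<open>Multiplication by a right translate of \<open>h\<close>: the diagonal operators into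
  which Schur multiplication decomposes.\<close>

lift_definition diag_mult :: "'g::group_add ell2 \<Rightarrow> 'g \<Rightarrow> 'g ell2 \<Rightarrow> 'g ell2" is
  "\<lambda>h z f s. h (s + z) * f s"
proof -
  fix h f :: "'g \<Rightarrow> complex" and z
  assume h: "(\<lambda>x. (cmod (h x))\<^sup>2) summable_on UNIV" and f: "(\<lambda>x. (cmod (f x))\<^sup>2) summable_on UNIV"
  have "cmod (h x) \<le> norm (Abs_ell2 h)" for x
    using cmod_ell2_apply_le[of "Abs_ell2 h" x] h by (simp add: Abs_ell2_inverse)
  then show "(\<lambda>s. (cmod (h (s + z) * f s))\<^sup>2) summable_on UNIV"
    by (intro summable_on_comparison_test[OF summable_on_cmult_right[OF f, of "(norm (Abs_ell2 h))\<^sup>2"]])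
      (auto simp: norm_mult power_mult_distrib intro!: mult_right_mono power_mono)
qed

lemmas ell2_apply_diag_mult [simp] = diag_mult.rep_eq

lemma diag_mult_fin: "finite F \<Longrightarrow> diag_mult h z (ell2_fin F w) = ell2_fin F (\<lambda>s. ell2_apply h (s + z) * w s)"
  by (rule ell2_eqI) simp

lemma diag_mult_linear:
  "diag_mult h z (f + g) = diag_mult h z f + diag_mult h z g"
  "diag_mult h z (ell2_scale c f) = ell2_scale c (diag_mult h z f)"
  by (rule ell2_eqI; simp add: algebra_simps)+

text \<open>At fixed \<open>s\<close> the squared moduli of \<open>h\<close> at the points
  \<open>s + z\<close> sum to at most \<open>(norm h)\<^sup>2\<close>, so the sum over
  \<open>z\<close> is estimated before the one over \<open>s\<close>.\<close>

lemma sum_diag_mult_le: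
  assumes Z: "finite Z"
  shows "(\<Sum>z\<in>Z. (norm (diag_mult h z f))\<^sup>2) \<le> (norm h * norm f)\<^sup>2"
proof -
  have "(\<Sum>z\<in>Z. (norm (diag_mult h z f))\<^sup>2) \<le> (norm h)\<^sup>2 * (norm f)\<^sup>2"
  proof (rule has_sum_mono)
    show "((\<lambda>s. \<Sum>z\<in>Z. (cmod (ell2_apply h (s + z)))\<^sup>2 * (cmod (ell2_apply f s))\<^sup>2) has_sum
        (\<Sum>z\<in>Z. (norm (diag_mult h z f))\<^sup>2)) UNIV"
      using ell2_has_sum_norm[of "diag_mult h _ f"]
      by - (rule has_sum_sum, simp add: norm_mult power_mult_distrib)
    show "((\<lambda>s. (norm h)\<^sup>2 * (cmod (ell2_apply f s))\<^sup>2) has_sum (norm h)\<^sup>2 * (norm f)\<^sup>2) UNIV"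
      by (rule has_sum_cmult_right[OF ell2_has_sum_norm])
    fix s
    have "(\<Sum>z\<in>Z. (cmod (ell2_apply h (s + z)))\<^sup>2) = (\<Sum>z\<in>(+) s ` Z. (cmod (ell2_apply h z))\<^sup>2)"
      by (subst sum.reindex) (auto simp: inj_on_def)
    also have "\<dots> \<le> (norm h)\<^sup>2" using Z by (intro ell2_sum_le_norm) simp
    finally show "(\<Sum>z\<in>Z. (cmod (ell2_apply h (s + z)))\<^sup>2 * (cmod (ell2_apply f s))\<^sup>2)
        \<le> (norm h)\<^sup>2 * (cmod (ell2_apply f s))\<^sup>2"
      unfolding sum_distrib_right[symmetric] by (intro mult_right_mono) auto
  qed
  then show ?thesis by (simp add: power_mult_distrib)
qed

lemma diag_mult_summable: "(\<lambda>z. (norm (diag_mult h z f))\<^sup>2) summable_on UNIV"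
  by (rule nonneg_bdd_above_summable_on)
    (auto intro!: bdd_aboveI[of _ "(norm h * norm f)\<^sup>2"] sum_diag_mult_le)

lemma diag_form_sum_le:
  assumes "finite Z"
  shows "(\<Sum>z\<in>Z. cmod (cinner (blinfun_apply x (diag_mult h z f)) (diag_mult h' z g)))
    \<le> norm x * (norm h * norm f * (norm h' * norm g))"
proof -
  have "(\<Sum>z\<in>Z. cmod (cinner (blinfun_apply x (diag_mult h z f)) (diag_mult h' z g)))
      \<le> (\<Sum>z\<in>Z. norm x * (\<bar>norm (diag_mult h z f)\<bar> * \<bar>norm (diag_mult h' z g)\<bar>))"
    by (rule sum_mono) (simp add: cmod_cinner_op_le)
  also have "\<dots> \<le> norm x * (L2_set (\<lambda>z. norm (diag_mult h z f)) Z * L2_set (\<lambda>z. norm (diag_mult h' z g)) Z)"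
    unfolding sum_distrib_left[symmetric] by (intro mult_left_mono L2_set_mult_ineq) simp
  also have "\<dots> \<le> norm x * (norm h * norm f * (norm h' * norm g))"
    using sum_diag_mult_le[OF assms, of h f] sum_diag_mult_le[OF assms, of h' g]
    by (intro mult_left_mono mult_mono) (auto simp: L2_set_def intro!: real_le_lsqrt sum_nonneg)
  finally show ?thesis .
qed

lemma diag_form_summable:
  "(\<lambda>z. cinner (blinfun_apply x (diag_mult h z f)) (diag_mult h' z g)) summable_on UNIV"
  by (rule abs_summable_summable, rule nonneg_bdd_above_summable_on)
    (auto intro!: bdd_aboveI[of _ "norm x * (norm h * norm f * (norm h' * norm g))"] diag_form_sum_le)

text \<open>Expresses a vector functional of \<open>schur\<close> by vector functionals of
  \<open>x\<close> itself, which makes it normal in \<open>x\<close>. Both sides are continuous in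
  \<open>f\<close> and \<open>g\<close>, so finitely supported vectors decide, and there only
  finitely many entries occur.\<close>

lemma schur_functional_has_sum:
  assumes x: "x \<in> bounded_ops"
  shows "((\<lambda>z. cinner (blinfun_apply x (diag_mult h z f)) (diag_mult h' z g)) has_sum
    cinner (blinfun_apply (schur (coefficient h h') x) f) g) UNIV"
proof -
  define S where "S = schur (coefficient h h') x"
  have S: "S \<in> bounded_ops" "\<And>t s. entry S t s = coefficient h h' (t - s) * entry x t s"
    using x by (simp_all add: S_def coefficient_in_fourier_algebra)
  define b where "b f g = (\<Sum>\<^sub>\<infinity>z. cinner (blinfun_apply x (diag_mult h z f)) (diag_mult h' z g))" for f g
  have hs: "((\<lambda>z. cinner (blinfun_apply x (diag_mult h z f)) (diag_mult h' z g)) has_sum b f g) UNIV" for f g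
    unfolding b_def by (rule has_sum_infsum[OF diag_form_summable])
  have bd: "cmod (b f g) \<le> norm f * norm g * (norm x * norm h * norm h')" for f g
  proof (rule has_sum_norm_le[OF hs])
    fix Z :: "'a set" assume "finite Z"
    then have "cmod (\<Sum>z\<in>Z. cinner (blinfun_apply x (diag_mult h z f)) (diag_mult h' z g))
        \<le> norm x * (norm h * norm f * (norm h' * norm g))"
      by (intro order_trans[OF norm_sum] diag_form_sum_le)
    then show "cmod (\<Sum>z\<in>Z. cinner (blinfun_apply x (diag_mult h z f)) (diag_mult h' z g))
        \<le> norm f * norm g * (norm x * norm h * norm h')" by (simp add: ac_simps)
  qed
  have bil: "bounded_bilinear b"
  proof
    show "b (f + f') g = b f g + b f' g" for f f' g
      using has_sum_unique[OF hs[of "f + f'" g]] has_sum_add[OF hs[of f g] hs[of f' g]]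
      by (simp add: diag_mult_linear blinfun.add_right cinner_add_left)
    show "b f (g + g') = b f g + b f g'" for f g g'
      using has_sum_unique[OF hs[of f "g + g'"]] has_sum_add[OF hs[of f g] hs[of f g']]
      by (simp add: diag_mult_linear cinner_add_right)
    show "b (r *\<^sub>R f) g = r *\<^sub>R b f g" for r f g
      using has_sum_unique[OF hs[of "r *\<^sub>R f" g]] has_sum_cmult_right[OF hs[of f g], of "of_real r"] x
      by (simp add: scaleR_eq_ell2_scale diag_mult_linear bounded_opsD scaleR_conv_of_real)
    show "b f (r *\<^sub>R g) = r *\<^sub>R b f g" for r f g
      using has_sum_unique[OF hs[of f "r *\<^sub>R g"]] has_sum_cmult_right[OF hs[of f g], of "of_real r"]
      by (simp add: scaleR_eq_ell2_scale diag_mult_linear scaleR_conv_of_real)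
    show "\<exists>K. \<forall>f g. norm (b f g) \<le> norm f * norm g * K" using bd by blast
  qed
  have fin: "b (ell2_fin F f) (ell2_fin F g) = cinner (blinfun_apply S (ell2_fin F f)) (ell2_fin F g)"
    if F: "finite F" for F f g
  proof (rule has_sum_unique[OF hs])
    have "((\<lambda>z. \<Sum>t\<in>F. \<Sum>s\<in>F. (entry x t s * f s * cnj (g t)) * (ell2_apply h (s + z) * cnj (ell2_apply h' (t + z)))) has_sum
        (\<Sum>t\<in>F. \<Sum>s\<in>F. (entry x t s * f s * cnj (g t)) * coefficient h h' (t - s))) UNIV"
      by (intro has_sum_sum has_sum_cmult_right coefficient_has_sum)
    then show "((\<lambda>z. cinner (blinfun_apply x (diag_mult h z (ell2_fin F f))) (diag_mult h' z (ell2_fin F g))) has_sum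
        cinner (blinfun_apply S (ell2_fin F f)) (ell2_fin F g)) UNIV"
      using F x S by (simp add: diag_mult_fin cinner_fin_right op_apply_fin sum_distrib_right sum_distrib_left ac_simps)
  qed
  let ?c = "\<lambda>F (f :: 'a ell2). ell2_fin F (ell2_apply f)"
  have "((\<lambda>F. b (?c F f) (?c F g)) \<longlongrightarrow> b f g) (finite_subsets_at_top UNIV)"
    by (intro bounded_bilinear.tendsto[OF bil] truncate_tendsto)
  moreover have "((\<lambda>F. b (?c F f) (?c F g)) \<longlongrightarrow> cinner (blinfun_apply S f) g) (finite_subsets_at_top UNIV)"
  proof (rule Lim_transform_eventually)
    show "((\<lambda>F. cinner (blinfun_apply S (?c F f)) (?c F g)) \<longlongrightarrow> cinner (blinfun_apply S f) g) (finite_subsets_at_top UNIV)"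
      by (intro tendsto_cinner truncate_tendsto bounded_linear.tendsto[OF blinfun.bounded_linear_right])
    show "\<forall>\<^sub>F F in finite_subsets_at_top UNIV. cinner (blinfun_apply S (?c F f)) (?c F g) = b (?c F f) (?c F g)"
      by (rule eventually_finite_subsets_at_top_weakI) (simp add: fin)
  qed
  ultimately have "b f g = cinner (blinfun_apply S f) g"
    by (rule tendsto_unique[OF finite_subsets_at_top_neq_bot])
  then show ?thesis using hs[of f g] by (simp add: S_def)
qed

lemma schur_functional_normal:
  assumes "\<phi> \<in> fourier_algebra"
  obtains \<nu> where "\<nu> \<in> normal_functionals"
    "\<And>x. x \<in> group_vN \<Longrightarrow> \<nu> x = cinner (blinfun_apply (schur \<phi> x) f) g"
proof -
  obtain h h' where \<phi>: "\<phi> = coefficient h h'" using assms by (auto simp: fourier_algebra_iff)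
  define \<nu> where "\<nu> x = (\<Sum>\<^sub>\<infinity>z. cinner (blinfun_apply x (diag_mult h z f)) (diag_mult h' z g))" for x
  have "\<nu> \<in> normal_functionals"
    by (rule normal_functionals_family[OF diag_mult_summable diag_mult_summable])
      (unfold \<nu>_def, rule has_sum_infsum[OF diag_form_summable])
  moreover have "\<nu> x = cinner (blinfun_apply (schur \<phi> x) f) g" if "x \<in> group_vN" for x
    unfolding \<nu>_def \<phi> by (rule infsumI, rule schur_functional_has_sum, rule group_vN_bounded_ops[OF that])
  ultimately show ?thesis using that by blast
qed

text \<open>The functionals on the right are normal in \<open>x\<close>, and at
  \<open>left_regular p\<close> Schur multiplication is multiplication by \<phi> p. Uniqueness gives
  the rest, without exhibiting vectors of which the product is a coefficient.\<close>

lemma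
  assumes \<phi>: "\<phi> \<in> fourier_algebra" and x: "x \<in> group_vN"
  shows fourier_functional_mult: "fourier_functional (\<lambda>t. \<phi> t * coefficient f g t) x
      = cinner (blinfun_apply (schur \<phi> x) f) g"
    and fourier_functional_mult_diff: "fourier_functional (\<lambda>t. \<phi> t * coefficient f g t - coefficient f g t) x
      = cinner (blinfun_apply (schur \<phi> x - x) f) g"
proof -
  obtain \<nu> where \<nu>: "\<nu> \<in> normal_functionals"
    "\<And>x. x \<in> group_vN \<Longrightarrow> \<nu> x = cinner (blinfun_apply (schur \<phi> x) f) g"
    using schur_functional_normal[OF \<phi>] by blast
  have at: "\<nu> (left_regular p) = \<phi> p * coefficient f g p" for p
    by (simp add: \<nu>(2) schur_left_regular \<phi> op_scale_apply coefficient_def)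
  show "fourier_functional (\<lambda>t. \<phi> t * coefficient f g t) x = cinner (blinfun_apply (schur \<phi> x) f) g"
    using fourier_functional_eqI[OF \<nu>(1), OF at] x \<nu>(2) by simp
  have "fourier_functional (\<lambda>t. \<phi> t * coefficient f g t - coefficient f g t)
      = restrict (\<lambda>x. \<nu> x - cinner (blinfun_apply x f) g) group_vN"
    by (rule fourier_functional_eqI[OF normal_functionals_diff[OF \<nu>(1) normal_functionals_cinner]])
      (simp only: at, simp add: coefficient_def)
  then show "fourier_functional (\<lambda>t. \<phi> t * coefficient f g t - coefficient f g t) x
      = cinner (blinfun_apply (schur \<phi> x - x) f) g"
    using x \<nu>(2) by (simp add: blinfun.diff_left cinner_diff_left)
qed

lemma multiplier_transpose_eq:
  assumes \<phi>: "\<phi> \<in> fourier_algebra" and x: "x \<in> group_vN"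
  shows "multiplier_transpose \<phi> x = schur \<phi> x"
  unfolding multiplier_transpose_def
proof (rule the_equality)
  show "schur \<phi> x \<in> group_vN \<and> (\<forall>\<psi>\<in>fourier_algebra. fourier_functional \<psi> (schur \<phi> x)
      = fourier_functional (\<lambda>t. \<phi> t * \<psi> t) x)"
  proof (intro conjI ballI)
    fix \<psi> :: "'a \<Rightarrow> complex" assume "\<psi> \<in> fourier_algebra"
    then obtain f g where \<psi>: "\<psi> = coefficient f g" by (auto simp: fourier_algebra_iff)
    show "fourier_functional \<psi> (schur \<phi> x) = fourier_functional (\<lambda>t. \<phi> t * \<psi> t) x"
      unfolding \<psi> fourier_functional_mult[OF assms] by (simp add: fourier_functional_coefficient assms)
  qed (simp add: assms)
  fix y assume y: "y \<in> group_vN \<and> (\<forall>\<psi>\<in>fourier_algebra. fourier_functional \<psi> y = fourier_functional (\<lambda>t. \<phi> t * \<psi> t) x)"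
  show "y = schur \<phi> x"
  proof (rule op_eqI)
    show "y \<in> bounded_ops" "schur \<phi> x \<in> bounded_ops" using y assms by (blast intro: group_vN_bounded_ops schur_group_vN)+
    fix t s
    \<comment> \<open>Testing with the coefficient of \<open>delta s\<close> and
      \<open>delta t\<close> reads off the entry in row \<open>t\<close> and column
      \<open>s\<close>, which pins down \<open>y\<close>.\<close>
    have "fourier_functional (coefficient (delta s) (delta t)) y
        = fourier_functional (\<lambda>u. \<phi> u * coefficient (delta s) (delta t) u) x"
      using y coefficient_in_fourier_algebra by blast
    then show "entry y t s = entry (schur \<phi> x) t s"
      unfolding fourier_functional_mult[OF assms] fourier_functional_coefficient[OF conjunct1[OF y]]
      by (simp add: entry_def)
  qed
qed

lemma cb_multiplier_norm_eq: "\<phi> \<in> fourier_algebra \<Longrightarrow> cb_multiplier_norm \<phi> = cb_norm group_vN (schur \<phi>)"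
  unfolding cb_multiplier_norm_def by (rule cb_norm_cong) (rule multiplier_transpose_eq)

section \<open>Finite rank maps\<close>

text \<open>Gram-Schmidt, one vector at a time; a vector equal to its projection adds
  nothing.\<close>

lemma orthonormal_spanning:
  fixes D :: "'a::real_inner set"
  assumes "finite D"
  shows "\<exists>U. finite U \<and> (\<forall>u\<in>U. \<forall>v\<in>U. u \<bullet> v = (if u = v then 1 else 0)) \<and> D \<subseteq> span U"
  using assms
proof (induction D rule: finite_induct)
  case empty
  then show ?case by (intro exI[of _ "{}"]) simp
next
  case (insert d D)
  obtain U where U: "finite U" "\<And>u v. u \<in> U \<Longrightarrow> v \<in> U \<Longrightarrow> u \<bullet> v = (if u = v then 1 else 0)" "D \<subseteq> span U"
    using insert.IH by blast
  define p where "p = (\<Sum>u\<in>U. (d \<bullet> u) *\<^sub>R u)"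
  have p: "p \<in> span U" by (auto simp: p_def intro: span_sum span_scale span_base)
  have orth: "(d - p) \<bullet> v = 0" if v: "v \<in> U" for v
  proof -
    have "p \<bullet> v = (\<Sum>u\<in>U. (d \<bullet> u) * (u \<bullet> v))" by (simp add: p_def inner_sum_left)
    also have "\<dots> = (\<Sum>u\<in>U. if u = v then d \<bullet> v else 0)" using U(2) v by (intro sum.cong) auto
    finally show ?thesis using U(1) v by (simp add: inner_diff_left)
  qed
  show ?case
  proof (cases "d = p")
    case True
    then show ?thesis using U p by (intro exI[of _ U]) auto
  next
    case False
    define e where "e = (d - p) /\<^sub>R norm (d - p)"
    have e: "e \<bullet> e = 1" using False by (simp add: e_def norm_eq_sqrt_inner[symmetric] flip: power2_norm_eq_inner)
    have eU: "e \<bullet> v = 0" if "v \<in> U" for v using orth[OF that] by (simp add: e_def)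
    then have "e \<notin> U" using e by force
    have "d = p + norm (d - p) *\<^sub>R e" using False by (simp add: e_def)
    moreover have "p \<in> span (insert e U)" using p span_mono[of U "insert e U"] by blast
    ultimately have "d \<in> span (insert e U)" by (metis insertI1 span_add span_base span_scale)
    moreover have "D \<subseteq> span (insert e U)" using U(3) span_mono[of U "insert e U"] by blast
    ultimately show ?thesis
      using U(1,2) e eU \<open>e \<notin> U\<close> by (intro exI[of _ "insert e U"]) (auto simp: inner_commute)
  qed
qed

text \<open>In an orthonormal expansion of \<open>w\<close> every coefficient is at most
  \<open>norm w\<close>, so \<open>h\<close> can be the sum of the moduli of the finitely many
  orthonormal vectors.\<close>

lemma finite_dimensional_pointwise_bound:
  fixes D :: "'a ell2 set"
  assumes "finite D"
  obtains h where "(\<lambda>x. (h x)\<^sup>2) summable_on UNIV" "\<And>w x. w \<in> span D \<Longrightarrow> cmod (ell2_apply w x) \<le> norm w * h x"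
proof -
  obtain U where U: "finite U" "\<And>u v. u \<in> U \<Longrightarrow> v \<in> U \<Longrightarrow> u \<bullet> v = (if u = v then 1 else 0)" "D \<subseteq> span U"
    using orthonormal_spanning[OF assms] by blast
  define h where "h x = (\<Sum>u\<in>U. cmod (ell2_apply u x))" for x
  have "(\<lambda>x. (h x)\<^sup>2) summable_on UNIV"
  proof (rule summable_on_comparison_test)
    have "((\<lambda>x. \<Sum>u\<in>U. (cmod (ell2_apply u x))\<^sup>2) has_sum (\<Sum>u\<in>U. (norm u)\<^sup>2)) UNIV"
      by (rule has_sum_sum) (rule ell2_has_sum_norm)
    then show "(\<lambda>x. (\<Sum>u\<in>U. (cmod (ell2_apply u x))\<^sup>2) * real (card U)) summable_on UNIV"
      by (intro summable_on_cmult_left has_sum_imp_summable)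
    show "(h x)\<^sup>2 \<le> (\<Sum>u\<in>U. (cmod (ell2_apply u x))\<^sup>2) * real (card U)" for x
      unfolding h_def by (rule sum_squared_le_sum_of_squares)
  qed simp
  moreover have "cmod (ell2_apply w x) \<le> norm w * h x" if "w \<in> span D" for w x
  proof -
    have "w \<in> span U" using that U(3) by (metis span_mono span_span subsetD)
    then have w: "w = (\<Sum>u\<in>U. (w \<bullet> u) *\<^sub>R u)"
    proof (induction rule: span_induct)
      case base
      define P where "P w = (\<Sum>u\<in>U. (w \<bullet> u) *\<^sub>R u)" for w
      have P: "P 0 = 0" "P (v + w) = P v + P w" "P (c *\<^sub>R w) = c *\<^sub>R P w" for v w c
        by (simp_all add: P_def inner_add_left scaleR_left_distrib sum.distrib scaleR_sum_right)
      have "subspace {w. P w = w}" by (rule subspaceI) (simp_all add: P)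
      then show ?case unfolding P_def eq_commute[of "sum _ _"] .
    next
      case (step v)
      have "(\<Sum>u\<in>U. (v \<bullet> u) *\<^sub>R u) = (\<Sum>u\<in>U. if v = u then v else 0)"
        using U(2) step by (intro sum.cong) auto
      then show ?case using U(1) step by simp
    qed
    have nu: "norm u = 1" if "u \<in> U" for u using U(2)[OF that that] by (simp add: norm_eq_sqrt_inner)
    have "cmod (ell2_apply w x) = cmod (\<Sum>u\<in>U. (w \<bullet> u) *\<^sub>R ell2_apply u x)"
      by (subst w) simp
    also have "\<dots> \<le> (\<Sum>u\<in>U. norm w * cmod (ell2_apply u x))"
    proof (intro sum_norm_le)
      fix u assume "u \<in> U"
      then have "\<bar>w \<bullet> u\<bar> \<le> norm w" using Cauchy_Schwarz_ineq2[of w u] nu by simp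
      then show "cmod ((w \<bullet> u) *\<^sub>R ell2_apply u x) \<le> norm w * cmod (ell2_apply u x)"
        by (simp add: mult_right_mono)
    qed
    finally show ?thesis by (simp add: h_def sum_distrib_left)
  qed
  ultimately show ?thesis using that by blast
qed

lemma norm_left_regular_le: "norm (left_regular p) \<le> 1"
  by (rule norm_blinfun_bound) auto

text \<open>The vectors \<open>T (left_regular x)\<close> applied to \<open>delta 0\<close> lie in
  one finite dimensional space and have norm at most \<open>k\<close>, so the value at
  \<open>x\<close> is dominated by \<open>k * \<bar>h x\<bar>\<close>.\<close>

lemma finite_rank_square_summable:
  assumes V: "range left_regular \<subseteq> V" and fr: "finite_rank_on V T"
    and bd: "\<And>p. norm (T (left_regular p)) \<le> k"
  shows "(\<lambda>x. (cmod (entry (T (left_regular x)) x 0))\<^sup>2) summable_on UNIV"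
proof -
  obtain B where B: "finite B" "T ` V \<subseteq> op_span B" using fr by (auto simp: finite_rank_on_def)
  \<comment> \<open>The multiples by \<open>\<i>\<close> let the complex span of \<open>B\<close> be
    handled as a real span.\<close>
  define D where "D = (\<lambda>b. blinfun_apply b (delta 0)) ` B \<union> (\<lambda>b. ell2_scale \<i> (blinfun_apply b (delta 0))) ` B"
  have D: "blinfun_apply y (delta 0) \<in> span D" if "y \<in> op_span B" for y
    using that
  proof (induction rule: op_complex.span_induct_alt)
    case (step c b y)
    have "blinfun_apply (op_scale c b + y) (delta 0) = Re c *\<^sub>R blinfun_apply b (delta 0)
        + Im c *\<^sub>R ell2_scale \<i> (blinfun_apply b (delta 0)) + blinfun_apply y (delta 0)"
      by (rule ell2_eqI)
        (simp add: op_scale_apply blinfun.add_left scaleR_conv_of_real algebra_simps complex_eq_iff)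
    moreover have "blinfun_apply b (delta 0) \<in> D" "ell2_scale \<i> (blinfun_apply b (delta 0)) \<in> D"
      using step by (auto simp: D_def)
    ultimately show ?case using step by (simp add: span_add span_scale span_base)
  qed (simp add: span_zero)
  obtain h where h: "(\<lambda>x. (h x)\<^sup>2) summable_on UNIV"
    "\<And>w x. w \<in> span D \<Longrightarrow> cmod (ell2_apply w x) \<le> norm w * h x"
    using finite_dimensional_pointwise_bound[of D] B(1) by (auto simp: D_def)
  show ?thesis
  proof (rule summable_on_comparison_test[OF summable_on_cmult_right[OF h(1), of "k\<^sup>2"]])
    fix x
    define w where "w = blinfun_apply (T (left_regular x)) (delta 0)"
    have "w \<in> span D" unfolding w_def by (intro D subsetD[OF B(2)] imageI subsetD[OF V] rangeI)
    then have "cmod (ell2_apply w x) \<le> norm w * h x" by (rule h(2))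
    also have "\<dots> \<le> norm w * \<bar>h x\<bar>" by (intro mult_left_mono) auto
    also have "\<dots> \<le> k * \<bar>h x\<bar>"
      using norm_blinfun[of "T (left_regular x)" "delta 0"] bd[of x] by (intro mult_right_mono) (auto simp: w_def)
    finally have "(cmod (ell2_apply w x))\<^sup>2 \<le> (k * \<bar>h x\<bar>)\<^sup>2" by (intro power_mono) auto
    then show "(cmod (entry (T (left_regular x)) x 0))\<^sup>2 \<le> k\<^sup>2 * (h x)\<^sup>2"
      by (simp add: entry_def w_def power_mult_distrib)
  qed auto
qed

section \<open>Multipliers converging to one pointwise\<close>

text \<open>The middle condition of the equivalences. A finite set and a tolerance stand for a net
  converging to 1 pointwise; the \<open>itself\<close> argument carries the group.\<close>

definition weakly_amenable_with :: "'g::group_add itself \<Rightarrow> real \<Rightarrow> bool" where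
  "weakly_amenable_with _ k \<longleftrightarrow> (\<forall>P e. finite P \<longrightarrow> 0 < e \<longrightarrow>
     (\<exists>\<phi> \<in> fourier_algebra. cb_norm group_vN (schur \<phi>) \<le> ennreal k \<and> (\<forall>p\<in>P. cmod (\<phi> (p :: 'g) - 1) < e)))"

lemma mult_half_cancel: "q \<noteq> 0 \<Longrightarrow> q * a * (e / (2 * q)) = e / 2 * (a :: real)"
  by simp

lemma cmod_coefficient_le: "cmod (coefficient f g p) \<le> norm f * norm g"
  using cmod_cinner_le[of "blinfun_apply (left_regular p) f" g] by (simp add: coefficient_def)

text \<open>A nonzero term needs \<open>t \<in> G\<close> and \<open>- x + t \<in> F\<close>, so
  \<open>x\<close> is an element of \<open>G\<close> minus one of \<open>F\<close>.\<close>

lemma coefficient_fin_finite_support: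
  assumes "finite F" "finite G"
  shows "finite {x. coefficient (ell2_fin F u) (ell2_fin G v) x \<noteq> 0}"
proof (rule finite_subset)
  show "finite ((\<lambda>(t, s). t - s) ` (G \<times> F))" using assms by simp
  show "{x. coefficient (ell2_fin F u) (ell2_fin G v) x \<noteq> 0} \<subseteq> (\<lambda>(t, s). t - s) ` (G \<times> F)"
  proof
    fix x assume "x \<in> {x. coefficient (ell2_fin F u) (ell2_fin G v) x \<noteq> 0}"
    then have "(\<Sum>t\<in>G. ell2_apply (ell2_fin F u) (- x + t) * cnj (v t)) \<noteq> 0"
      using assms by (simp add: coefficient_def cinner_fin_right)
    then obtain t where "t \<in> G" "ell2_apply (ell2_fin F u) (- x + t) * cnj (v t) \<noteq> 0"
      by (meson sum.not_neutral_contains_not_neutral)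
    then have "t \<in> G" "- x + t \<in> F" using assms by (auto split: if_splits)
    moreover have "t - (- x + t) = x" by (simp only: group_normalize)
    ultimately show "x \<in> (\<lambda>(t, s). t - s) ` (G \<times> F)" by force
  qed
qed

lemma weakly_amenable_with_finite_support:
  fixes P :: "'g::group_add set"
  assumes A: "weakly_amenable_with TYPE('g) k" and k: "1 \<le> k" and P: "finite P" and e: "0 < e"
  obtains \<phi> where "\<phi> \<in> fourier_algebra" "finite {x. \<phi> x \<noteq> 0}" "cb_norm group_vN (schur \<phi>) \<le> ennreal k"
    "\<And>p. p \<in> P \<Longrightarrow> cmod (\<phi> p - 1) < e"
proof -
  define e' where "e' = min e 1"
  \<comment> \<open>Since \<open>d \<le> 1/8\<close>, the final error
    \<open>d * (1 + 2 * d) + 2 * d\<close> is at most \<open>4 * d\<close>, which is half of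
    \<open>e'\<close>.\<close>
  define d where "d = e' / 8"
  have e': "0 < e'" "e' \<le> 1" "e' \<le> e" using e by (auto simp: e'_def)
  have d: "0 < d" using e' by (simp add: d_def)
  obtain \<psi> where \<psi>: "\<psi> \<in> fourier_algebra" "cb_norm group_vN (schur \<psi>) \<le> ennreal k"
    "\<And>p. p \<in> P \<Longrightarrow> cmod (\<psi> p - 1) < d"
    using A P d unfolding weakly_amenable_with_def by blast
  obtain f g where fg: "\<psi> = coefficient f g" using \<psi>(1) by (auto simp: fourier_algebra_iff)
  \<comment> \<open>Makes the errors of truncating \<open>f\<close> and \<open>g\<close> add up to
    at most \<open>d\<close>; the summand 1 avoids a zero denominator.\<close>
  define r where "r = d / (norm f + norm g + 1)"
  have den: "0 < norm f + norm g + 1" by (smt (verit) norm_ge_zero)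
  have r: "0 < r" using d den by (simp add: r_def)
  obtain F where F: "finite F" "norm (f - ell2_fin F (ell2_apply f)) < r" using truncate_close[OF r] .
  obtain G where G: "finite G" "norm (g - ell2_fin G (ell2_apply g)) < r" using truncate_close[OF r] .
  define f' where "f' = ell2_fin F (ell2_apply f)"
  define g' where "g' = ell2_fin G (ell2_apply g)"
  have small: "norm (f - f') * norm g + norm f' * norm (g - g') \<le> d"
  proof -
    have "norm (f - f') * norm g + norm f' * norm (g - g') \<le> r * norm g + norm f * r"
      using F G r norm_truncate_le[OF F(1), of f]
      by (intro add_mono mult_mono) (auto simp: f'_def g'_def)
    also have "\<dots> \<le> r * (norm f + norm g + 1)" using r by (simp add: algebra_simps)
    also have "\<dots> = d" using den by (simp add: r_def)
    finally show ?thesis .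
  qed
  define \<psi>' where "\<psi>' = coefficient f' g'"
  have \<psi>'A: "\<psi>' \<in> fourier_algebra" by (simp add: \<psi>'_def coefficient_in_fourier_algebra)
  have cb': "cb_norm group_vN (schur \<psi>') \<le> ennreal (k + d)"
  proof -
    have "cb_norm group_vN (schur \<psi>') \<le> ennreal (k + norm (f - f') * norm g + norm f' * norm (g - g'))"
      unfolding \<psi>'_def using \<psi>(2) k by (intro cb_norm_schur_perturb) (auto simp: fg)
    also have "\<dots> \<le> ennreal (k + d)" using small by (intro ennreal_leI) simp
    finally show ?thesis .
  qed
  have near': "cmod (\<psi>' p - \<psi> p) \<le> d" for p
  proof -
    have "cmod (\<psi> p - \<psi>' p) \<le> cmod (coefficient (f - f') g p) + cmod (coefficient f' (g - g') p)"
      unfolding fg \<psi>'_def coefficient_diff by (rule norm_triangle_ineq)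
    also have "\<dots> \<le> d" using cmod_coefficient_le[of "f - f'" g p] cmod_coefficient_le[of f' "g - g'" p] small by linarith
    finally show ?thesis by (simp add: norm_minus_commute)
  qed
  \<comment> \<open>Truncation may have raised the completely bounded norm to \<open>k + d\<close>;
    this factor brings it back to \<open>k\<close>.\<close>
  define c where "c = k / (k + d)"
  have c: "0 \<le> c" "c * (k + d) = k" using k d by (auto simp: c_def)
  have c1: "\<bar>c - 1\<bar> \<le> d"
  proof -
    have "c - 1 = - (d / (k + d))" using k d by (simp add: c_def field_simps)
    moreover have "d / (k + d) \<le> d / 1" using k d by (intro divide_left_mono) auto
    moreover have "0 \<le> d / (k + d)" using k d by simp
    ultimately show ?thesis by linarith
  qed
  define \<phi> where "\<phi> x = of_real c * \<psi>' x" for x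
  have \<phi>A: "\<phi> \<in> fourier_algebra" unfolding \<phi>_def[abs_def] by (rule scale_in_fourier_algebra[OF \<psi>'A])
  have "cb_norm group_vN (schur \<phi>) \<le> ennreal k"
  proof -
    have "matrix_norm n (\<lambda>i j. schur \<phi> (a i j)) \<le> k"
      if a: "\<forall>i<n. \<forall>j<n. a i j \<in> group_vN" "matrix_norm n a \<le> 1" for n a
    proof -
      have "matrix_norm n (\<lambda>i j. schur \<phi> (a i j)) = matrix_norm n (\<lambda>i j. op_scale (of_real c) (schur \<psi>' (a i j)))"
        using a(1) \<phi>A \<psi>'A unfolding \<phi>_def[abs_def]
        by (intro matrix_norm_cong schur_scale_left group_vN_bounded_ops) auto
      also have "\<dots> \<le> cmod (of_real c) * matrix_norm n (\<lambda>i j. schur \<psi>' (a i j))" by (rule matrix_norm_scale)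
      also have "\<dots> \<le> c * (k + d)"
      proof -
        have "matrix_norm n (\<lambda>i j. schur \<psi>' (a i j)) \<le> k + d"
          using a k d by (intro cb_norm_leD[OF cb']) auto
        then show ?thesis using mult_left_mono[OF _ c(1)] c(1) by simp
      qed
      finally show ?thesis by (simp add: c)
    qed
    then show ?thesis using k by (subst cb_norm_le_iff) auto
  qed
  moreover have "finite {x. \<phi> x \<noteq> 0}"
    using finite_subset[OF _ coefficient_fin_finite_support[OF F(1) G(1)], of "{x. \<phi> x \<noteq> 0}" "ell2_apply f" "ell2_apply g"]
    by (auto simp: \<phi>_def \<psi>'_def f'_def g'_def)
  moreover have "cmod (\<phi> p - 1) < e" if p: "p \<in> P" for p
  proof -
    have n1: "cmod (\<psi>' p - 1) \<le> 2 * d"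
      using near'[of p] \<psi>(3)[OF p] norm_triangle_ineq[of "\<psi>' p - \<psi> p" "\<psi> p - 1"] by simp
    then have "cmod (\<psi>' p) \<le> 1 + 2 * d" using norm_triangle_ineq[of "\<psi>' p - 1" 1] by simp
    then have "cmod (of_real (c - 1) * \<psi>' p) \<le> d * (1 + 2 * d)"
      unfolding norm_mult norm_of_real
      using c1 d by (intro mult_mono) auto
    moreover have "\<phi> p - 1 = of_real (c - 1) * \<psi>' p + (\<psi>' p - 1)" by (simp add: \<phi>_def algebra_simps)
    ultimately have "cmod (\<phi> p - 1) \<le> d * (1 + 2 * d) + 2 * d"
      using n1 norm_triangle_ineq[of "of_real (c - 1) * \<psi>' p" "\<psi>' p - 1"] by (simp only:)
    also have "\<dots> \<le> d * 2 + 2 * d" using d e' by (intro add_right_mono mult_left_mono) (auto simp: d_def)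
    also have "\<dots> < e" using e' by (simp add: d_def)
    finally show ?thesis .
  qed
  ultimately show ?thesis using that \<phi>A by blast
qed

text \<open>Acts as \<open>eventually\<close> along multipliers of completely bounded norm at most
  \<open>k\<close> that tend to 1 pointwise. Each mode of convergence is thus stated without a net
  and combined over finitely many parameters.\<close>

definition eventually_near_one :: "real \<Rightarrow> (('g::group_add \<Rightarrow> complex) \<Rightarrow> bool) \<Rightarrow> bool" where
  "eventually_near_one k R \<longleftrightarrow> (\<exists>P d. finite P \<and> 0 < d \<and> (\<forall>\<phi>\<in>fourier_algebra.
     cb_norm group_vN (schur \<phi>) \<le> ennreal k \<longrightarrow> (\<forall>p\<in>P. cmod (\<phi> p - 1) < d) \<longrightarrow> R \<phi>))"

lemma eventually_near_oneI:
  assumes "finite P" "0 < d" "\<And>\<phi>. \<phi> \<in> fourier_algebra \<Longrightarrow> cb_norm group_vN (schur \<phi>) \<le> ennreal k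
    \<Longrightarrow> (\<And>p. p \<in> P \<Longrightarrow> cmod (\<phi> p - 1) < d) \<Longrightarrow> R \<phi>"
  shows "eventually_near_one k R"
  unfolding eventually_near_one_def using assms by (intro exI[of _ P] exI[of _ d]) auto

lemma eventually_near_one_mono:
  assumes "eventually_near_one k R"
    "\<And>\<phi>. \<phi> \<in> fourier_algebra \<Longrightarrow> cb_norm group_vN (schur \<phi>) \<le> ennreal k \<Longrightarrow> R \<phi> \<Longrightarrow> R' \<phi>"
  shows "eventually_near_one k R'"
  using assms unfolding eventually_near_one_def by meson

lemma eventually_near_one_ball_finite:
  assumes "finite S" "\<And>s. s \<in> S \<Longrightarrow> eventually_near_one k (R s)"
  shows "eventually_near_one k (\<lambda>\<phi>. \<forall>s\<in>S. R s \<phi>)"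
  using assms
proof (induction S rule: finite_induct)
  case empty
  show ?case by (rule eventually_near_oneI[of "{}" 1]) auto
next
  case (insert s S)
  obtain P d where 1: "finite P" "0 < d" "\<forall>\<phi>\<in>fourier_algebra.
     cb_norm group_vN (schur \<phi>) \<le> ennreal k \<longrightarrow> (\<forall>p\<in>P. cmod (\<phi> p - 1) < d) \<longrightarrow> R s \<phi>"
    using insert.prems[of s] unfolding eventually_near_one_def by auto
  have "eventually_near_one k (\<lambda>\<phi>. \<forall>s\<in>S. R s \<phi>)" using insert by simp
  then obtain P' d' where 2: "finite P'" "0 < d'" "\<forall>\<phi>\<in>fourier_algebra.
     cb_norm group_vN (schur \<phi>) \<le> ennreal k \<longrightarrow> (\<forall>p\<in>P'. cmod (\<phi> p - 1) < d') \<longrightarrow> (\<forall>s\<in>S. R s \<phi>)"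
    unfolding eventually_near_one_def by auto
  show ?case
  proof (rule eventually_near_oneI[of "P \<union> P'" "min d d'"])
    fix \<phi> :: "'b \<Rightarrow> complex"
    assume "\<phi> \<in> fourier_algebra" "cb_norm group_vN (schur \<phi>) \<le> ennreal k"
      "\<And>p. p \<in> P \<union> P' \<Longrightarrow> cmod (\<phi> p - 1) < min d d'"
    then show "\<forall>s\<in>insert s S. R s \<phi>" using 1(3) 2(3) by simp
  qed (use 1 2 in auto)
qed

lemma eventually_near_one_ex:
  fixes R :: "('g::group_add \<Rightarrow> complex) \<Rightarrow> bool"
  assumes "weakly_amenable_with TYPE('g) k" "1 \<le> k" "eventually_near_one k R"
  obtains \<phi> where "\<phi> \<in> fourier_algebra" "finite {x. \<phi> x \<noteq> 0}" "cb_norm group_vN (schur \<phi>) \<le> ennreal k" "R \<phi>"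
proof -
  obtain P d where P: "finite P" "0 < d" "\<forall>\<phi>\<in>fourier_algebra.
     cb_norm group_vN (schur \<phi>) \<le> ennreal k \<longrightarrow> (\<forall>p\<in>P. cmod (\<phi> p - 1) < d) \<longrightarrow> R \<phi>"
    using assms(3) unfolding eventually_near_one_def by blast
  show ?thesis
    by (rule weakly_amenable_with_finite_support[OF assms(1,2) P(1,2)]) (use P(3) that in blast)
qed

section \<open>Uniform bounds and the three modes of convergence\<close>

lemma norm_schur_le:
  assumes "\<phi> \<in> fourier_algebra" "cb_norm group_vN (schur \<phi>) \<le> ennreal k" "0 \<le> k" "x \<in> group_vN"
  shows "norm (schur \<phi> x) \<le> k * norm x"
  by (rule cb_norm_le_norm[OF assms(2,3) clinear_on_schur[OF assms(1) order_refl] assms(4)]) simp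

lemma norm_schur_diff_le:
  assumes "\<phi> \<in> fourier_algebra" "cb_norm group_vN (schur \<phi>) \<le> ennreal k" "0 \<le> k" "x \<in> group_vN"
  shows "norm (schur \<phi> x - x) \<le> (k + 1) * norm x"
  using norm_triangle_ineq4[of "schur \<phi> x" x] norm_schur_le[OF assms] by (simp add: algebra_simps)

text \<open>For truncated vectors only finitely many values of \<phi> matter, and
  \<open>norm_schur_diff_le\<close> controls the truncation error for all \<phi> at once. The
  estimate is uniform over the unit ball, as the Fourier norm demands.\<close>

lemma coefficient_eventually:
  fixes f g :: "'g::group_add ell2"
  assumes k: "0 \<le> k" and e: "0 < e"
  shows "eventually_near_one k (\<lambda>\<phi>. \<forall>x\<in>group_vN. cmod (cinner (blinfun_apply (schur \<phi> x - x) f) g) \<le> e * norm x)"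
proof -
  \<comment> \<open>Half of the tolerance goes to truncation: an operator of norm at most
    \<open>(k + 1) * norm x\<close> meets errors of total size
    \<open>r * (norm f + norm g)\<close>.\<close>
  define r where "r = e / (2 * (k + 1) * (norm f + norm g + 1))"
  have den: "0 < norm f + norm g + 1" by (smt (verit) norm_ge_zero)
  have r: "0 < r" using e den k by (simp add: r_def)
  obtain F where F: "finite F" "norm (f - ell2_fin F (ell2_apply f)) < r" using truncate_close[OF r] .
  obtain G where G: "finite G" "norm (g - ell2_fin G (ell2_apply g)) < r" using truncate_close[OF r] .
  define f' where "f' = ell2_fin F (ell2_apply f)"
  define g' where "g' = ell2_fin G (ell2_apply g)"
  define M where "M = (\<Sum>t\<in>G. \<Sum>s\<in>F. cmod (ell2_apply f s) * cmod (ell2_apply g t))"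
  have M: "0 \<le> M" by (auto simp: M_def intro!: sum_nonneg)
  \<comment> \<open>The other half goes to the finitely many entries, whose total weight is
    \<open>M\<close>; \<open>M + 1\<close> is positive even if \<open>M\<close> is 0.\<close>
  define d where "d = e / (2 * (M + 1))"
  have d: "0 < d" using e M by (simp add: d_def)
  show ?thesis
  proof (rule eventually_near_oneI[OF _ d])
    show "finite ((\<lambda>(t, s). t - s) ` (G \<times> F))" using F G by simp
    fix \<phi> :: "'g \<Rightarrow> complex"
    assume \<phi>: "\<phi> \<in> fourier_algebra" "cb_norm group_vN (schur \<phi>) \<le> ennreal k"
      and near: "\<And>p. p \<in> (\<lambda>(t, s). t - s) ` (G \<times> F) \<Longrightarrow> cmod (\<phi> p - 1) < d"
    show "\<forall>x\<in>group_vN. cmod (cinner (blinfun_apply (schur \<phi> x - x) f) g) \<le> e * norm x"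
    proof
      fix x :: "'g op" assume x: "x \<in> group_vN"
      define y where "y = schur \<phi> x - x"
      have y: "y \<in> bounded_ops" using x \<phi> by (simp add: y_def group_vN_bounded_ops)
      have ny: "norm y \<le> (k + 1) * norm x" unfolding y_def by (rule norm_schur_diff_le[OF \<phi> k x])
      have ent: "entry y t s = (\<phi> (t - s) - 1) * entry x t s" for t s
        using x \<phi> by (simp add: y_def group_vN_bounded_ops algebra_simps)
      have "cinner (blinfun_apply y f') g' = (\<Sum>t\<in>G. \<Sum>s\<in>F. (\<phi> (t - s) - 1) * entry x t s * ell2_apply f s * cnj (ell2_apply g t))"
        unfolding f'_def g'_def using F G y by (simp add: cinner_fin_right op_apply_fin ent sum_distrib_right)
      also have "cmod \<dots> \<le> (\<Sum>t\<in>G. \<Sum>s\<in>F. d * norm x * (cmod (ell2_apply f s) * cmod (ell2_apply g t)))"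
      proof (intro sum_norm_le)
        fix t s assume "t \<in> G" "s \<in> F"
        then have "cmod (\<phi> (t - s) - 1) \<le> d" using near[of "t - s"] by force
        then have "cmod (\<phi> (t - s) - 1) * cmod (entry x t s) \<le> d * norm x"
          using cmod_entry_le[of x t s] d by (intro mult_mono) auto
        then show "cmod ((\<phi> (t - s) - 1) * entry x t s * ell2_apply f s * cnj (ell2_apply g t))
            \<le> d * norm x * (cmod (ell2_apply f s) * cmod (ell2_apply g t))"
          by (simp add: norm_mult mult.assoc[symmetric] mult_right_mono)
      qed
      also have "\<dots> = (d * M) * norm x" by (simp add: M_def sum_distrib_left ac_simps)
      also have "\<dots> \<le> e / 2 * norm x"
        using e M by (intro mult_right_mono) (auto simp: d_def field_simps)
      finally have 1: "cmod (cinner (blinfun_apply y f') g') \<le> e / 2 * norm x" .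
      have "cmod (cinner (blinfun_apply y (f - f')) g) + cmod (cinner (blinfun_apply y f') (g - g'))
          \<le> norm y * (norm (f - f') * norm g) + norm y * (norm f' * norm (g - g'))"
        by (intro add_mono cmod_cinner_op_le)
      also have "\<dots> \<le> norm y * (r * norm g) + norm y * (norm f * r)"
        using F G norm_truncate_le[OF F(1), of f] r
        by (intro add_mono mult_left_mono mult_mono) (auto simp: f'_def g'_def)
      also have "\<dots> = norm y * (r * (norm f + norm g))" by (simp add: algebra_simps)
      also have "\<dots> \<le> ((k + 1) * norm x) * (r * (norm f + norm g + 1))"
        using ny r k by (intro mult_mono) auto
      also have "r * (norm f + norm g + 1) = e / (2 * (k + 1))" using den by (simp add: r_def)
      also have "(k + 1) * norm x * (e / (2 * (k + 1))) = e / 2 * norm x"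
        by (rule mult_half_cancel) (use k in simp)
      finally have 2: "cmod (cinner (blinfun_apply y (f - f')) g) + cmod (cinner (blinfun_apply y f') (g - g')) \<le> e / 2 * norm x" .
      have "cinner (blinfun_apply y f) g = cinner (blinfun_apply y (f - f')) g
          + cinner (blinfun_apply y f') (g - g') + cinner (blinfun_apply y f') g'"
        by (simp add: blinfun.diff_right cinner_diff_left cinner_diff_right)
      then have "cmod (cinner (blinfun_apply y f) g) \<le> cmod (cinner (blinfun_apply y (f - f')) g)
          + cmod (cinner (blinfun_apply y f') (g - g')) + cmod (cinner (blinfun_apply y f') g')"
        by (smt (verit) norm_triangle_ineq)
      then show "cmod (cinner (blinfun_apply (schur \<phi> x - x) f) g) \<le> e * norm x"
        using 1 2 by (simp add: y_def)
    qed
  qed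
qed

text \<open>The bound \<open>K\<close> on \<open>norm (schur \<phi> x - x)\<close> makes the tail of
  the series small for all \<phi> at once; the first \<open>N\<close> terms fall under
  \<open>coefficient_eventually\<close>.\<close>

lemma normal_functional_eventually:
  assumes \<nu>: "\<nu> \<in> normal_functionals" and x: "x \<in> group_vN" and k: "0 \<le> k" and e: "0 < e"
  shows "eventually_near_one k (\<lambda>\<phi>. cmod (\<nu> (schur \<phi> x - x)) < e)"
proof -
  obtain \<xi> \<eta> where \<nu>_eq: "\<nu> = normal_functional \<xi> \<eta>" and \<xi>: "square_summable \<xi>" and \<eta>: "square_summable \<eta>"
    using \<nu> by (auto simp: normal_functionals_def)
  define K where "K = (k + 1) * norm x"
  have K: "0 \<le> K" using k by (simp add: K_def)
  define b where "b n = norm (\<xi> n) * norm (\<eta> n)" for n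
  have b: "summable b" unfolding b_def using \<xi> \<eta> by (rule norm_product_summable)
  have "0 < e / (2 * (K + 1))" using e K by simp
  from suminf_exist_split[OF this b] obtain N where N: "norm (\<Sum>i. b (i + N)) < e / (2 * (K + 1))" by blast
  \<comment> \<open>Strictly larger than \<open>N * norm x\<close>, the factor of \<open>e'\<close>
    in the bound for the first \<open>N\<close> terms, and positive even if that product is
    0.\<close>
  define q where "q = (real N + 1) * (norm x + 1)"
  define e' where "e' = e / (2 * q)"
  have q: "0 < q" unfolding q_def by (intro mult_pos_pos add_nonneg_pos) auto
  have e': "0 < e'" using e q by (simp add: e'_def)
  have "eventually_near_one k (\<lambda>\<phi>. \<forall>n\<in>{..<N}. \<forall>x\<in>group_vN.
      cmod (cinner (blinfun_apply (schur \<phi> x - x) (\<xi> n)) (\<eta> n)) \<le> e' * norm x)"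
    by (intro eventually_near_one_ball_finite coefficient_eventually k e') simp
  then show ?thesis
  proof (rule eventually_near_one_mono)
    fix \<phi> :: "'a \<Rightarrow> complex"
    assume \<phi>: "\<phi> \<in> fourier_algebra" "cb_norm group_vN (schur \<phi>) \<le> ennreal k"
      and near: "\<forall>n\<in>{..<N}. \<forall>x\<in>group_vN. cmod (cinner (blinfun_apply (schur \<phi> x - x) (\<xi> n)) (\<eta> n)) \<le> e' * norm x"
    define y where "y = schur \<phi> x - x"
    have ny: "norm y \<le> K" unfolding y_def K_def by (rule norm_schur_diff_le[OF \<phi> k x])
    define a where "a n = cinner (blinfun_apply y (\<xi> n)) (\<eta> n)" for n
    have ab: "cmod (a n) \<le> K * b n" for n
      using cmod_cinner_op_le[of y "\<xi> n" "\<eta> n"] mult_right_mono[OF ny, of "b n"]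
      by (simp add: a_def b_def)
    have suma: "summable (\<lambda>n. cmod (a n))"
      by (rule summable_comparison_test'[OF summable_mult[OF b, of K]]) (simp add: ab)
    have "\<nu> y = (\<Sum>n. a (n + N)) + (\<Sum>n<N. a n)"
      unfolding \<nu>_eq normal_functional_def a_def[symmetric]
      by (rule suminf_split_initial_segment[OF summable_norm_cancel[OF suma]])
    moreover have "cmod (\<Sum>n. a (n + N)) \<le> e / 2"
    proof -
      have s: "summable (\<lambda>n. cmod (a (n + N)))" using summable_ignore_initial_segment[OF suma] .
      have sb: "summable (\<lambda>n. b (n + N))" using summable_ignore_initial_segment[OF b] .
      have "cmod (\<Sum>n. a (n + N)) \<le> (\<Sum>n. cmod (a (n + N)))" by (rule summable_norm[OF s])
      also have "\<dots> \<le> (\<Sum>n. K * b (n + N))" by (intro suminf_le ab s summable_mult sb)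
      also have "\<dots> = K * (\<Sum>n. b (n + N))" by (rule suminf_mult[OF sb])
      also have "\<dots> \<le> K * (e / (2 * (K + 1)))" using N K by (intro mult_left_mono) auto
      also have "\<dots> \<le> e / 2" using K e by (simp add: field_simps)
      finally show ?thesis .
    qed
    moreover have "cmod (\<Sum>n<N. a n) < e / 2"
    proof -
      have "cmod (\<Sum>n<N. a n) \<le> (\<Sum>n<N. e' * norm x)"
        using near x by (intro sum_norm_le) (auto simp: a_def y_def)
      also have "\<dots> = real N * norm x * e'" by simp
      also have "\<dots> < q * e'"
      proof (rule mult_strict_right_mono[OF _ e'])
        have "(real N + 1) * (norm x + 1) = real N * norm x + (real N + norm x) + 1" by (simp add: algebra_simps)
        moreover have "0 \<le> real N + norm x" by simp
        ultimately show "real N * norm x < q" unfolding q_def by linarith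
      qed
      also have "\<dots> = e / 2" using q by (simp add: e'_def)
      finally show ?thesis .
    qed
    ultimately show "cmod (\<nu> (schur \<phi> x - x)) < e"
      using norm_triangle_ineq[of "\<Sum>n. a (n + N)" "\<Sum>n<N. a n"] unfolding y_def[symmetric] by simp
  qed
qed

text \<open>On the span of the \<open>left_regular p\<close> Schur multiplication is diagonal with
  values \<phi> p, so finitely many points decide; the bound on the difference carries the
  convergence to the closure.\<close>

lemma reduced_Cstar_eventually:
  fixes x :: "'g::group_add op"
  assumes x: "x \<in> reduced_Cstar" and k: "0 \<le> k" and e: "0 < e"
  shows "eventually_near_one k (\<lambda>\<phi>. norm (schur \<phi> x - x) < e)"
proof -
  have span: "y \<in> group_vN \<and> (\<forall>d>0. eventually_near_one k (\<lambda>\<phi>. norm (schur \<phi> y - y) < d))"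
    if "y \<in> op_span (range left_regular)" for y :: "'g op"
    using that
  proof (induction y rule: op_complex.span_induct_alt)
    case base
    have "eventually_near_one k (\<lambda>\<phi>. norm (schur \<phi> 0 - 0 :: 'g op) < d)" if "0 < d" for d
    proof (rule eventually_near_oneI[of "{}" 1])
      fix \<phi> :: "'g \<Rightarrow> complex" assume "\<phi> \<in> fourier_algebra"
      then have "schur \<phi> (op_scale 0 0) = op_scale 0 (schur \<phi> 0)" by (intro schur_scale) auto
      then show "norm (schur \<phi> 0 - 0 :: 'g op) < d" using that by simp
    qed auto
    then show ?case by simp
  next
    case (step c b y)
    obtain p where p: "b = left_regular p" using step by blast
    have y: "y \<in> group_vN" using step.IH by blast
    have "eventually_near_one k (\<lambda>\<phi>. norm (schur \<phi> (op_scale c b + y) - (op_scale c b + y)) < d)"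
      if d: "0 < d" for d
    proof -
      define r where "r = d / (2 * (cmod c + 1))"
      have r: "0 < r" using d by (auto simp: r_def intro!: divide_pos_pos add_nonneg_pos mult_pos_pos)
      have "eventually_near_one k (\<lambda>\<phi>. cmod (\<phi> p - 1) < r)"
        by (rule eventually_near_oneI[of "{p}" r]) (use r in auto)
      moreover have "eventually_near_one k (\<lambda>\<phi>. norm (schur \<phi> y - y) < d / 2)"
        using step.IH half_gt_zero[OF d] by blast
      \<comment> \<open>The two conditions are joined as a family indexed by \<open>bool\<close>, to
        reuse the combination over finite sets.\<close>
      ultimately have "eventually_near_one k (\<lambda>\<phi>. \<forall>i\<in>UNIV. if i then cmod (\<phi> p - 1) < r else norm (schur \<phi> y - y) < d / 2)"
      proof (intro eventually_near_one_ball_finite)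
        fix i assume "eventually_near_one k (\<lambda>\<phi>. cmod (\<phi> p - 1) < r)"
          "eventually_near_one k (\<lambda>\<phi>. norm (schur \<phi> y - y) < d / 2)"
        then show "eventually_near_one k (\<lambda>\<phi>. if i then cmod (\<phi> p - 1) < r else norm (schur \<phi> y - y) < d / 2)"
          by (cases i) simp_all
      qed simp
      then show ?thesis
      proof (rule eventually_near_one_mono)
        fix \<phi> :: "'g \<Rightarrow> complex"
        assume \<phi>: "\<phi> \<in> fourier_algebra" and near: "\<forall>i\<in>UNIV. if i then cmod (\<phi> p - 1) < r else norm (schur \<phi> y - y) < d / 2"
        have near: "cmod (\<phi> p - 1) < r" "norm (schur \<phi> y - y) < d / 2"
          using near[rule_format, of True] near[rule_format, of False] by auto
        have "schur \<phi> (op_scale c b + y) - (op_scale c b + y) = op_scale (c * (\<phi> p - 1)) b + (schur \<phi> y - y)"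
          using y \<phi> by (simp add: p schur_add schur_scale group_vN_bounded_ops schur_left_regular
              op_complex.scale_right_diff_distrib op_complex.scale_left_diff_distrib algebra_simps)
        then have "norm (schur \<phi> (op_scale c b + y) - (op_scale c b + y))
            \<le> norm (op_scale (c * (\<phi> p - 1)) b) + norm (schur \<phi> y - y)"
          by (simp only: norm_triangle_ineq)
        also have "norm (op_scale (c * (\<phi> p - 1)) b) \<le> cmod c * cmod (\<phi> p - 1)"
          unfolding norm_op_scale norm_mult p by (rule mult_left_le[OF norm_left_regular_le]) simp
        also have "\<dots> \<le> cmod c * r" using near(1) by (intro mult_left_mono) auto
        also have "\<dots> \<le> (cmod c + 1) * r" using r by (intro mult_right_mono) auto
        also have "\<dots> = d / 2"
        proof -
          have "cmod c + 1 \<noteq> 0" by (rule add_nonneg_pos[THEN less_imp_neq, symmetric]) auto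
          from mult_half_cancel[OF this, of 1 d] show ?thesis by (simp only: r_def mult_1_right)
        qed
        finally show "norm (schur \<phi> (op_scale c b + y) - (op_scale c b + y)) < d" using near(2) by simp
      qed
    qed
    then show ?case using y p by simp
  qed
  \<comment> \<open>Replacing \<open>x\<close> by an element this close costs at most
    \<open>(k + 1) * r = e / 2\<close>.\<close>
  define r where "r = e / (2 * (k + 1))"
  have r: "0 < r" using e k by (simp add: r_def)
  obtain y where y: "y \<in> op_span (range left_regular)" "norm (y - x) < r"
    using x r unfolding reduced_Cstar_def closure_approachable dist_norm by blast
  have yv: "y \<in> group_vN" using y(1) op_span_left_regular_subset by blast
  have xv: "x \<in> group_vN" using x reduced_Cstar_subset by blast
  have "eventually_near_one k (\<lambda>\<phi>. norm (schur \<phi> y - y) < e / 2)" using span[OF y(1)] half_gt_zero[OF e] by blast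
  then show ?thesis
  proof (rule eventually_near_one_mono)
    fix \<phi> :: "'g \<Rightarrow> complex"
    assume \<phi>: "\<phi> \<in> fourier_algebra" "cb_norm group_vN (schur \<phi>) \<le> ennreal k"
      and near: "norm (schur \<phi> y - y) < e / 2"
    have "schur \<phi> x = schur \<phi> y + schur \<phi> (x - y)"
      using schur_add[OF \<phi>(1), of y "x - y"] xv yv by (simp add: group_vN_bounded_ops)
    then have "schur \<phi> x - x = (schur \<phi> y - y) + (schur \<phi> (x - y) - (x - y))" by simp
    then have "norm (schur \<phi> x - x) \<le> norm (schur \<phi> y - y) + norm (schur \<phi> (x - y) - (x - y))"
      by (simp only: norm_triangle_ineq)
    also have "norm (schur \<phi> (x - y) - (x - y)) \<le> (k + 1) * norm (x - y)"
      using xv yv by (intro norm_schur_diff_le[OF \<phi> k]) simp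
    also have "\<dots> \<le> (k + 1) * r" using y(2) k by (intro mult_left_mono) (auto simp: norm_minus_commute)
    also have "\<dots> = e / 2"
      using mult_half_cancel[of "k + 1" 1 e] k by (simp add: r_def del: distrib_left_numeral)
    finally show "norm (schur \<phi> x - x) < e" using near by simp
  qed
qed

text \<open>\<open>entry x p 0\<close> is the Fourier coefficient of \<open>x\<close> at
  \<open>p\<close>; a finitely supported \<phi> leaves a finite part of the Fourier series.\<close>

lemma schur_finite_support:
  assumes \<phi>: "\<phi> \<in> fourier_algebra" "finite {p. \<phi> p \<noteq> 0}" and x: "x \<in> group_vN"
  shows "schur \<phi> x = (\<Sum>p | \<phi> p \<noteq> 0. op_scale (\<phi> p * entry x p 0) (left_regular p))"
proof (rule op_eqI)
  show "schur \<phi> x \<in> bounded_ops" using \<phi> x by (simp add: group_vN_bounded_ops)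
  have "(\<Sum>p\<in>I. op_scale (\<phi> p * entry x p 0) (left_regular p)) \<in> bounded_ops" for I
    by (induction I rule: infinite_finite_induct) auto
  then show "(\<Sum>p | \<phi> p \<noteq> 0. op_scale (\<phi> p * entry x p 0) (left_regular p)) \<in> bounded_ops" .
  fix t s :: 'a
  have iff: "t = p + s \<longleftrightarrow> p = t - s" for p by (auto simp: eq_diff_eq)
  have "entry (\<Sum>p | \<phi> p \<noteq> 0. op_scale (\<phi> p * entry x p 0) (left_regular p)) t s
      = (\<Sum>p | \<phi> p \<noteq> 0. if p = t - s then \<phi> p * entry x p 0 else 0)"
    by (simp add: iff) (intro sum.cong refl, simp)
  also have "\<dots> = \<phi> (t - s) * entry x (t - s) 0" using \<phi>(2) by simp
  finally show "entry (schur \<phi> x) t s = entry (\<Sum>p | \<phi> p \<noteq> 0. op_scale (\<phi> p * entry x p 0) (left_regular p)) t s"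
    using \<phi>(1) x group_vN_entry_0[OF x, of t s] by (simp add: group_vN_bounded_ops)
qed

lemma schur_finite_support_span:
  assumes "\<phi> \<in> fourier_algebra" "finite {p. \<phi> p \<noteq> 0}" "x \<in> group_vN"
  shows "schur \<phi> x \<in> op_span (left_regular ` {p. \<phi> p \<noteq> 0})"
  unfolding schur_finite_support[OF assms]
  by (intro op_complex.span_sum op_complex.span_scale op_complex.span_base imageI)

text \<open>Pulled back along \<open>schur \<phi>\<close>, a normal functional becomes a finite
  combination of Fourier coefficients, and these are normal functionals of \<open>x\<close>.\<close>

lemma schur_sigma_weak_continuous:
  assumes \<phi>: "\<phi> \<in> fourier_algebra" "finite {p. \<phi> p \<noteq> 0}"
  shows "continuous_map sigma_weak_vN sigma_weak_vN (schur \<phi>)"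
proof -
  have "continuous_map sigma_weak_vN sigma_weak_topology (schur \<phi>)"
    unfolding sigma_weak_topology_def
  proof (rule continuous_on_generated_topo)
    fix W :: "'a op set" assume "W \<in> {normal_functional \<xi> \<eta> -` U | \<xi> \<eta> U.
        summable (\<lambda>n. (norm (\<xi> n))\<^sup>2) \<and> summable (\<lambda>n. (norm (\<eta> n))\<^sup>2) \<and> open U}"
    then obtain \<nu> U where W: "W = \<nu> -` U" and U: "open U" and \<nu>: "\<nu> \<in> normal_functionals"
      unfolding normal_functionals_def by blast
    define \<mu> :: "'a op \<Rightarrow> complex" where "\<mu> x = (\<Sum>p | \<phi> p \<noteq> 0. (\<phi> p * \<nu> (left_regular p)) * cinner (blinfun_apply x (delta 0)) (delta p))" for x
    have \<mu>: "\<mu> \<in> normal_functionals"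
      unfolding \<mu>_def[abs_def]
      by (intro normal_functionals_sum normal_functionals_scale normal_functionals_cinner \<phi>(2))
    have "\<nu> 0 = 0" using normal_functional_additive(2)[OF \<nu>, of 0 0] by simp
    then have sum: "\<nu> (\<Sum>p\<in>I. y p) = (\<Sum>p\<in>I. \<nu> (y p))" for I and y :: "'a \<Rightarrow> 'a op"
      by (induction I rule: infinite_finite_induct) (auto simp: normal_functional_additive(1)[OF \<nu>])
    have "\<nu> (schur \<phi> x) = \<mu> x" if "x \<in> group_vN" for x
      unfolding schur_finite_support[OF \<phi> that] sum normal_functional_additive(2)[OF \<nu>] \<mu>_def
      by (simp add: entry_def ac_simps)
    then have "schur \<phi> -` W \<inter> topspace sigma_weak_vN = {x \<in> topspace sigma_weak_vN. \<mu> x \<in> U}"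
      by (auto simp: W)
    then show "openin sigma_weak_vN (schur \<phi> -` W \<inter> topspace sigma_weak_vN)"
      using openin_continuous_map_preimage[OF continuous_map_normal_functional[OF \<mu>], of U] U by simp
  qed (unfold topology_generated_by_topspace[symmetric] sigma_weak_topology_def[symmetric] topspace_sigma_weak, simp)
  then show ?thesis
    using \<phi> unfolding sigma_weak_vN_def[where 'g = 'a]
    by (intro continuous_map_into_subtopology) (auto simp: topspace_sigma_weak)
qed

section \<open>Nets\<close>

text \<open>Removes the nets from all three conditions. In a net, finitely many limits are
  simultaneously small at some index; conversely the finite subsets of \<open>S\<close>, paired with
  tolerances \<open>1 / (n + 1)\<close>, form the index set.\<close>

lemma net_iff:
  fixes d :: "'p \<Rightarrow> 'x \<Rightarrow> 'c::real_normed_vector"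
  shows "(\<exists>(I :: ('p set \<times> nat) set) le f. directed I le \<and> (\<forall>i\<in>I. Q (f i)) \<and>
      (\<forall>p\<in>S. ((\<lambda>i. d p (f i)) \<longlongrightarrow> 0) (net_filter I le)))
    \<longleftrightarrow> (\<forall>F e. finite F \<longrightarrow> F \<subseteq> S \<longrightarrow> 0 < e \<longrightarrow> (\<exists>x. Q x \<and> (\<forall>p\<in>F. norm (d p x) < e)))"
proof (intro iffI allI impI)
  fix F :: "'p set" and e :: real
  assume "\<exists>(I :: ('p set \<times> nat) set) le f. directed I le \<and> (\<forall>i\<in>I. Q (f i)) \<and>
      (\<forall>p\<in>S. ((\<lambda>i. d p (f i)) \<longlongrightarrow> 0) (net_filter I le))" and F: "finite F" "F \<subseteq> S" "0 < e"
  then obtain I :: "('p set \<times> nat) set" and le f where I: "directed I le" "\<forall>i\<in>I. Q (f i)"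
    "\<forall>p\<in>S. ((\<lambda>i. d p (f i)) \<longlongrightarrow> 0) (net_filter I le)" by blast
  have "\<forall>\<^sub>F i in net_filter I le. \<forall>p\<in>F. norm (d p (f i)) < e"
    using F I(3) by (intro eventually_ball_finite) (auto simp: tendsto_iff)
  then obtain a where a: "a \<in> I" "\<forall>b\<in>I. le a b \<longrightarrow> (\<forall>p\<in>F. norm (d p (f b)) < e)"
    unfolding eventually_net_filter[OF I(1)] by blast
  have "le a a" using I(1) a(1) by (auto simp: directed_def reflp_on_def)
  then show "\<exists>x. Q x \<and> (\<forall>p\<in>F. norm (d p x) < e)" using a I(2) by blast
next
  assume ex: "\<forall>F e. finite F \<longrightarrow> F \<subseteq> S \<longrightarrow> 0 < e \<longrightarrow> (\<exists>x. Q x \<and> (\<forall>p\<in>F. norm (d p x) < e))"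
  define I where "I = {F. finite F \<and> F \<subseteq> S} \<times> (UNIV :: nat set)"
  define le where "le = (\<lambda>(F :: 'p set, m :: nat) (G, n). F \<subseteq> G \<and> m \<le> n)"
  have dI: "directed I le"
    unfolding directed_def
  proof (intro conjI ballI)
    show "I \<noteq> {}" by (auto simp: I_def)
    show "reflp_on I le" "transp_on I le" by (auto simp: le_def reflp_on_def transp_on_def)
    fix a b assume "a \<in> I" "b \<in> I"
    then show "\<exists>c\<in>I. le a c \<and> le b c"
      by (intro bexI[of _ "(fst a \<union> fst b, max (snd a) (snd b))"]) (auto simp: I_def le_def)
  qed
  have "\<forall>i\<in>I. \<exists>x. Q x \<and> (\<forall>p\<in>fst i. norm (d p x) < inverse (real (Suc (snd i))))"
    using ex by (auto simp: I_def)
  then obtain f where f: "\<And>i. i \<in> I \<Longrightarrow> Q (f i)"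
    "\<And>i p. i \<in> I \<Longrightarrow> p \<in> fst i \<Longrightarrow> norm (d p (f i)) < inverse (real (Suc (snd i)))"
    by metis
  have "((\<lambda>i. d p (f i)) \<longlongrightarrow> 0) (net_filter I le)" if "p \<in> S" for p
    unfolding tendsto_iff eventually_net_filter[OF dI]
  proof (intro allI impI)
    fix e :: real assume "0 < e"
    then obtain n where n: "inverse (real (Suc n)) < e" using reals_Archimedean by blast
    show "\<exists>a\<in>I. \<forall>b\<in>I. le a b \<longrightarrow> dist (d p (f b)) 0 < e"
    proof (intro bexI[of _ "({p}, n)"] ballI impI)
      show "({p}, n) \<in> I" using that by (auto simp: I_def)
      fix b assume b: "b \<in> I" "le ({p}, n) b"
      then have "p \<in> fst b" "n \<le> snd b" by (auto simp: le_def)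
      then have "norm (d p (f b)) < inverse (real (Suc (snd b)))" using f(2) b by blast
      also have "\<dots> \<le> inverse (real (Suc n))" using \<open>n \<le> snd b\<close> by (simp add: le_imp_inverse_le)
      finally show "dist (d p (f b)) 0 < e" using n by simp
    qed
  qed
  then show "\<exists>(I :: ('p set \<times> nat) set) le f. directed I le \<and> (\<forall>i\<in>I. Q (f i)) \<and>
      (\<forall>p\<in>S. ((\<lambda>i. d p (f i)) \<longlongrightarrow> 0) (net_filter I le))" using dI f(1) by blast
qed

section \<open>The equivalences\<close>

text \<open>Convergence enters only through the entry at \<open>(p, 0)\<close>, which norm
  convergence and \<sigma>-weak convergence both control; so one argument serves both
  algebras.\<close>

lemma weakly_amenable_with_of_maps:
  fixes V :: "'g::group_add op set"
  assumes V: "range left_regular \<subseteq> V" "\<And>c x. x \<in> V \<Longrightarrow> op_scale c x \<in> V" "V \<subseteq> group_vN"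
    and k: "0 \<le> k"
    and ex: "\<And>P e. finite P \<Longrightarrow> 0 < e \<Longrightarrow> \<exists>T. T \<in> linear_maps_on V \<and> finite_rank_on V T \<and>
      cb_norm V T \<le> ennreal k \<and> (\<forall>p\<in>P. cmod (entry (T (left_regular p) - left_regular p) p 0) < e)"
  shows "weakly_amenable_with TYPE('g) k"
  unfolding weakly_amenable_with_def
proof (intro allI impI)
  fix P :: "'g set" and e :: real assume "finite P" "0 < e"
  from ex[OF this] obtain T where T: "T \<in> linear_maps_on V" "finite_rank_on V T" "cb_norm V T \<le> ennreal k"
    and near: "\<forall>p\<in>P. cmod (entry (T (left_regular p) - left_regular p) p 0) < e" by blast
  have lin: "clinear_on V op_scale T" and TV: "T ` V \<subseteq> V" using T(1) by (auto simp: linear_maps_on_def)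
  define \<phi> where "\<phi> x = entry (T (left_regular x)) x 0" for x
  have "norm (T (left_regular p)) \<le> k" for p
  proof -
    have "norm (T (left_regular p)) \<le> k * norm (left_regular p)"
      using V by (intro cb_norm_le_norm[OF T(3) k lin]) auto
    also have "\<dots> \<le> k" using norm_left_regular_le k by (intro mult_left_le) auto
    finally show ?thesis .
  qed
  then have \<phi>A: "\<phi> \<in> fourier_algebra"
    unfolding \<phi>_def[abs_def]
    by (intro square_summable_in_fourier_algebra finite_rank_square_summable[OF V(1) T(2)])
  have "cb_norm group_vN (schur \<phi>) \<le> ennreal k"
    using V(3) TV by (intro cb_norm_schur_le[OF V(1,2) lin _ k T(3) \<phi>A]) (auto simp: \<phi>_def)
  then show "\<exists>\<phi>\<in>fourier_algebra. cb_norm group_vN (schur \<phi>) \<le> ennreal k \<and> (\<forall>p\<in>P. cmod (\<phi> p - 1) < e)"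
    using \<phi>A near by (intro bexI[of _ \<phi>]) (auto simp: \<phi>_def)
qed

lemma fourier_norm_mult_diff:
  fixes \<phi> :: "'g::group_add \<Rightarrow> complex"
  assumes \<phi>: "\<phi> \<in> fourier_algebra"
  shows "fourier_norm (\<lambda>x. \<phi> x * coefficient f g x - coefficient f g x)
    = Sup {cmod (cinner (blinfun_apply (schur \<phi> x - x) f) g) | x. x \<in> group_vN \<and> norm x \<le> 1}"
  unfolding fourier_norm_def predual_norm_def
  by (intro arg_cong[of _ _ Sup] Collect_cong ex_cong1) (auto simp: fourier_functional_mult_diff[OF \<phi>])

lemma fourier_cond_iff:
  assumes k: "1 \<le> k"
  shows "(\<exists>(I :: (('g::group_add \<Rightarrow> complex) set \<times> nat) set) le (\<phi> :: _ \<Rightarrow> 'g \<Rightarrow> complex).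
       directed I le \<and>
       (\<forall>\<alpha>\<in>I. \<phi> \<alpha> \<in> fourier_algebra) \<and>
       (\<forall>\<psi>\<in>fourier_algebra.
          ((\<lambda>\<alpha>. fourier_norm (\<lambda>x. \<phi> \<alpha> x * \<psi> x - \<psi> x)) \<longlongrightarrow> 0) (net_filter I le)) \<and>
       (\<forall>\<alpha>\<in>I. \<phi> \<alpha> \<in> cb_multipliers \<and> cb_multiplier_norm (\<phi> \<alpha>) \<le> ennreal k))
    \<longleftrightarrow> weakly_amenable_with TYPE('g) k" (is "?L \<longleftrightarrow> ?A")
proof -
  have k0: "0 \<le> k" using k by simp
  define Q where "Q \<phi> \<longleftrightarrow> \<phi> \<in> fourier_algebra \<and> \<phi> \<in> cb_multipliers \<and> cb_multiplier_norm \<phi> \<le> ennreal k"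
    for \<phi> :: "'g \<Rightarrow> complex"
  define d where "d \<psi> \<phi> = fourier_norm (\<lambda>x. \<phi> x * \<psi> x - \<psi> x)" for \<psi> \<phi> :: "'g \<Rightarrow> complex"
  have "?L \<longleftrightarrow> (\<exists>(I :: (('g \<Rightarrow> complex) set \<times> nat) set) le f. directed I le \<and> (\<forall>i\<in>I. Q (f i)) \<and>
      (\<forall>\<psi>\<in>fourier_algebra. ((\<lambda>i. d \<psi> (f i)) \<longlongrightarrow> 0) (net_filter I le)))"
    unfolding Q_def d_def by (intro arg_cong[of _ _ Ex] ext) auto
  also have "\<dots> \<longleftrightarrow> (\<forall>F e. finite F \<longrightarrow> F \<subseteq> fourier_algebra \<longrightarrow> 0 < e \<longrightarrow> (\<exists>\<phi>. Q \<phi> \<and> (\<forall>\<psi>\<in>F. norm (d \<psi> \<phi>) < e)))"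
    by (rule net_iff)
  also have "\<dots> \<longleftrightarrow> ?A"
  proof
    assume ex: "\<forall>F e. finite F \<longrightarrow> F \<subseteq> fourier_algebra \<longrightarrow> 0 < e \<longrightarrow> (\<exists>\<phi>. Q \<phi> \<and> (\<forall>\<psi>\<in>F. norm (d \<psi> \<phi>) < e))"
    show ?A
      unfolding weakly_amenable_with_def
    proof (intro allI impI)
      fix P :: "'g set" and e :: real assume P: "finite P" "0 < e"
      \<comment> \<open>The indicator function of \<open>p\<close>. At
        \<open>left_regular p\<close>, of norm at most 1, the functional of \<phi> \<psi> - \<psi>
        takes the value \<open>\<phi> p - 1\<close>, which the Fourier norm therefore
        dominates.\<close>
      define \<psi> where "\<psi> p = coefficient (delta 0) (delta p)" for p :: 'g
      have "finite (\<psi> ` P)" "\<psi> ` P \<subseteq> fourier_algebra"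
        using P by (auto simp: \<psi>_def coefficient_in_fourier_algebra)
      from ex[rule_format, OF this P(2)] obtain \<phi> where
        \<phi>: "Q \<phi>" "\<forall>\<psi>'\<in>\<psi> ` P. norm (d \<psi>' \<phi>) < e" by blast
      have \<phi>A: "\<phi> \<in> fourier_algebra" and cb: "cb_norm group_vN (schur \<phi>) \<le> ennreal k"
        using \<phi>(1) by (auto simp: Q_def cb_multiplier_norm_eq)
      have "cmod (\<phi> p - 1) < e" if p: "p \<in> P" for p
      proof -
        let ?S = "{cmod (cinner (blinfun_apply (schur \<phi> x - x) (delta 0)) (delta p)) | x. x \<in> group_vN \<and> norm x \<le> 1}"
        have "bdd_above ?S"
        proof (rule bdd_aboveI, clarify)
          fix x :: "'g op" assume x: "x \<in> group_vN" "norm x \<le> 1"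
          have "cmod (cinner (blinfun_apply (schur \<phi> x - x) (delta 0)) (delta p)) \<le> norm (schur \<phi> x - x)"
            using cmod_cinner_op_le[of "schur \<phi> x - x" "delta 0" "delta p"] by simp
          also have "\<dots> \<le> (k + 1) * norm x" by (rule norm_schur_diff_le[OF \<phi>A cb k0 x(1)])
          also have "\<dots> \<le> k + 1" using x k by (intro mult_left_le) auto
          finally show "cmod (cinner (blinfun_apply (schur \<phi> x - x) (delta 0)) (delta p)) \<le> k + 1" .
        qed
        moreover have "cmod (\<phi> p - 1) = cmod (cinner (blinfun_apply (schur \<phi> (left_regular p) - left_regular p) (delta 0)) (delta p))"
          by (simp add: schur_left_regular[OF \<phi>A] blinfun.diff_left op_scale_apply)
        then have "cmod (\<phi> p - 1) \<in> ?S"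
          using norm_left_regular_le group_vN_intros(5) by blast
        ultimately have "cmod (\<phi> p - 1) \<le> Sup ?S" by (intro cSup_upper)
        also have "\<dots> = d (\<psi> p) \<phi>" unfolding d_def \<psi>_def fourier_norm_mult_diff[OF \<phi>A] ..
        also have "\<dots> < e" using \<phi>(2) p by force
        finally show ?thesis .
      qed
      then show "\<exists>\<phi>\<in>fourier_algebra. cb_norm group_vN (schur \<phi>) \<le> ennreal k \<and> (\<forall>p\<in>P. cmod (\<phi> p - 1) < e)"
        using \<phi>A cb by blast
    qed
  next
    assume A: ?A
    show "\<forall>F e. finite F \<longrightarrow> F \<subseteq> fourier_algebra \<longrightarrow> 0 < e \<longrightarrow> (\<exists>\<phi>. Q \<phi> \<and> (\<forall>\<psi>\<in>F. norm (d \<psi> \<phi>) < e))"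
    proof (intro allI impI)
      fix F :: "('g \<Rightarrow> complex) set" and e :: real
      assume F: "finite F" "F \<subseteq> fourier_algebra" "0 < e"
      have "eventually_near_one k (\<lambda>\<phi>. \<forall>\<psi>\<in>F. norm (d \<psi> \<phi>) < e)"
      proof (rule eventually_near_one_ball_finite[OF F(1)])
        fix \<psi> assume "\<psi> \<in> F"
        then have "\<psi> \<in> fourier_algebra" using F(2) by blast
        then obtain f g where \<psi>: "\<psi> = coefficient f g" by (auto simp: fourier_algebra_iff)
        \<comment> \<open>Half of \<open>e\<close>, since a supremum preserves only weak
          inequalities.\<close>
        have "eventually_near_one k (\<lambda>\<phi>. \<forall>x\<in>group_vN. cmod (cinner (blinfun_apply (schur \<phi> x - x) f) g) \<le> e / 2 * norm x)"
          using k0 F(3) by (intro coefficient_eventually) auto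
        then show "eventually_near_one k (\<lambda>\<phi>. norm (d \<psi> \<phi>) < e)"
        proof (rule eventually_near_one_mono)
          fix \<phi> :: "'g \<Rightarrow> complex"
          assume \<phi>: "\<phi> \<in> fourier_algebra"
            and near: "\<forall>x\<in>group_vN. cmod (cinner (blinfun_apply (schur \<phi> x - x) f) g) \<le> e / 2 * norm x"
          let ?S = "{cmod (cinner (blinfun_apply (schur \<phi> x - x) f) g) | x. x \<in> group_vN \<and> norm x \<le> 1}"
          have le: "s \<le> e / 2" if "s \<in> ?S" for s
          proof -
            obtain x where x: "x \<in> group_vN" "norm x \<le> 1" "s = cmod (cinner (blinfun_apply (schur \<phi> x - x) f) g)"
              using \<open>s \<in> ?S\<close> by blast
            have "s \<le> e / 2 * norm x" using near x by blast
            also have "\<dots> \<le> e / 2" using x F(3) by (intro mult_left_le) auto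
            finally show ?thesis .
          qed
          have mem: "cmod (cinner (blinfun_apply (schur \<phi> 0 - 0) f) g) \<in> ?S" by force
          then have "Sup ?S \<le> e / 2" using le by (intro cSup_least) auto
          moreover have "0 \<le> Sup ?S"
            by (rule order_trans[OF norm_ge_zero cSup_upper[OF mem]]) (rule bdd_aboveI, rule le)
          ultimately show "norm (d \<psi> \<phi>) < e"
            unfolding d_def \<psi> fourier_norm_mult_diff[OF \<phi>] using F(3) by simp
        qed
      qed
      from eventually_near_one_ex[OF A k this] obtain \<phi> where
        \<phi>: "\<phi> \<in> fourier_algebra" "finite {x. \<phi> x \<noteq> 0}" "cb_norm group_vN (schur \<phi>) \<le> ennreal k"
        "\<forall>\<psi>\<in>F. norm (d \<psi> \<phi>) < e" .
      \<comment> \<open>Any product with the finitely supported \<phi> is finitely supported, hence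
        square summable and in the Fourier algebra.\<close>
      have "\<phi> \<in> fourier_multipliers"
        unfolding fourier_multipliers_def
      proof (intro CollectI ballI square_summable_in_fourier_algebra finite_nonzero_values_imp_summable_on)
        fix \<psi> show "finite {x \<in> UNIV. (cmod (\<phi> x * \<psi> x))\<^sup>2 \<noteq> 0}"
          by (rule finite_subset[OF _ \<phi>(2)]) auto
      qed
      moreover have "cb_multiplier_norm \<phi> \<le> ennreal k" using \<phi> by (simp add: cb_multiplier_norm_eq)
      moreover from this have "cb_multiplier_norm \<phi> < \<infinity>" using le_less_trans[OF _ ennreal_less_top] by (simp add: infinity_ennreal_def)
      ultimately have "Q \<phi>" using \<phi>(1) by (simp add: Q_def cb_multipliers_def)
      then show "\<exists>\<phi>. Q \<phi> \<and> (\<forall>\<psi>\<in>F. norm (d \<psi> \<phi>) < e)" using \<phi>(4) by blast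
    qed
  qed
  finally show ?thesis .
qed

lemma op_scale_reduced_Cstar: "x \<in> reduced_Cstar \<Longrightarrow> op_scale c x \<in> reduced_Cstar"
proof -
  assume "x \<in> reduced_Cstar"
  then obtain X where X: "\<And>n. X n \<in> op_span (range left_regular)" "X \<longlonglongrightarrow> x"
    unfolding reduced_Cstar_def closure_sequential by blast
  have add: "op_scale c (x + y) = op_scale c x + op_scale c y" for x y :: "'a op"
    by (rule op_complex.scale_right_distrib)
  have "bounded_linear (op_scale c :: 'a op \<Rightarrow> 'a op)"
    by (rule bounded_linear_intro[where K = "cmod c"])
      (auto simp: add norm_op_scale op_scale_apply blinfun.scaleR_left scaleR_eq_ell2_scale mult.commute
        intro!: blinfun_eqI)
  then have "(\<lambda>n. op_scale c (X n)) \<longlonglongrightarrow> op_scale c x" by (rule bounded_linear.tendsto) (rule X)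
  moreover have "\<forall>n. op_scale c (X n) \<in> op_span (range left_regular)"
    using op_complex.span_scale[OF X(1)] by blast
  ultimately show "op_scale c x \<in> reduced_Cstar"
    unfolding reduced_Cstar_def closure_sequential by (intro exI[of _ "\<lambda>n. op_scale c (X n)"] conjI)
qed

text \<open>The range lies in the span of finitely many \<open>left_regular p\<close>, which is
  contained in each of the two algebras; \<open>V\<close> stands for either.\<close>

lemma schur_finite_support_maps:
  assumes \<phi>: "\<phi> \<in> fourier_algebra" "finite {x. \<phi> x \<noteq> 0}" "cb_norm group_vN (schur \<phi>) \<le> ennreal k"
    and V: "op_span (range left_regular) \<subseteq> V" "V \<subseteq> group_vN"
  shows "schur \<phi> \<in> linear_maps_on V" "finite_rank_on V (schur \<phi>)" "cb_norm V (schur \<phi>) \<le> ennreal k"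
proof -
  have span: "schur \<phi> x \<in> op_span (left_regular ` {p. \<phi> p \<noteq> 0})" if "x \<in> V" for x
    using schur_finite_support_span[OF \<phi>(1,2)] V(2) that by blast
  moreover have "op_span (left_regular ` {p. \<phi> p \<noteq> 0}) \<subseteq> op_span (range left_regular)"
    by (rule op_complex.span_mono) auto
  ultimately show "schur \<phi> \<in> linear_maps_on V"
    using V clinear_on_schur[OF \<phi>(1) V(2)] by (auto simp: linear_maps_on_def)
  show "finite_rank_on V (schur \<phi>)"
    unfolding finite_rank_on_def using \<phi>(2) span by (intro exI[of _ "left_regular ` {p. \<phi> p \<noteq> 0}"]) auto
  show "cb_norm V (schur \<phi>) \<le> ennreal k" using cb_norm_mono[OF V(2)] \<phi>(3) by (rule order_trans)
qed

lemma Cstar_cond_iff: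
  assumes k: "1 \<le> k"
  shows "(\<exists>(I :: ('g::group_add op set \<times> nat) set) le (T :: _ \<Rightarrow> 'g op \<Rightarrow> 'g op).
       directed I le \<and>
       (\<forall>\<alpha>\<in>I. T \<alpha> \<in> linear_maps_on reduced_Cstar \<and> finite_rank_on reduced_Cstar (T \<alpha>) \<and>
              cb_norm reduced_Cstar (T \<alpha>) \<le> ennreal k) \<and>
       (\<forall>x\<in>reduced_Cstar. ((\<lambda>\<alpha>. norm (T \<alpha> x - x)) \<longlongrightarrow> 0) (net_filter I le)))
    \<longleftrightarrow> weakly_amenable_with TYPE('g) k" (is "_ \<longleftrightarrow> ?A")
proof -
  have k0: "0 \<le> k" using k by simp
  show ?thesis
    unfolding net_iff[where Q = "\<lambda>T. T \<in> linear_maps_on reduced_Cstar \<and> finite_rank_on reduced_Cstar T \<and>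
        cb_norm reduced_Cstar T \<le> ennreal k" and d = "\<lambda>x (T :: 'g op \<Rightarrow> 'g op). norm (T x - x)"]
  proof
    assume ex: "\<forall>F e. finite F \<longrightarrow> F \<subseteq> reduced_Cstar \<longrightarrow> 0 < e \<longrightarrow>
      (\<exists>T. (T \<in> linear_maps_on reduced_Cstar \<and> finite_rank_on reduced_Cstar T \<and>
        cb_norm reduced_Cstar T \<le> ennreal k) \<and> (\<forall>x\<in>F. norm (norm (T x - x :: 'g op)) < e))"
    show ?A
    proof (rule weakly_amenable_with_of_maps[OF _ _ reduced_Cstar_subset k0])
      fix P :: "'g set" and e :: real assume "finite P" "0 < e"
      then obtain T where T: "T \<in> linear_maps_on reduced_Cstar" "finite_rank_on reduced_Cstar T"
          "cb_norm reduced_Cstar T \<le> ennreal k"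
        and near: "\<forall>x\<in>left_regular ` P. norm (norm (T x - x :: 'g op)) < e"
        using ex[rule_format, of "left_regular ` P" e] left_regular_in_reduced_Cstar by blast
      have "cmod (entry (T (left_regular p) - left_regular p) p 0) < e" if "p \<in> P" for p
        using near that le_less_trans[OF cmod_entry_le] by fastforce
      then show "\<exists>T. T \<in> linear_maps_on reduced_Cstar \<and> finite_rank_on reduced_Cstar T \<and>
          cb_norm reduced_Cstar T \<le> ennreal k \<and> (\<forall>p\<in>P. cmod (entry (T (left_regular p) - left_regular p) p 0) < e)"
        using T by blast
    qed (auto simp: left_regular_in_reduced_Cstar op_scale_reduced_Cstar)
  next
    assume A: ?A
    show "\<forall>F e. finite F \<longrightarrow> F \<subseteq> reduced_Cstar \<longrightarrow> 0 < e \<longrightarrow>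
      (\<exists>T. (T \<in> linear_maps_on reduced_Cstar \<and> finite_rank_on reduced_Cstar T \<and>
        cb_norm reduced_Cstar T \<le> ennreal k) \<and> (\<forall>x\<in>F. norm (norm (T x - x :: 'g op)) < e))"
    proof (intro allI impI)
      fix F :: "'g op set" and e :: real assume F: "finite F" "F \<subseteq> reduced_Cstar" "0 < e"
      have "eventually_near_one k (\<lambda>\<phi>. \<forall>x\<in>F. norm (schur \<phi> x - x) < e)"
        using F by (intro eventually_near_one_ball_finite reduced_Cstar_eventually k0) auto
      from eventually_near_one_ex[OF A k this] obtain \<phi> where
        \<phi>: "\<phi> \<in> fourier_algebra" "finite {x. \<phi> x \<noteq> 0}" "cb_norm group_vN (schur \<phi>) \<le> ennreal k"
        "\<forall>x\<in>F. norm (schur \<phi> x - x) < e" .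
      have "op_span (range left_regular) \<subseteq> (reduced_Cstar :: 'g op set)"
        unfolding reduced_Cstar_def by (rule closure_subset)
      from schur_finite_support_maps[OF \<phi>(1-3) this reduced_Cstar_subset] \<phi>(4)
      show "\<exists>T. (T \<in> linear_maps_on reduced_Cstar \<and> finite_rank_on reduced_Cstar T \<and>
        cb_norm reduced_Cstar T \<le> ennreal k) \<and> (\<forall>x\<in>F. norm (norm (T x - x :: 'g op)) < e)"
        by (intro exI[of _ "schur \<phi>"]) simp
    qed
  qed
qed

lemma vN_cond_iff:
  assumes k: "1 \<le> k"
  shows "(\<exists>(I :: (('g::group_add op \<times> ('g op \<Rightarrow> complex)) set \<times> nat) set) le (T :: _ \<Rightarrow> 'g op \<Rightarrow> 'g op).
       directed I le \<and>
       (\<forall>\<alpha>\<in>I. T \<alpha> \<in> linear_maps_on group_vN \<and> finite_rank_on group_vN (T \<alpha>) \<and>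
              continuous_map sigma_weak_vN sigma_weak_vN (T \<alpha>) \<and>
              cb_norm group_vN (T \<alpha>) \<le> ennreal k) \<and>
       (\<forall>x\<in>group_vN. \<forall>\<phi>\<in>vN_predual.
          ((\<lambda>\<alpha>. \<phi> (T \<alpha> x - x)) \<longlongrightarrow> 0) (net_filter I le)))
    \<longleftrightarrow> weakly_amenable_with TYPE('g) k" (is "?L \<longleftrightarrow> ?A")
proof -
  have k0: "0 \<le> k" using k by simp
  define Q where "Q T \<longleftrightarrow> T \<in> linear_maps_on group_vN \<and> finite_rank_on group_vN T \<and>
      continuous_map sigma_weak_vN sigma_weak_vN T \<and> cb_norm group_vN T \<le> ennreal k" for T :: "'g op \<Rightarrow> 'g op"
  \<comment> \<open>The parameter is a pair of an operator and a functional, so that convergence in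
    both fits \<open>net_iff\<close>.\<close>
  define d where "d p T = snd p (T (fst p) - fst p)" for p :: "'g op \<times> ('g op \<Rightarrow> complex)" and T
  have "?L \<longleftrightarrow> (\<exists>(I :: (('g op \<times> ('g op \<Rightarrow> complex)) set \<times> nat) set) le T. directed I le \<and> (\<forall>i\<in>I. Q (T i)) \<and>
      (\<forall>p\<in>group_vN \<times> vN_predual. ((\<lambda>i. d p (T i)) \<longlongrightarrow> 0) (net_filter I le)))"
    unfolding Q_def d_def by (intro arg_cong[of _ _ Ex] ext) auto
  also have "\<dots> \<longleftrightarrow> (\<forall>F e. finite F \<longrightarrow> F \<subseteq> group_vN \<times> vN_predual \<longrightarrow> 0 < e \<longrightarrow> (\<exists>T. Q T \<and> (\<forall>p\<in>F. norm (d p T) < e)))"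
    by (rule net_iff)
  also have "\<dots> \<longleftrightarrow> ?A"
  proof
    assume ex: "\<forall>F e. finite F \<longrightarrow> F \<subseteq> group_vN \<times> vN_predual \<longrightarrow> 0 < e \<longrightarrow> (\<exists>T. Q T \<and> (\<forall>p\<in>F. norm (d p T) < e))"
    show ?A
    proof (rule weakly_amenable_with_of_maps[OF _ _ order_refl k0])
      fix P :: "'g set" and e :: real assume P: "finite P" "0 < e"
      \<comment> \<open>The vector functional that reads off the entry at \<open>(p, 0)\<close>, as
        \<open>weakly_amenable_with_of_maps\<close> asks.\<close>
      define \<omega> where "\<omega> p = restrict (\<lambda>x. cinner (blinfun_apply x (delta 0)) (delta p)) (group_vN :: 'g op set)" for p :: 'g
      have "\<omega> p \<in> vN_predual" for p
        unfolding \<omega>_def by (rule restrict_normal_functional_in_predual[OF normal_functionals_cinner])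
      then have "finite ((\<lambda>p. (left_regular p, \<omega> p)) ` P)" "(\<lambda>p. (left_regular p, \<omega> p)) ` P \<subseteq> group_vN \<times> vN_predual"
        using P by auto
      then obtain T where T: "Q T" and near: "\<forall>q\<in>(\<lambda>p. (left_regular p, \<omega> p)) ` P. norm (d q T) < e"
        using ex P(2) by blast
      have "cmod (entry (T (left_regular p) - left_regular p) p 0) < e" if "p \<in> P" for p
      proof -
        have "T (left_regular p) \<in> group_vN" using T by (auto simp: Q_def linear_maps_on_def)
        then have "T (left_regular p) - left_regular p \<in> group_vN" by simp
        then have "d (left_regular p, \<omega> p) T = entry (T (left_regular p) - left_regular p) p 0"
          unfolding d_def \<omega>_def entry_def by simp
        moreover have "norm (d (left_regular p, \<omega> p) T) < e" using near that by blast
        ultimately show ?thesis by simp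
      qed
      then show "\<exists>T. T \<in> linear_maps_on group_vN \<and> finite_rank_on group_vN T \<and>
          cb_norm group_vN T \<le> ennreal k \<and> (\<forall>p\<in>P. cmod (entry (T (left_regular p) - left_regular p) p 0) < e)"
        using T unfolding Q_def by blast
    qed auto
  next
    assume A: ?A
    show "\<forall>F e. finite F \<longrightarrow> F \<subseteq> group_vN \<times> vN_predual \<longrightarrow> 0 < e \<longrightarrow> (\<exists>T. Q T \<and> (\<forall>p\<in>F. norm (d p T) < e))"
    proof (intro allI impI)
      fix F :: "('g op \<times> ('g op \<Rightarrow> complex)) set" and e :: real
      assume F: "finite F" "F \<subseteq> group_vN \<times> vN_predual" "0 < e"
      have "eventually_near_one k (\<lambda>\<phi>. \<forall>p\<in>F. norm (d p (schur \<phi>)) < e)"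
      proof (rule eventually_near_one_ball_finite[OF F(1)])
        fix p assume "p \<in> F"
        then have p: "fst p \<in> group_vN" "snd p \<in> vN_predual" using F(2) by auto
        obtain \<nu> where \<nu>: "\<nu> \<in> normal_functionals" "\<And>x. x \<in> group_vN \<Longrightarrow> snd p x = \<nu> x"
          using predual_normal[OF p(2)] by blast
        show "eventually_near_one k (\<lambda>\<phi>. norm (d p (schur \<phi>)) < e)"
          by (rule eventually_near_one_mono[OF normal_functional_eventually[OF \<nu>(1) p(1) k0 F(3)]])
            (simp add: d_def \<nu>(2) p(1))
      qed
      from eventually_near_one_ex[OF A k this] obtain \<phi> where
        \<phi>: "\<phi> \<in> fourier_algebra" "finite {x. \<phi> x \<noteq> 0}" "cb_norm group_vN (schur \<phi>) \<le> ennreal k"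
        "\<forall>p\<in>F. norm (d p (schur \<phi>)) < e" .
      have "Q (schur \<phi>)"
        using schur_finite_support_maps[OF \<phi>(1-3) op_span_left_regular_subset order_refl]
          schur_sigma_weak_continuous[OF \<phi>(1,2)] by (simp add: Q_def)
      then show "\<exists>T. Q T \<and> (\<forall>p\<in>F. norm (d p T) < e)" using \<phi>(4) by blast
    qed
  qed
  finally show ?thesis .
qed

theorem theorem2p6:
  fixes k :: real
  assumes "k \<ge> 1"
  shows "let cond1 =
    (\<exists>(I :: (('g::group_add \<Rightarrow> complex) set \<times> nat) set) le (\<phi> :: _ \<Rightarrow> 'g \<Rightarrow> complex).
       directed I le \<and>
       (\<forall>\<alpha>\<in>I. \<phi> \<alpha> \<in> fourier_algebra) \<and>
       (\<forall>\<psi>\<in>fourier_algebra.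
          ((\<lambda>\<alpha>. fourier_norm (\<lambda>x. \<phi> \<alpha> x * \<psi> x - \<psi> x)) \<longlongrightarrow> 0) (net_filter I le)) \<and>
       (\<forall>\<alpha>\<in>I. \<phi> \<alpha> \<in> cb_multipliers \<and> cb_multiplier_norm (\<phi> \<alpha>) \<le> ennreal k));
    cond2 =
    (\<exists>(I :: ('g op set \<times> nat) set) le (T :: _ \<Rightarrow> 'g op \<Rightarrow> 'g op).
       directed I le \<and>
       (\<forall>\<alpha>\<in>I. T \<alpha> \<in> linear_maps_on reduced_Cstar \<and> finite_rank_on reduced_Cstar (T \<alpha>) \<and>
              cb_norm reduced_Cstar (T \<alpha>) \<le> ennreal k) \<and>
       (\<forall>x\<in>reduced_Cstar. ((\<lambda>\<alpha>. norm (T \<alpha> x - x)) \<longlongrightarrow> 0) (net_filter I le)));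
    cond3 =
    (\<exists>(I :: (('g op \<times> ('g op \<Rightarrow> complex)) set \<times> nat) set) le (T :: _ \<Rightarrow> 'g op \<Rightarrow> 'g op).
       directed I le \<and>
       (\<forall>\<alpha>\<in>I. T \<alpha> \<in> linear_maps_on group_vN \<and> finite_rank_on group_vN (T \<alpha>) \<and>
              continuous_map sigma_weak_vN sigma_weak_vN (T \<alpha>) \<and>
              cb_norm group_vN (T \<alpha>) \<le> ennreal k) \<and>
       (\<forall>x\<in>group_vN. \<forall>\<phi>\<in>vN_predual.
          ((\<lambda>\<alpha>. \<phi> (T \<alpha> x - x)) \<longlongrightarrow> 0) (net_filter I le)))
    in (cond1 \<longleftrightarrow> cond2) \<and> (cond2 \<longleftrightarrow> cond3)"
  unfolding Let_def fourier_cond_iff[OF assms] Cstar_cond_iff[OF assms] vN_cond_iff[OF assms] by simp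

end
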